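(* Consider the Sturm--Liouville type equation $$\phi(x)\,\mathbb{D}_x^2y(x)+\psi(x)\,\mathbb{S}_x\mathbb{D}_xy(x)+\lambda_n\,y(x)=0, \qquad ( * )$$ where $\phi$ is a polynomial of degree at most $2$, $\psi$ is a polynomial of degree $1$ (both independent of $n$), and $\lambda_n$ is a constant. The equation $( * )$ has a polynomial solution $P_n(x)$ of degree $n$ for $n=0,1,2,3,\dots$ if and only if the following holds (with parameters $a,b,c,d$ independent of $n$). (1) On the lattice $x(s)=c_1q^{-s}+c_2q^{s}$, $c_1c_2\neq 0$, $q\neq 1$: with $u=c_2/c_1$, $P_n(x(s))$ is, up to a multiplicative constant, equal to $${}_4\phi_3\left(\begin{matrix} q^{-n},\,u^2abcdq^{n-1},\,aq^{-s},\,auq^{s}\\ abu,\,acu,\,adu\end{matrix};q,q\right)=\frac{\big(u^{1/2}a\big)^n\,p_n\!\left(\frac{u^{1/2}q^{s}+u^{-1/2}q^{-s}}{2};u^{1/2}a,u^{1/2}b,u^{1/2}c,u^{1/2}d\,\Big|\,q\right)}{(abu;q)_n(acu;q)_n(adu;q)_n},$$ or to one of its subcases, including the limiting cases as one or more of the parameters $a,b,c,d$ tend to $\infty$. (2) On the lattice $x(s)=c_4s^2+c_5s$, $c_4\neq 0$: with $u=c_5/c_4$, $P_n(x(s))$ is, up to a multiplicative constant, equal to $${}_4F_3\left(\begin{matrix}-n,\,a+b+c+d+2u+n-1,\,a-s,\,a+u+s\\ a+b+u,\,a+c+u,\,a+d+u\end{matrix};1\right)=\frac{W_n\!\left(-\left(s+\frac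 u2\right)^2;a+\frac u2,b+\frac u2,c+\frac u2,d+\frac u2\right)}{(a+b+u)_n(a+c+u)_n(a+d+u)_n},$$ or to $${}_3F_2\left(\begin{matrix}-n,\,a-s,\,a+u+s\\ a+b+u,\,a+c+u\end{matrix};1\right)=\frac{S_n\!\left(-\left(s+\frac u2\right)^2;a+\frac u2,b+\frac u2,c+\frac u2\right)}{(a+b+u)_n(a+c+u)_n}.$$
   Context: Operators: for a lattice $x(s)$ and a polynomial $f$, $\mathbb{D}_xf(x(s))=\dfrac{f(x(s+\frac12))-f(x(s-\frac12))}{x(s+\frac12)-x(s-\frac12)}$ and $\mathbb{S}_xf(x(s))=\dfrac{f(x(s+\frac12))+f(x(s-\frac12))}{2}$; both map polynomials in $x$ to polynomials in $x$. Here $q>0$ is fixed. Hypergeometric notation: $(a;q)_0=1$, $(a;q)_k=\prod_{j=0}^{k-1}(1-aq^j)$; $(a)_0=1$, $(a)_k=\prod_{j=0}^{k-1}(a+j)$; ${}_{s+1}\phi_s(a_1,\dots,a_{s+1};b_1,\dots,b_s;q,z)=\sum_{k\ge0}\frac{(a_1;q)_k\cdots(a_{s+1};q)_k}{(b_1;q)_k\cdots(b_s;q)_k}\frac{z^k}{(q;q)_k}$; ${}_{s+1}F_s(a_1,\dots,a_{s+1};b_1,\dots,b_s;z)=\sum_{k\ge0}\frac{(a_1)_k\cdots(a_{s+1})_k}{(b_1)_k\cdots(b_s)_k}\frac{z^k}{k!}$. Askey--Wilson polynomials: $\dfrac{a^np_n(x;a,b,c,d|q)}{(ab;q)_n(ac;q)_n(ad;q)_n}={}_4\phi_3(q^{-n},abcdq^{n-1},ae^{-i\theta},ae^{i\theta};ab,ac,ad;q,q)$,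 $x=\cos\theta=\frac{e^{i\theta}+e^{-i\theta}}2$ ($e^{i\theta}$ may be any nonzero complex number), with $p_n$ extended by continuity in the parameters. Wilson polynomials: $\dfrac{W_n(t^2;a,b,c,d)}{(a+b)_n(a+c)_n(a+d)_n}={}_4F_3(-n,n+a+b+c+d-1,a-it,a+it;a+b,a+c,a+d;1)$. Continuous dual Hahn polynomials: $\dfrac{S_n(t^2;a,b,c)}{(a+b)_n(a+c)_n}={}_3F_2(-n,a-it,a+it;a+b,a+c;1)$. "Limiting cases as one or more parameters tend to $\infty$" means coefficientwise limits of suitably normalized (e.g. monic) multiples of these polynomials as one or more of the parameters tend to $\infty$; "subcases" are obtained by specializing parameters (e.g. setting some equal to $0$).
   Formalization: The solution P_n of degree n is required to be unique up to a multiplicative constant; without this the claim fails, e.g. x(s)=s^2, phi=x^2, psi=-x, P_2=x^2-x+1, where lambda_0=lambda_2. For arbitrary solutions, the form is asserted for those n where P_n is unique. *)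

theory Defs
  imports "HOL-Analysis.Analysis" "HOL-Computational_Algebra.Polynomial"
begin

section \<open>Lattices and the operators on polynomials\<close>

definition q_lattice :: "real \<Rightarrow> complex \<Rightarrow> complex \<Rightarrow> complex \<Rightarrow> complex" where
  "q_lattice q c1 c2 s = c1 * of_real q powr (- s) + c2 * of_real q powr s"

definition quad_lattice :: "complex \<Rightarrow> complex \<Rightarrow> complex \<Rightarrow> complex" where
  "quad_lattice c4 c5 s = c4 * s\<^sup>2 + c5 * s"

text \<open>Both operators return the polynomial whose value at \<open>x s\<close> is the stated quotient
  or average. On the lattices above this polynomial exists, and it is unique because \<open>x\<close> takes
  infinitely many values. The quotient is only required where its denominator is nonzero.\<close>

definition Dx :: "(complex \<Rightarrow> complex) \<Rightarrow> complex poly \<Rightarrow> complex poly" where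
  "Dx x f = (THE g. \<forall>s. x (s + 1/2) \<noteq> x (s - 1/2) \<longrightarrow>
     poly g (x s) = (poly f (x (s + 1/2)) - poly f (x (s - 1/2))) / (x (s + 1/2) - x (s - 1/2)))"

definition Sx :: "(complex \<Rightarrow> complex) \<Rightarrow> complex poly \<Rightarrow> complex poly" where
  "Sx x f = (THE g. \<forall>s. poly g (x s) = (poly f (x (s + 1/2)) + poly f (x (s - 1/2))) / 2)"

definition sl_solution ::
  "(complex \<Rightarrow> complex) \<Rightarrow> complex poly \<Rightarrow> complex poly \<Rightarrow> complex \<Rightarrow> nat \<Rightarrow> complex poly \<Rightarrow> bool" where
  "sl_solution x \<phi> \<psi> l n y \<longleftrightarrow>
     y \<noteq> 0 \<and> degree y = n \<and> \<phi> * Dx x (Dx x y) + \<psi> * Sx x (Dx x y) + smult l y = 0"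

text \<open>The solution of degree \<open>n\<close> is determined up to a multiplicative constant; this can fail
  (only) when the constants \<open>l\<close> for two different degrees coincide.\<close>

definition sl_unique ::
  "(complex \<Rightarrow> complex) \<Rightarrow> complex poly \<Rightarrow> complex poly \<Rightarrow> complex \<Rightarrow> nat \<Rightarrow> bool" where
  "sl_unique x \<phi> \<psi> l n \<longleftrightarrow>
     (\<forall>y z. sl_solution x \<phi> \<psi> l n y \<longrightarrow> sl_solution x \<phi> \<psi> l n z \<longrightarrow> (\<exists>k. z = smult k y))"

section \<open>Hypergeometric series\<close>

definition qpoch :: "complex \<Rightarrow> complex \<Rightarrow> nat \<Rightarrow> complex" where
  "qpoch a q k = (\<Prod>j<k. 1 - a * q ^ j)"

text \<open>The next two are the series with as many lower parameters as upper ones less one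
  (so that no extra power of \<open>(- 1) ^ k * q ^ (k choose 2)\<close> occurs in the first).\<close>

definition basic_hyp :: "complex list \<Rightarrow> complex list \<Rightarrow> complex \<Rightarrow> complex \<Rightarrow> complex" where
  "basic_hyp as bs q z =
     (\<Sum>k. (\<Prod>a\<leftarrow>as. qpoch a q k) / (\<Prod>b\<leftarrow>bs. qpoch b q k) * (z ^ k / qpoch q q k))"

definition hyp :: "complex list \<Rightarrow> complex list \<Rightarrow> complex \<Rightarrow> complex" where
  "hyp as bs z =
     (\<Sum>k. (\<Prod>a\<leftarrow>as. pochhammer a k) / (\<Prod>b\<leftarrow>bs. pochhammer b k) * (z ^ k / fact k))"

section \<open>Askey--Wilson polynomials\<close>

definition aw_phi ::
  "real \<Rightarrow> nat \<Rightarrow> complex \<Rightarrow> complex \<Rightarrow> complex \<Rightarrow> complex \<Rightarrow> complex \<Rightarrow> complex" where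
  "aw_phi q n a b c d z =
     basic_hyp [of_real q powi (- int n), a * b * c * d * of_real q powi (int n - 1), a / z, a * z]
       [a * b, a * c, a * d] (of_real q) (of_real q)"

definition aw_generic :: "real \<Rightarrow> nat \<Rightarrow> (complex \<times> complex \<times> complex \<times> complex) set" where
  "aw_generic q n = {(a, b, c, d). a \<noteq> 0 \<and> qpoch (a * b) (of_real q) n \<noteq> 0 \<and>
     qpoch (a * c) (of_real q) n \<noteq> 0 \<and> qpoch (a * d) (of_real q) n \<noteq> 0}"

text \<open>The polynomial \<open>p\<^sub>n(x; a, b, c, d | q)\<close> in \<open>x = (z + 1 / z) / 2\<close>, where \<open>z\<close> stands for
  \<open>e\<^sup>i\<^sup>\<theta>\<close>. The limit over \<open>aw_generic\<close> is the extension by continuity in the parameters; at a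
  generic tuple it is the value of the hypergeometric expression itself.\<close>

definition askey_wilson ::
  "real \<Rightarrow> nat \<Rightarrow> complex \<Rightarrow> complex \<Rightarrow> complex \<Rightarrow> complex \<Rightarrow> complex poly" where
  "askey_wilson q n a b c d = (THE p. \<forall>z. z \<noteq> 0 \<longrightarrow>
     ((\<lambda>(a, b, c, d). qpoch (a * b) (of_real q) n * qpoch (a * c) (of_real q) n *
          qpoch (a * d) (of_real q) n / a ^ n * aw_phi q n a b c d z)
       \<longlongrightarrow> poly p ((z + 1 / z) / 2)) (at (a, b, c, d) within aw_generic q n))"

text \<open>A parameter is either held fixed (\<open>Some v\<close>) or tends to infinity (\<open>None\<close>).\<close>

definition param_filter :: "complex option \<Rightarrow> complex filter" where
  "param_filter v = (case v of None \<Rightarrow> at_infinity | Some v \<Rightarrow> principal {v})"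

text \<open>The Askey--Wilson families with parameters \<open>r * a, r * b, r * c, r * d\<close> together with the
  coefficientwise limits of multiples of them as one or more of \<open>a, b, c, d\<close> tend to infinity.
  Any of the parameters may be \<open>0\<close>. The normalizing factor \<open>\<kappa>\<close> may depend on the degree and on
  the parameters.\<close>

definition askey_wilson_family :: "real \<Rightarrow> complex \<Rightarrow> (nat \<Rightarrow> complex poly) \<Rightarrow> bool" where
  "askey_wilson_family q r R \<longleftrightarrow>
     (\<exists>a b c d. \<forall>n. R n = askey_wilson q n (r * a) (r * b) (r * c) (r * d)) \<or>
     (\<exists>A B C D \<kappa>. None \<in> {A, B, C, D} \<and>
       (\<forall>n i. ((\<lambda>(a, b, c, d).
            \<kappa> n (a, b, c, d) * coeff (askey_wilson q n (r * a) (r * b) (r * c) (r * d)) i)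
          \<longlongrightarrow> coeff (R n) i)
          (param_filter A \<times>\<^sub>F (param_filter B \<times>\<^sub>F (param_filter C \<times>\<^sub>F param_filter D)))))"

section \<open>Wilson and continuous dual Hahn polynomials\<close>

text \<open>Both are polynomials in \<open>t\<^sup>2\<close>, again extended by continuity to the parameters for which
  the hypergeometric series has a zero denominator.\<close>

definition wilson :: "nat \<Rightarrow> complex \<Rightarrow> complex \<Rightarrow> complex \<Rightarrow> complex \<Rightarrow> complex poly" where
  "wilson n a b c d = (THE p. \<forall>t.
     ((\<lambda>(a, b, c, d). pochhammer (a + b) n * pochhammer (a + c) n * pochhammer (a + d) n *
          hyp [- of_nat n, of_nat n + a + b + c + d - 1, a - \<i> * t, a + \<i> * t]
              [a + b, a + c, a + d] 1)
       \<longlongrightarrow> poly p (t\<^sup>2))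
     (at (a, b, c, d) within {(a, b, c, d). pochhammer (a + b) n \<noteq> 0 \<and>
        pochhammer (a + c) n \<noteq> 0 \<and> pochhammer (a + d) n \<noteq> 0}))"

definition cont_dual_hahn :: "nat \<Rightarrow> complex \<Rightarrow> complex \<Rightarrow> complex \<Rightarrow> complex poly" where
  "cont_dual_hahn n a b c = (THE p. \<forall>t.
     ((\<lambda>(a, b, c). pochhammer (a + b) n * pochhammer (a + c) n *
          hyp [- of_nat n, a - \<i> * t, a + \<i> * t] [a + b, a + c] 1)
       \<longlongrightarrow> poly p (t\<^sup>2))
     (at (a, b, c) within {(a, b, c). pochhammer (a + b) n \<noteq> 0 \<and> pochhammer (a + c) n \<noteq> 0}))"

definition wilson_family :: "complex \<Rightarrow> (nat \<Rightarrow> complex poly) \<Rightarrow> bool" where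
  "wilson_family u R \<longleftrightarrow>
     (\<exists>a b c d. \<forall>n. R n = wilson n (a + u/2) (b + u/2) (c + u/2) (d + u/2)) \<or>
     (\<exists>a b c. \<forall>n. R n = cont_dual_hahn n (a + u/2) (b + u/2) (c + u/2))"

end

theory Submission
  imports Defs "HOL-Computational_Algebra.Fundamental_Theorem_Algebra"
begin

text \<open>
  Write \<open>L y = \<phi> D\<^sup>2 y + \<psi> S D y\<close>. On both lattices \<open>L\<close> maps polynomials of degree at most \<open>n\<close> to
  such polynomials and multiplies the coefficient of degree \<open>n\<close> by a number \<open>ev n\<close>, so that the
  equation is the eigenvalue problem of a triangular operator and \<open>\<lambda>\<^sub>n = - ev n\<close>. Hence
  \<open>Q\<^sub>n = (L - ev (n - 1)) \<dots> (L - ev 0) x\<^sup>n\<close> satisfies \<open>L Q\<^sub>n = ev n Q\<^sub>n\<close> by the Cayley--Hamilton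
  argument; it depends polynomially on the coefficients of \<open>\<phi>\<close> and \<open>\<psi>\<close>, it is homogeneous of degree
  \<open>n\<close> in them, and its coefficient of degree \<open>n\<close> is \<open>(ev n - ev 0) \<dots> (ev n - ev (n - 1))\<close>. If
  there are solutions of all degrees, this coefficient is nonzero exactly when the solution of degree
  \<open>n\<close> is unique up to a factor, and then that solution is a multiple of \<open>Q\<^sub>n\<close>. It remains to recognize
  \<open>Q\<^sub>n\<close>.

  After an affine change of the lattice, which turns it into \<open>(z + 1 / z) / 2\<close> with \<open>z\<close> proportional
  to \<open>q\<^sup>s\<close>, or into \<open>- w\<^sup>2\<close> with \<open>w = s + u / 2\<close>, the pairs \<open>(\<phi>, \<psi>)\<close> correspond linearly and
  bijectively to the polynomials of degree at most \<open>4\<close>: the coefficient of the forward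
  difference in \<open>L\<close> is \<open>E z / ((z\<^sup>2 - 1) (q z\<^sup>2 - 1))\<close> in the first case and
  \<open>H w / (2 w (2 w + 1))\<close> in the second. If \<open>1 - a z\<close> divides \<open>E\<close>, then \<open>L\<close> is bidiagonal in the basis
  \<open>(a z; q)\<^sub>k (a / z; q)\<^sub>k\<close> (\<open>Aop_basis\<close>); if \<open>a + w\<close> divides \<open>H\<close>, the same holds for
  \<open>(a + w)\<^sub>k (a - w)\<^sub>k\<close> (\<open>Wop_basis\<close>). For a bidiagonal operator the product defining \<open>Q\<^sub>n\<close> can be
  expanded in closed form (\<open>annihilator_bidiagonal\<close>), and this expansion is the terminating
  hypergeometric series. So for \<open>E = (1 - a z) (1 - b z) (1 - c z) (1 - d z)\<close> the polynomial \<open>Q\<^sub>n\<close> is,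
  up to a constant depending only on \<open>n\<close> and \<open>q\<close>, the Askey--Wilson polynomial; since \<open>Q\<^sub>n\<close> is a
  polynomial in the parameters, this also identifies the extension by continuity, with no
  exceptional parameters. Monic \<open>H\<close> of degree \<open>4\<close> and \<open>3\<close> give the Wilson and the continuous dual
  Hahn polynomials.

  Given an equation, it suffices to factor \<open>E\<close> or \<open>H\<close>. On the quadratic lattice the degree
  of \<open>H\<close> is at least \<open>3\<close> because \<open>\<psi>\<close> has degree \<open>1\<close>. On the \<open>q\<close>-lattice every \<open>E \<noteq> 0\<close> is a multiple
  of a product of four factors \<open>1 - v z\<close> or \<open>- z\<close>, the latter being the limit of \<open>(1 - v z) / v\<close>
  as \<open>v\<close> tends to infinity; so the \<open>Q\<^sub>n\<close> for an \<open>E\<close> that vanishes at \<open>0\<close>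
  form a limiting family. Conversely, an Askey--Wilson or Wilson family whose members have the full degree
  for every \<open>n\<close> has pairwise different \<open>ev n\<close>, hence solves the equation with unique solutions. For
  a limiting family the equation itself passes to the limit; it degenerates only if the lowest and
  the highest coefficient of the limit of \<open>E\<close> both vanish, and then all \<open>ev n\<close> are zero and \<open>L\<close>
  would vanish on all polynomials (\<open>Aop_zero_on_basis\<close>), which is impossible for \<open>E \<noteq> 0\<close>.
\<close>

section \<open>Auxiliary facts about polynomials\<close>

lemma prod_lessThan_3: "(\<Prod>i<3. h i) = h 0 * (h 1 * h 2)" for h :: "nat \<Rightarrow> complex poly"
  by (simp add: eval_nat_numeral mult_ac)

lemma prod_lessThan_4: "(\<Prod>i<4. h i) = h 0 * (h 1 * h 2 * h 3)" for h :: "nat \<Rightarrow> complex poly"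
  by (simp add: eval_nat_numeral mult_ac)

lemma poly_degree4:
  assumes "degree H \<le> 4"
  shows "poly H w = coeff H 0 + coeff H 1 * w + coeff H 2 * w ^ 2 + coeff H 3 * w ^ 3 + coeff H 4 * (w :: complex) ^ 4"
proof -
  have "poly H w = (\<Sum>i\<le>4. coeff H i * w ^ i)"
    unfolding poly_altdef by (rule sum.mono_neutral_left) (use assms in \<open>auto simp: coeff_eq_0\<close>)
  then show ?thesis by (simp add: eval_nat_numeral)
qed

lemma coeff_mult_top:
  assumes "degree (p :: complex poly) \<le> m" "degree q \<le> n"
  shows "coeff (p * q) (m + n) = coeff p m * coeff q n"
proof -
  have "coeff (p * q) (m + n) = (\<Sum>i\<le>m+n. coeff p i * coeff q (m + n - i))" by (rule coeff_mult)
  also have "\<dots> = (\<Sum>i\<in>{m}. coeff p i * coeff q (m + n - i))"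
  proof (rule sum.mono_neutral_right)
    show "\<forall>i\<in>{..m + n} - {m}. coeff p i * coeff q (m + n - i) = 0"
    proof
      fix i assume "i \<in> {..m + n} - {m}"
      then consider "m < i" | "i < m" by fastforce
      then show "coeff p i * coeff q (m + n - i) = 0"
      proof cases
        case 1 then show ?thesis using assms(1) by (simp add: coeff_eq_0)
      next
        case 2 then show ?thesis using assms(2) by (simp add: coeff_eq_0)
      qed
    qed
  qed auto
  finally show ?thesis by simp
qed

section \<open>Triangular operators\<close>

text \<open>The product \<open>(L - ev 0) \<dots> (L - ev (k - 1))\<close> with the factor of the highest index applied
  first: in this order the bound for the degree of the image drops by one with each factor.\<close>
primrec annihilator ::
  "(complex poly \<Rightarrow> complex poly) \<Rightarrow> (nat \<Rightarrow> complex) \<Rightarrow> nat \<Rightarrow> complex poly \<Rightarrow> complex poly" where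
  "annihilator L ev 0 p = p"
| "annihilator L ev (Suc k) p = annihilator L ev k (L p - smult (ev k) p)"

definition eigenpoly ::
  "(complex poly \<Rightarrow> complex poly) \<Rightarrow> (nat \<Rightarrow> complex) \<Rightarrow> nat \<Rightarrow> complex poly" where
  "eigenpoly L ev n = annihilator L ev n (monom 1 n)"

lemma smult_sum_right: "smult c (\<Sum>i\<in>A. f i) = (\<Sum>i\<in>A. smult c (f i))"
  by (induction A rule: infinite_finite_induct) (simp_all add: smult_add_right)

locale linear_poly_operator =
  fixes L :: "complex poly \<Rightarrow> complex poly"
  assumes add: "L (p + q) = L p + L q" and smult: "L (smult c p) = smult c (L p)"
begin

lemma zero: "L 0 = 0"
  using smult[of 0 0] by simp

lemma diff: "L (p - q) = L p - L q"
  using add[of p "smult (-1) q"] smult[of "-1" q] by simp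

lemma sum: "L (\<Sum>i\<in>A. f i) = (\<Sum>i\<in>A. L (f i))"
  by (induction A rule: infinite_finite_induct) (simp_all add: zero add)

lemma annihilator_linear: "linear_poly_operator (annihilator L ev k)"
proof (induction k)
  case 0
  then show ?case by unfold_locales auto
next
  case (Suc k)
  interpret K: linear_poly_operator "annihilator L ev k" by (rule Suc)
  show ?case
  proof
    fix p q c
    have "L (p + q) - smult (ev k) (p + q) = (L p - smult (ev k) p) + (L q - smult (ev k) q)"
      by (simp add: add smult_add_right)
    then show "annihilator L ev (Suc k) (p + q) = annihilator L ev (Suc k) p + annihilator L ev (Suc k) q"
      by (simp add: K.add)
    have "L (smult c p) - smult (ev k) (smult c p) = smult c (L p - smult (ev k) p)"
      by (simp add: smult smult_diff_right mult.commute)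
    then show "annihilator L ev (Suc k) (smult c p) = smult c (annihilator L ev (Suc k) p)"
      by (simp add: K.smult)
  qed
qed

lemma annihilator_commute: "annihilator L ev k (L p) = L (annihilator L ev k p)"
proof (induction k arbitrary: p)
  case (Suc k)
  have "L (L p) - smult (ev k) (L p) = L (L p - smult (ev k) p)" by (simp add: diff smult)
  then show ?case by (simp add: Suc)
qed simp

lemma annihilator_scale:
  "annihilator (\<lambda>p. smult c (L p)) (\<lambda>k. c * ev k) k p = smult (c ^ k) (annihilator L ev k p)"
proof (induction k arbitrary: p)
  case (Suc k)
  interpret K: linear_poly_operator "annihilator L ev k" by (rule annihilator_linear)
  have "smult c (L p) - smult (c * ev k) p = smult c (L p - smult (ev k) p)"
    by (simp add: smult_diff_right)
  then show ?case by (simp add: Suc K.smult mult.commute)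
qed simp

lemma eigenpoly_scale:
  "eigenpoly (\<lambda>p. smult c (L p)) (\<lambda>k. c * ev k) n = smult (c ^ n) (eigenpoly L ev n)"
  unfolding eigenpoly_def by (rule annihilator_scale)

text \<open>Let \<open>W m\<close> be the image of \<open>B n\<close> under the factors with index at least \<open>m\<close>. Its coefficients
  solve the two-term recurrence for an eigenvector, so \<open>(L - ev n) (W (m + 1))\<close> telescopes to a
  multiple of the single basis element \<open>B m\<close>. Replacing \<open>ev n\<close> by \<open>ev m\<close> gives the next \<open>W\<close>. There
  is no division, so coinciding eigenvalues are harmless.\<close>
lemma annihilator_bidiagonal:
  assumes B0: "L (B 0) = smult (ev 0) (B 0)"
    and B: "\<And>k. L (B (Suc k)) = smult (ev (Suc k)) (B (Suc k)) + smult (\<mu> (Suc k)) (B k)"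
  shows "annihilator L ev n (B n) =
    (\<Sum>k\<le>n. smult ((\<Prod>j<k. ev n - ev j) * (\<Prod>i\<in>{k<..n}. \<mu> i)) (B k))"
proof -
  define W where "W m = (\<Sum>k\<in>{m..n}. smult ((\<Prod>j\<in>{m..<k}. ev n - ev j) * (\<Prod>i\<in>{k<..n}. \<mu> i)) (B k))" for m
  have eig: "L (W (Suc m)) - smult (ev n) (W (Suc m)) = smult (\<Prod>i\<in>{m<..n}. \<mu> i) (B m)"
    if "m < n" for m
  proof -
    define c where "c k = (\<Prod>j\<in>{Suc m..<k}. ev n - ev j) * (\<Prod>i\<in>{k<..n}. \<mu> i)" for k
    have c: "\<mu> (Suc k) * c (Suc k) = (ev n - ev k) * c k" if "Suc m \<le> k" "k < n" for k
    proof -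
      have "{Suc m..<Suc k} = insert k {Suc m..<k}" "{k<..n} = insert (Suc k) {Suc k<..n}"
        using that by auto
      then show ?thesis by (simp add: c_def)
    qed
    have L: "L (W (Suc m)) - smult (ev n) (W (Suc m)) =
      (\<Sum>k\<in>{Suc m..n}. smult ((ev k - ev n) * c k) (B k) + smult (\<mu> k * c k) (B (k - 1)))"
    proof -
      have "L (W (Suc m)) - smult (ev n) (W (Suc m)) =
        (\<Sum>k\<in>{Suc m..n}. smult (c k) (L (B k)) - smult (ev n * c k) (B k))"
        unfolding W_def c_def[symmetric]
        by (simp add: sum smult smult_sum_right sum_subtractf)
      also have "\<dots> = (\<Sum>k\<in>{Suc m..n}. smult ((ev k - ev n) * c k) (B k) + smult (\<mu> k * c k) (B (k - 1)))"
      proof (rule sum.cong[OF refl])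
        fix k assume "k \<in> {Suc m..n}"
        then obtain k' where k: "k = Suc k'" by (cases k) auto
        show "smult (c k) (L (B k)) - smult (ev n * c k) (B k) =
          smult ((ev k - ev n) * c k) (B k) + smult (\<mu> k * c k) (B (k - 1))"
          unfolding k B by (simp add: algebra_simps smult_add_right smult_diff_left)
      qed
      finally show ?thesis .
    qed
    have tele: "(\<Sum>k\<in>{Suc m..l}. smult ((ev k - ev n) * c k) (B k) + smult (\<mu> k * c k) (B (k - 1))) =
      smult (\<mu> (Suc m) * c (Suc m)) (B m) + smult ((ev l - ev n) * c l) (B l)"
      if "Suc m \<le> l" "l \<le> n" for l
      using that
    proof (induction l rule: dec_induct)
      case base
      then show ?case by simp
    next
      case (step l)
      have "smult (\<mu> (Suc l) * c (Suc l)) (B l) + smult ((ev l - ev n) * c l) (B l) = 0"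
        using c[of l] step by (simp flip: smult_add_left) (simp add: algebra_simps)
      moreover have "(\<Sum>k\<in>{Suc m..Suc l}. smult ((ev k - ev n) * c k) (B k) + smult (\<mu> k * c k) (B (k - 1))) =
        smult (\<mu> (Suc m) * c (Suc m)) (B m) + smult ((ev l - ev n) * c l) (B l) +
        (smult ((ev (Suc l) - ev n) * c (Suc l)) (B (Suc l)) + smult (\<mu> (Suc l) * c (Suc l)) (B l))"
        using step by simp
      ultimately show ?case by (simp add: algebra_simps)
    qed
    have "{m<..n} = insert (Suc m) {Suc m<..n}" using that by auto
    then have "\<mu> (Suc m) * c (Suc m) = (\<Prod>i\<in>{m<..n}. \<mu> i)" by (simp add: c_def)
    then show ?thesis using L tele[of n] that by simp
  qed
  have step: "L (W (Suc m)) - smult (ev m) (W (Suc m)) = W m" if "m < n" for m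
  proof -
    have "{m..n} = insert m {Suc m..n}" using that by auto
    then have "W m = smult (\<Prod>i\<in>{m<..n}. \<mu> i) (B m) +
      (\<Sum>k\<in>{Suc m..n}. smult ((\<Prod>j\<in>{m..<k}. ev n - ev j) * (\<Prod>i\<in>{k<..n}. \<mu> i)) (B k))"
      unfolding W_def by simp
    also have "(\<Sum>k\<in>{Suc m..n}. smult ((\<Prod>j\<in>{m..<k}. ev n - ev j) * (\<Prod>i\<in>{k<..n}. \<mu> i)) (B k)) =
      smult (ev n - ev m) (W (Suc m))"
      unfolding W_def smult_sum_right
    proof (rule sum.cong[OF refl])
      fix k assume "k \<in> {Suc m..n}"
      then have "{m..<k} = insert m {Suc m..<k}" by auto
      then show "smult ((\<Prod>j\<in>{m..<k}. ev n - ev j) * (\<Prod>i\<in>{k<..n}. \<mu> i)) (B k) =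
        smult (ev n - ev m) (smult ((\<Prod>j\<in>{Suc m..<k}. ev n - ev j) * (\<Prod>i\<in>{k<..n}. \<mu> i)) (B k))"
        by (simp add: mult.assoc)
    qed
    finally show ?thesis
      using eig[OF that] by (simp add: smult_diff_left algebra_simps)
  qed
  have "annihilator L ev m (W m) = W 0" if "m \<le> n" for m
    using that by (induction m) (simp_all add: step)
  from this[of n] have "annihilator L ev n (B n) = W 0" by (simp add: W_def)
  then show ?thesis by (simp add: W_def atMost_atLeast0 lessThan_atLeast0)
qed

end

text \<open>The assumptions mean that the matrix of \<open>L\<close> in the monomial basis is upper triangular with
  diagonal \<open>ev\<close>.\<close>
locale triangular_operator = linear_poly_operator L
  for L :: "complex poly \<Rightarrow> complex poly" +
  fixes ev :: "nat \<Rightarrow> complex"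
  assumes degree_le: "degree p \<le> n \<Longrightarrow> degree (L p) \<le> n"
    and coeff_top: "degree p \<le> n \<Longrightarrow> coeff (L p) n = ev n * coeff p n"
begin

lemma annihilator_kills: "(\<And>i. k \<le> i \<Longrightarrow> coeff p i = 0) \<Longrightarrow> annihilator L ev k p = 0"
proof (induction k arbitrary: p)
  case 0
  then show ?case by (simp add: poly_eq_iff)
next
  case (Suc k)
  have d: "degree p \<le> k" by (rule Polynomial.degree_le) (use Suc.prems in auto)
  have "coeff (L p - smult (ev k) p) i = 0" if "k \<le> i" for i
  proof (cases "i = k")
    case True
    then show ?thesis using coeff_top[OF d] by simp
  next
    case False
    then have "k < i" using that by simp
    then show ?thesis using degree_le[OF d] d by (simp add: coeff_eq_0)
  qed
  then show ?case using Suc.IH by simp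
qed

text \<open>One further factor \<open>L - ev n\<close>, which commutes with the others, would annihilate all
  polynomials of degree at most \<open>n\<close>.\<close>
lemma annihilator_eigen:
  assumes "degree p \<le> n"
  shows "L (annihilator L ev n p) = smult (ev n) (annihilator L ev n p)"
proof -
  interpret K: linear_poly_operator "annihilator L ev n" by (rule annihilator_linear)
  have "annihilator L ev (Suc n) p = 0"
    by (rule annihilator_kills) (use assms in \<open>auto simp: coeff_eq_0\<close>)
  then show ?thesis by (simp add: K.diff K.smult annihilator_commute)
qed

lemma annihilator_degree_coeff:
  assumes "degree p \<le> n"
  shows "degree (annihilator L ev k p) \<le> n \<and>
    coeff (annihilator L ev k p) n = (\<Prod>j<k. ev n - ev j) * coeff p n"
  using assms
proof (induction k arbitrary: p)
  case (Suc k)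
  have d: "degree (L p - smult (ev k) p) \<le> n"
    using degree_le[OF Suc.prems] Suc.prems by (intro degree_diff_le) auto
  show ?case
    using Suc.IH[OF d] coeff_top[OF Suc.prems] by (simp add: algebra_simps)
qed simp

lemma annihilator_eq_eigenpoly:
  assumes "degree p \<le> n"
  shows "annihilator L ev n p = smult (coeff p n) (eigenpoly L ev n)"
proof -
  interpret K: linear_poly_operator "annihilator L ev n" by (rule annihilator_linear)
  have "annihilator L ev n (p - smult (coeff p n) (monom 1 n)) = 0"
  proof (rule annihilator_kills)
    fix i assume "n \<le> i"
    then show "coeff (p - smult (coeff p n) (monom 1 n)) i = 0"
      using assms by (cases "i = n") (auto simp: coeff_eq_0)
  qed
  then show ?thesis by (simp add: K.diff K.smult eigenpoly_def)
qed

lemma degree_monom1_le: "degree (monom (1::complex) n) \<le> n"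
  by (simp add: degree_monom_eq)

lemma eigenpoly_eigen: "L (eigenpoly L ev n) = smult (ev n) (eigenpoly L ev n)"
  unfolding eigenpoly_def by (rule annihilator_eigen) (rule degree_monom1_le)

lemma degree_eigenpoly_le: "degree (eigenpoly L ev n) \<le> n"
  using annihilator_degree_coeff[OF degree_monom1_le] unfolding eigenpoly_def by blast

lemma coeff_eigenpoly: "coeff (eigenpoly L ev n) n = (\<Prod>j<n. ev n - ev j)"
  using annihilator_degree_coeff[OF degree_monom1_le, of n n] unfolding eigenpoly_def by simp

lemma eigenvalue_of_degree:
  assumes "L p = smult c p" "p \<noteq> 0"
  shows "c = ev (degree p)"
proof -
  have "ev (degree p) * coeff p (degree p) = c * coeff p (degree p)"
    using coeff_top[OF order_refl, of p] assms(1) by (metis coeff_smult)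
  then show ?thesis using assms(2) by (metis leading_coeff_0_iff mult_right_cancel)
qed

text \<open>Subtracting the multiple of \<open>y\<close> with the same coefficient of degree \<open>n\<close> leaves an eigenvector
  of smaller degree \<open>j\<close> for the eigenvalue \<open>ev n\<close>, which forces \<open>ev j = ev n\<close>.\<close>
lemma eigenvectors_proportional:
  assumes sep: "\<And>j. j < n \<Longrightarrow> ev j \<noteq> ev n"
    and y: "L y = smult (ev n) y" "degree y = n" "y \<noteq> 0"
    and z: "L z = smult (ev n) z" "degree z \<le> n"
  shows "z = smult (coeff z n / coeff y n) y"
proof (rule ccontr)
  assume ne: "z \<noteq> smult (coeff z n / coeff y n) y"
  define w where "w = z - smult (coeff z n / coeff y n) y"
  have w0: "w \<noteq> 0" using ne by (simp add: w_def)
  have yn: "coeff y n \<noteq> 0" using y by auto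
  have Lw: "L w = smult (ev n) w"
    unfolding w_def by (simp add: diff smult y(1) z(1) smult_diff_right mult.commute)
  have dw: "degree w \<le> n" unfolding w_def using y(2) z(2) by (intro degree_diff_le) auto
  have "coeff w n = 0" using yn by (simp add: w_def)
  then have "degree w \<noteq> n" using w0 by auto
  then have "degree w < n" using dw by simp
  then show False using sep eigenvalue_of_degree[OF Lw w0] by force
qed

end

section \<open>Divided differences on a lattice\<close>

lemma half_steps:
  fixes s :: complex
  shows "s + 1/2 + 1/2 = s + 1" "s + 1/2 - 1/2 = s" "s - 1/2 + 1/2 = s" "s - 1/2 - 1/2 = s - 1"
  by simp_all

text \<open>The two facts about a lattice that make \<open>D\<close> and \<open>S\<close> act on polynomials: the sum and the
  squared difference of neighbouring values are polynomials in the value between them. The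
  numbers \<open>dd n\<close> and \<open>mm n\<close> are the leading coefficients of \<open>D x\<^sup>n\<close> and \<open>S x\<^sup>n\<close>.\<close>
locale quadratic_lattice =
  fixes x :: "complex \<Rightarrow> complex" and \<sigma> \<delta> :: "complex poly" and \<alpha> :: complex
    and dd mm :: "nat \<Rightarrow> complex"
  assumes surj: "surj x"
    and sum_eq: "x (s + 1/2) + x (s - 1/2) = poly \<sigma> (x s)"
    and diff_sq_eq: "(x (s + 1/2) - x (s - 1/2))\<^sup>2 = poly \<delta> (x s)"
    and \<delta>_nonzero: "\<delta> \<noteq> 0"
    and degree_\<sigma>: "degree \<sigma> \<le> 1" and coeff_\<sigma>: "coeff \<sigma> 1 = 2 * \<alpha>"
    and degree_\<delta>: "degree \<delta> \<le> 2" and coeff_\<delta>: "coeff \<delta> 2 = 4 * (\<alpha>\<^sup>2 - 1)"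
    and dd_0: "dd 0 = 0" and mm_0: "mm 0 = 1"
    and dd_Suc: "dd (Suc n) = \<alpha> * dd n + mm n"
    and mm_Suc: "mm (Suc n) = \<alpha> * mm n + (\<alpha>\<^sup>2 - 1) * dd n"
begin

lemma poly_eqI_cofinite:
  assumes "finite Z" "\<And>s. x s \<notin> Z \<Longrightarrow> poly f (x s) = poly g (x s)"
  shows "f = g"
proof (rule ccontr)
  assume "f \<noteq> g"
  then have "finite {v. poly (f - g) v = 0}" by (intro poly_roots_finite) simp
  moreover have "UNIV = Z \<union> {v. poly (f - g) v = 0}"
    using assms(2) surj by (auto simp: surj_def) metis
  ultimately have "finite (UNIV :: complex set)" using assms(1) by (metis finite_Un)
  then show False by (simp add: infinite_UNIV_char_0)
qed

lemma poly_eqI_lattice: "(\<And>s. poly f (x s) = poly g (x s)) \<Longrightarrow> f = g"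
  by (rule poly_eqI_cofinite[of "{}"]) auto

text \<open>If neighbouring values around \<open>s\<close> coincide, \<open>\<delta>\<close> vanishes at \<open>x s\<close>. If the coincidence occurs
  half a step away, \<open>\<delta>\<close> vanishes at a neighbouring value \<open>\<rho>\<close>, and \<open>h \<rho>\<close>, the polynomial
  whose value at \<open>x s\<close> is \<open>4 (\<rho> - x (s + 1/2)) (\<rho> - x (s - 1/2))\<close>, vanishes at \<open>x s\<close>.\<close>
lemma degenerate_values_finite:
  "finite {x s | s. x (s + 1/2) = x (s - 1/2) \<or> x (s + 1) = x s \<or> x (s - 1) = x s}"
proof -
  define Z where "Z = {v. poly \<delta> v = 0}"
  have fin: "finite Z" unfolding Z_def by (rule poly_roots_finite[OF \<delta>_nonzero])
  define h where "h \<rho> = [:4 * \<rho> * \<rho>:] - smult (4 * \<rho>) \<sigma> + (\<sigma> * \<sigma> - \<delta>)" for \<rho>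
  have h: "poly (h \<rho>) (x s) = 4 * (\<rho> - x (s + 1/2)) * (\<rho> - x (s - 1/2))" for \<rho> s
    unfolding h_def by (simp add: sum_eq[symmetric] diff_sq_eq[symmetric])
      (simp add: algebra_simps power2_eq_square)
  have "coeff (h \<rho>) 2 = 4" for \<rho>
  proof -
    have "coeff (\<sigma> * \<sigma>) (1 + 1) = coeff \<sigma> 1 * coeff \<sigma> 1"
      using degree_\<sigma> by (cases "degree \<sigma> = 1") 
        (use coeff_mult_degree_sum[of \<sigma> \<sigma>] in \<open>auto simp: coeff_eq_0 coeff_mult eval_nat_numeral\<close>)
    then have "coeff (\<sigma> * \<sigma>) 2 = 4 * \<alpha>\<^sup>2"
      using coeff_\<sigma> by (simp add: numeral_2_eq_2 power2_eq_square)
    moreover have "coeff \<sigma> 2 = 0" using degree_\<sigma> by (simp add: coeff_eq_0)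
    moreover have "coeff [:4 * \<rho> * \<rho>:] 2 = 0" by (simp add: numeral_2_eq_2)
    ultimately show ?thesis
      unfolding h_def coeff_add coeff_diff coeff_smult coeff_\<delta> by (simp add: algebra_simps)
  qed
  then have "h \<rho> \<noteq> 0" for \<rho> by (metis coeff_0 zero_neq_numeral)
  then have "finite (Z \<union> (\<Union>\<rho>\<in>Z. {v. poly (h \<rho>) v = 0}))"
    using fin by (intro finite_UnI finite_UN_I poly_roots_finite)
  moreover have "{x s | s. x (s + 1/2) = x (s - 1/2) \<or> x (s + 1) = x s \<or> x (s - 1) = x s}
    \<subseteq> Z \<union> (\<Union>\<rho>\<in>Z. {v. poly (h \<rho>) v = 0})"
  proof safe
    fix s assume "x (s + 1/2) = x (s - 1/2)" "x s \<notin> (\<Union>\<rho>\<in>Z. {v. poly (h \<rho>) v = 0})"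
    then show "x s \<in> Z" using diff_sq_eq[of s] by (simp add: Z_def)
  next
    fix s assume "x (s + 1) = x s" "x s \<notin> (\<Union>\<rho>\<in>Z. {v. poly (h \<rho>) v = 0})"
    then have "x (s + 1/2) \<in> Z" using diff_sq_eq[of "s + 1/2", unfolded half_steps] by (simp add: Z_def)
    moreover have "poly (h (x (s + 1/2))) (x s) = 0" by (simp add: h)
    ultimately show "x s \<in> Z" using \<open>x s \<notin> _\<close> by blast
  next
    fix s assume "x (s - 1) = x s" "x s \<notin> (\<Union>\<rho>\<in>Z. {v. poly (h \<rho>) v = 0})"
    then have "x (s - 1/2) \<in> Z" using diff_sq_eq[of "s - 1/2", unfolded half_steps] by (simp add: Z_def)
    moreover have "poly (h (x (s - 1/2))) (x s) = 0" by (simp add: h)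
    ultimately show "x s \<in> Z" using \<open>x s \<notin> _\<close> by blast
  qed
  ultimately show ?thesis by (rule rev_finite_subset)
qed

text \<open>Identities between polynomials may thus be checked where no divided difference has a zero
  denominator.\<close>
lemma poly_eqI_nondegenerate:
  assumes "\<And>s. x (s + 1/2) \<noteq> x (s - 1/2) \<Longrightarrow> x (s + 1) \<noteq> x s \<Longrightarrow> x (s - 1) \<noteq> x s \<Longrightarrow>
    poly f (x s) = poly g (x s)"
  shows "f = g"
  by (rule poly_eqI_cofinite[OF degenerate_values_finite]) (use assms in blast)

text \<open>Induction on the polynomial by the product rules \<open>D (x f) = \<sigma> / 2 D f + S f\<close> and
  \<open>S (x f) = \<sigma> / 2 S f + \<delta> / 4 D f\<close>.\<close>
lemma Dx_Sx_exist:
  "\<exists>g h. (\<forall>s. poly f (x (s + 1/2)) - poly f (x (s - 1/2)) = (x (s + 1/2) - x (s - 1/2)) * poly g (x s)) \<and>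
     (\<forall>s. poly f (x (s + 1/2)) + poly f (x (s - 1/2)) = 2 * poly h (x s)) \<and>
     (\<forall>n. degree f \<le> n \<longrightarrow> (\<forall>i\<ge>n. coeff g i = 0) \<and> (\<forall>i>n. coeff h i = 0) \<and>
        coeff g (n - 1) = dd n * coeff f n \<and> coeff h n = mm n * coeff f n)"
proof (induction f)
  case 0
  show ?case by (intro exI[of _ 0]) simp
next
  case (pCons c f)
  then obtain g h where
    g: "\<And>s. poly f (x (s + 1/2)) - poly f (x (s - 1/2)) = (x (s + 1/2) - x (s - 1/2)) * poly g (x s)"
    and h: "\<And>s. poly f (x (s + 1/2)) + poly f (x (s - 1/2)) = 2 * poly h (x s)"
    and top: "\<And>n. degree f \<le> n \<Longrightarrow> (\<forall>i\<ge>n. coeff g i = 0) \<and> (\<forall>i>n. coeff h i = 0) \<and>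
        coeff g (n - 1) = dd n * coeff f n \<and> coeff h n = mm n * coeff f n"
    by blast
  define s0 where "s0 = coeff \<sigma> 0"
  have \<sigma>: "\<sigma> = [:s0, 2 * \<alpha>:]"
    using degree_\<sigma> coeff_\<sigma> by (auto simp: poly_eq_iff s0_def coeff_pCons coeff_eq_0 split: nat.split)
  define d0 where "d0 = coeff \<delta> 0"
  define d1 where "d1 = coeff \<delta> 1"
  have \<delta>: "\<delta> = [:d0, d1, 4 * (\<alpha>\<^sup>2 - 1):]"
    using degree_\<delta> coeff_\<delta>
    by (auto simp: poly_eq_iff d0_def d1_def coeff_pCons coeff_eq_0 numeral_2_eq_2 split: nat.split)
  define G where "G = smult (1/2) (\<sigma> * g) + h"
  define K where "K = [:c:] + smult (1/2) (\<sigma> * h) + smult (1/4) (\<delta> * g)"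
  have "poly (pCons c f) (x (s + 1/2)) - poly (pCons c f) (x (s - 1/2)) =
    (x (s + 1/2) - x (s - 1/2)) * poly G (x s)" for s
  proof -
    have "2 * (poly (pCons c f) (x (s + 1/2)) - poly (pCons c f) (x (s - 1/2))) =
      (x (s + 1/2) + x (s - 1/2)) * (poly f (x (s + 1/2)) - poly f (x (s - 1/2))) +
      (x (s + 1/2) - x (s - 1/2)) * (poly f (x (s + 1/2)) + poly f (x (s - 1/2)))"
      by (simp add: algebra_simps)
    also have "\<dots> = 2 * ((x (s + 1/2) - x (s - 1/2)) * poly G (x s))"
      unfolding g h sum_eq G_def by (simp add: algebra_simps)
    finally show ?thesis using mult_left_cancel[of "2 :: complex"] by (metis zero_neq_numeral)
  qed
  moreover have "poly (pCons c f) (x (s + 1/2)) + poly (pCons c f) (x (s - 1/2)) = 2 * poly K (x s)" for s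
  proof -
    have "2 * (poly (pCons c f) (x (s + 1/2)) + poly (pCons c f) (x (s - 1/2))) = 4 * c +
      (x (s + 1/2) + x (s - 1/2)) * (poly f (x (s + 1/2)) + poly f (x (s - 1/2))) +
      (x (s + 1/2) - x (s - 1/2)) * (poly f (x (s + 1/2)) - poly f (x (s - 1/2)))"
      by (simp add: algebra_simps)
    also have "\<dots> = 4 * c + poly \<sigma> (x s) * (2 * poly h (x s)) + (x (s + 1/2) - x (s - 1/2))\<^sup>2 * poly g (x s)"
      unfolding g h sum_eq by (simp add: power2_eq_square)
    also have "\<dots> = 2 * (2 * poly K (x s))"
      unfolding diff_sq_eq K_def by (simp add: algebra_simps)
    finally show ?thesis using mult_left_cancel[of "2 :: complex"] by (metis zero_neq_numeral)
  qed
  moreover have "(\<forall>i\<ge>n. coeff G i = 0) \<and> (\<forall>i>n. coeff K i = 0) \<and>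
        coeff G (n - 1) = dd n * coeff (pCons c f) n \<and> coeff K n = mm n * coeff (pCons c f) n"
    if n: "degree (pCons c f) \<le> n" for n
  proof (cases n)
    case 0
    with n have "f = 0" by (simp split: if_splits)
    then have "degree f \<le> 0" "coeff f 0 = 0" by simp_all
    have "g = 0" "h = 0"
      using top[of 0] \<open>f = 0\<close> by (auto simp: poly_eq_iff) (metis gr0I)
    then show ?thesis by (auto simp: G_def K_def 0 dd_0 mm_0 \<open>f = 0\<close> coeff_pCons split: nat.split)
  next
    case (Suc m)
    with n have m: "degree f \<le> m" by (simp split: if_splits)
    note t = top[OF m]
    have cG: "coeff G (Suc i) = s0 / 2 * coeff g (Suc i) + \<alpha> * coeff g i + coeff h (Suc i)" for i
      by (simp add: G_def \<sigma> field_simps)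
    have cG0: "coeff G 0 = s0 / 2 * coeff g 0 + coeff h 0"
      by (simp add: G_def \<sigma> field_simps)
    have cK: "coeff K (Suc i) = s0 / 2 * coeff h (Suc i) + \<alpha> * coeff h i + d0 / 4 * coeff g (Suc i) +
        d1 / 4 * coeff g i + (if i = 0 then 0 else (\<alpha>\<^sup>2 - 1) * coeff g (i - 1))" for i
      by (cases i) (simp_all add: K_def \<sigma> \<delta> field_simps)
    show ?thesis
    proof (intro conjI allI impI)
      fix i assume "n \<le> i"
      then obtain j where "i = Suc j" "m \<le> j" using Suc by (cases i) auto
      then show "coeff G i = 0" using t by (simp add: cG)
    next
      fix i assume "n < i"
      then obtain j where "i = Suc j" "m < j" using Suc by (cases i) auto
      then show "coeff K i = 0" using t by (simp add: cK)
    next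
      show "coeff G (n - 1) = dd n * coeff (pCons c f) n"
        using t by (cases m) (auto simp: Suc cG cG0 dd_Suc dd_0 algebra_simps)
      have "(if m = 0 then 0 else coeff g (m - 1)) = dd m * coeff f m" using t by (simp add: dd_0)
      then have "coeff K (Suc m) = \<alpha> * (mm m * coeff f m) + (\<alpha>\<^sup>2 - 1) * (dd m * coeff f m)"
        using t cK[of m] by auto
      then show "coeff K n = mm n * coeff (pCons c f) n" by (simp add: Suc mm_Suc algebra_simps)
    qed
  qed
  ultimately show ?case by blast
qed

lemma Dx_unique:
  assumes "\<And>s. poly f (x (s + 1/2)) - poly f (x (s - 1/2)) = (x (s + 1/2) - x (s - 1/2)) * poly g (x s)"
  shows "Dx x f = g"
  unfolding Dx_def
proof (rule the_equality)
  show *: "\<forall>s. x (s + 1/2) \<noteq> x (s - 1/2) \<longrightarrow>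
     poly g (x s) = (poly f (x (s + 1/2)) - poly f (x (s - 1/2))) / (x (s + 1/2) - x (s - 1/2))"
    using assms by simp
  fix g'
  assume "\<forall>s. x (s + 1/2) \<noteq> x (s - 1/2) \<longrightarrow>
     poly g' (x s) = (poly f (x (s + 1/2)) - poly f (x (s - 1/2))) / (x (s + 1/2) - x (s - 1/2))"
  with * show "g' = g" by (intro poly_eqI_nondegenerate) simp
qed

lemma Sx_unique:
  assumes "\<And>s. poly f (x (s + 1/2)) + poly f (x (s - 1/2)) = 2 * poly g (x s)"
  shows "Sx x f = g"
  unfolding Sx_def by (rule the_equality) (use assms in \<open>auto intro: poly_eqI_lattice\<close>)

lemma Dx_eq: "poly f (x (s + 1/2)) - poly f (x (s - 1/2)) = (x (s + 1/2) - x (s - 1/2)) * poly (Dx x f) (x s)"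
  using Dx_Sx_exist[of f] Dx_unique by blast

lemma Sx_eq: "poly f (x (s + 1/2)) + poly f (x (s - 1/2)) = 2 * poly (Sx x f) (x s)"
  using Dx_Sx_exist[of f] Sx_unique by blast

lemma Dx_Sx_top:
  assumes "degree f \<le> n"
  shows "degree (Dx x f) \<le> n - 1" "degree (Sx x f) \<le> n"
    "coeff (Dx x f) (n - 1) = dd n * coeff f n" "coeff (Sx x f) n = mm n * coeff f n"
proof -
  obtain g h where
    "\<forall>s. poly f (x (s + 1/2)) - poly f (x (s - 1/2)) = (x (s + 1/2) - x (s - 1/2)) * poly g (x s)"
    "\<forall>s. poly f (x (s + 1/2)) + poly f (x (s - 1/2)) = 2 * poly h (x s)"
    and t: "(\<forall>i\<ge>n. coeff g i = 0) \<and> (\<forall>i>n. coeff h i = 0) \<and>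
        coeff g (n - 1) = dd n * coeff f n \<and> coeff h n = mm n * coeff f n"
    using Dx_Sx_exist[of f] assms by blast
  then have gh: "Dx x f = g" "Sx x f = h" using Dx_unique Sx_unique by blast+
  show "degree (Dx x f) \<le> n - 1" "degree (Sx x f) \<le> n"
    unfolding gh using t by (auto intro!: Polynomial.degree_le)
  show "coeff (Dx x f) (n - 1) = dd n * coeff f n" "coeff (Sx x f) n = mm n * coeff f n"
    unfolding gh using t by auto
qed

sublocale D: linear_poly_operator "Dx x"
proof
  fix p q c
  show "Dx x (p + q) = Dx x p + Dx x q"
    by (rule Dx_unique) (use Dx_eq[of p] Dx_eq[of q] in \<open>simp add: algebra_simps\<close>)
  show "Dx x (smult c p) = smult c (Dx x p)"
    by (rule Dx_unique) (use Dx_eq[of p] in \<open>simp flip: right_diff_distrib\<close>)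
qed

sublocale S: linear_poly_operator "Sx x"
proof
  fix p q c
  show "Sx x (p + q) = Sx x p + Sx x q"
    by (rule Sx_unique) (use Sx_eq[of p] Sx_eq[of q] in \<open>simp add: algebra_simps\<close>)
  show "Sx x (smult c p) = smult c (Sx x p)"
    by (rule Sx_unique) (use Sx_eq[of p] in \<open>simp flip: distrib_left\<close>)
qed

end

definition sl_op :: "(complex \<Rightarrow> complex) \<Rightarrow> complex poly \<Rightarrow> complex poly \<Rightarrow> complex poly \<Rightarrow> complex poly" where
  "sl_op x \<phi> \<psi> y = \<phi> * Dx x (Dx x y) + \<psi> * Sx x (Dx x y)"

lemma sl_solution_eigen:
  "sl_solution x \<phi> \<psi> l n y \<longleftrightarrow> y \<noteq> 0 \<and> degree y = n \<and> sl_op x \<phi> \<psi> y = smult (- l) y"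
  unfolding sl_solution_def sl_op_def by (simp add: eq_neg_iff_add_eq_0)

context quadratic_lattice
begin

definition sl_ev :: "complex poly \<Rightarrow> complex poly \<Rightarrow> nat \<Rightarrow> complex" where
  "sl_ev \<phi> \<psi> n = dd n * (dd (n - 1) * coeff \<phi> 2 + mm (n - 1) * coeff \<psi> 1)"

lemma sl_op_triangular:
  assumes \<phi>: "degree \<phi> \<le> 2" and \<psi>: "degree \<psi> \<le> 1"
  shows "triangular_operator (sl_op x \<phi> \<psi>) (sl_ev \<phi> \<psi>)"
proof
  fix p q c
  show "sl_op x \<phi> \<psi> (p + q) = sl_op x \<phi> \<psi> p + sl_op x \<phi> \<psi> q"
    by (simp add: sl_op_def D.add S.add algebra_simps)
  show "sl_op x \<phi> \<psi> (smult c p) = smult c (sl_op x \<phi> \<psi> p)"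
    by (simp add: sl_op_def D.smult S.smult smult_add_right)
next
  fix p :: "complex poly" and n assume p: "degree p \<le> n"
  note D1 = Dx_Sx_top[OF p]
  note D2 = Dx_Sx_top[OF D1(1)]
  have "degree (sl_op x \<phi> \<psi> p) \<le> n \<and> coeff (sl_op x \<phi> \<psi> p) n = sl_ev \<phi> \<psi> n * coeff p n"
  proof (cases n)
    case 0
    then obtain c where "p = [:c:]" using p by (metis degree_eq_zeroE le_zero_eq)
    then have "Dx x p = 0" by (intro Dx_unique) simp
    then show ?thesis by (simp add: sl_op_def D.zero S.zero sl_ev_def 0 dd_0)
  next
    case (Suc m)
    have S: "coeff (\<psi> * Sx x (Dx x p)) n = coeff \<psi> 1 * coeff (Sx x (Dx x p)) m"
      "degree (\<psi> * Sx x (Dx x p)) \<le> n"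
      using coeff_mult_top[OF \<psi> D2(2)] degree_mult_le[of \<psi> "Sx x (Dx x p)"] \<psi> D2(2) Suc by auto
    \<comment> \<open>For \<open>m = 0\<close> the index \<open>m - 1\<close> is \<open>0\<close>, but \<open>D\<^sup>2 p\<close> vanishes.\<close>
    have D: "coeff (\<phi> * Dx x (Dx x p)) n = coeff \<phi> 2 * coeff (Dx x (Dx x p)) (m - 1) * (if m = 0 then 0 else 1)
       \<and> degree (\<phi> * Dx x (Dx x p)) \<le> n"
    proof (cases m)
      case 0
      then obtain c where "Dx x p = [:c:]" using D1(1) Suc by (metis degree_eq_zeroE diff_Suc_1 le_zero_eq)
      then have "Dx x (Dx x p) = 0" by (intro Dx_unique) simp
      then show ?thesis by simp
    next
      case (Suc k)
      then have "n = 2 + (m - 1)" using \<open>n = Suc m\<close> by simp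
      then show ?thesis
        using coeff_mult_top[OF \<phi> D2(1)] degree_mult_le[of \<phi> "Dx x (Dx x p)"] \<phi> D2(1) Suc \<open>n = Suc m\<close>
        by (simp add: numeral_2_eq_2)
    qed
    have "degree (sl_op x \<phi> \<psi> p) \<le> n"
      unfolding sl_op_def using S D by (intro degree_add_le) auto
    moreover have "coeff (sl_op x \<phi> \<psi> p) n = sl_ev \<phi> \<psi> n * coeff p n"
    proof -
      have "coeff (Dx x (Dx x p)) (m - 1) * (if m = 0 then 0 else 1) = dd m * (dd n * coeff p n)"
        using D2(3) D1(3) Suc by (auto simp: dd_0)
      moreover have "coeff (Sx x (Dx x p)) m = mm m * (dd n * coeff p n)"
        using D2(4) D1(3) Suc by auto
      ultimately show ?thesis
        using S D unfolding sl_op_def by (simp add: sl_ev_def Suc algebra_simps)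
    qed
    ultimately show ?thesis by blast
  qed
  then show "degree (sl_op x \<phi> \<psi> p) \<le> n" "coeff (sl_op x \<phi> \<psi> p) n = sl_ev \<phi> \<psi> n * coeff p n"
    by auto
qed

text \<open>The second-order difference operator hidden in the equation: the coefficients of the forward
  and of the backward difference differ only in the sign of \<open>\<psi>\<close> and in the denominators.\<close>
lemma sl_op_difference:
  assumes "x (s + 1/2) \<noteq> x (s - 1/2)" "x (s + 1) \<noteq> x s" "x (s - 1) \<noteq> x s"
  shows "poly (sl_op x \<phi> \<psi> f) (x s) =
    (poly \<phi> (x s) / (x (s + 1/2) - x (s - 1/2)) + poly \<psi> (x s) / 2) *
      ((poly f (x (s + 1)) - poly f (x s)) / (x (s + 1) - x s)) -
    (poly \<phi> (x s) / (x (s + 1/2) - x (s - 1/2)) - poly \<psi> (x s) / 2) *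
      ((poly f (x s) - poly f (x (s - 1))) / (x s - x (s - 1)))"
proof -
  have p: "(poly f (x (s + 1)) - poly f (x s)) / (x (s + 1) - x s) = poly (Dx x f) (x (s + 1/2))"
    unfolding Dx_eq[of f "s + 1/2", unfolded half_steps] using assms(2) by simp
  have m: "(poly f (x s) - poly f (x (s - 1))) / (x s - x (s - 1)) = poly (Dx x f) (x (s - 1/2))"
    unfolding Dx_eq[of f "s - 1/2", unfolded half_steps] using assms(3) by simp
  have D: "poly (Dx x (Dx x f)) (x s) =
    (poly (Dx x f) (x (s + 1/2)) - poly (Dx x f) (x (s - 1/2))) / (x (s + 1/2) - x (s - 1/2))"
    using Dx_eq[of "Dx x f" s] assms(1) by simp
  have S: "poly (Sx x (Dx x f)) (x s) = (poly (Dx x f) (x (s + 1/2)) + poly (Dx x f) (x (s - 1/2))) / 2"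
    using Sx_eq[of "Dx x f" s] by simp
  show ?thesis unfolding p m sl_op_def poly_add poly_mult D S
    by (simp add: add_divide_distrib diff_divide_distrib algebra_simps)
qed

lemma sl_solution_ev:
  assumes "degree \<phi> \<le> 2" "degree \<psi> \<le> 1" "sl_solution x \<phi> \<psi> l n y"
  shows "sl_op x \<phi> \<psi> y = smult (sl_ev \<phi> \<psi> n) y" "- l = sl_ev \<phi> \<psi> n"
proof -
  interpret T: triangular_operator "sl_op x \<phi> \<psi>" "sl_ev \<phi> \<psi>" by (rule sl_op_triangular[OF assms(1,2)])
  have y: "y \<noteq> 0" "degree y = n" "sl_op x \<phi> \<psi> y = smult (- l) y"
    using assms(3) by (auto simp: sl_solution_eigen)
  show "- l = sl_ev \<phi> \<psi> n" using T.eigenvalue_of_degree[OF y(3,1)] y(2) by simp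
  then show "sl_op x \<phi> \<psi> y = smult (sl_ev \<phi> \<psi> n) y" using y(3) by simp
qed

lemma sl_unique_if_separated:
  assumes \<phi>: "degree \<phi> \<le> 2" and \<psi>: "degree \<psi> \<le> 1"
    and sep: "\<And>j. j < n \<Longrightarrow> sl_ev \<phi> \<psi> j \<noteq> sl_ev \<phi> \<psi> n"
  shows "sl_unique x \<phi> \<psi> l n"
  unfolding sl_unique_def
proof (intro allI impI)
  interpret T: triangular_operator "sl_op x \<phi> \<psi>" "sl_ev \<phi> \<psi>" by (rule sl_op_triangular[OF \<phi> \<psi>])
  fix y z assume y: "sl_solution x \<phi> \<psi> l n y" and z: "sl_solution x \<phi> \<psi> l n z"
  show "\<exists>k. z = smult k y"
    using T.eigenvectors_proportional[OF sep sl_solution_ev(1)[OF \<phi> \<psi> y] _ _ sl_solution_ev(1)[OF \<phi> \<psi> z]] y z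
    by (auto simp: sl_solution_def)
qed

text \<open>If \<open>ev j = ev n\<close> with \<open>j < n\<close>, then \<open>P n + P j\<close> is another solution of degree \<open>n\<close>.\<close>
lemma separated_if_sl_unique:
  assumes \<phi>: "degree \<phi> \<le> 2" and \<psi>: "degree \<psi> \<le> 1"
    and P: "\<And>n. sl_solution x \<phi> \<psi> (l n) n (P n)"
    and u: "sl_unique x \<phi> \<psi> (l n) n" and j: "j < n"
  shows "sl_ev \<phi> \<psi> j \<noteq> sl_ev \<phi> \<psi> n"
proof
  interpret T: triangular_operator "sl_op x \<phi> \<psi>" "sl_ev \<phi> \<psi>" by (rule sl_op_triangular[OF \<phi> \<psi>])
  assume eq: "sl_ev \<phi> \<psi> j = sl_ev \<phi> \<psi> n"
  have nz: "P m \<noteq> 0" "degree (P m) = m" for m using P[of m] by (auto simp: sl_solution_def)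
  have d: "degree (P n + P j) = n" using nz j by (simp add: degree_add_eq_left)
  have "sl_op x \<phi> \<psi> (P n + P j) = smult (- l n) (P n + P j)"
    unfolding T.add sl_solution_ev[OF \<phi> \<psi> P] eq by (simp add: smult_add_right)
  moreover have "P n + P j \<noteq> 0"
    using nz j by (metis add_eq_0_iff2 degree_minus less_irrefl)
  ultimately have "sl_solution x \<phi> \<psi> (l n) n (P n + P j)"
    using d by (simp add: sl_solution_eigen)
  then obtain k where k: "P n + P j = smult k (P n)" using u P unfolding sl_unique_def by blast
  have "coeff (P j) n = 0" using nz j by (simp add: coeff_eq_0)
  then have "coeff (P n) n = k * coeff (P n) n" using arg_cong[OF k, of "\<lambda>p. coeff p n"] by simp
  moreover have "coeff (P n) n \<noteq> 0" using nz by (metis leading_coeff_0_iff)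
  ultimately have "k = 1" by simp
  then show False using k nz by simp
qed

lemma sl_solution_eigenpoly:
  assumes \<phi>: "degree \<phi> \<le> 2" and \<psi>: "degree \<psi> \<le> 1"
    and sep: "\<And>j. j < n \<Longrightarrow> sl_ev \<phi> \<psi> j \<noteq> sl_ev \<phi> \<psi> n"
    and y: "sl_solution x \<phi> \<psi> l n y"
  shows "\<exists>k. k \<noteq> 0 \<and> y = smult k (eigenpoly (sl_op x \<phi> \<psi>) (sl_ev \<phi> \<psi>) n)"
proof -
  interpret T: triangular_operator "sl_op x \<phi> \<psi>" "sl_ev \<phi> \<psi>" by (rule sl_op_triangular[OF \<phi> \<psi>])
  let ?Q = "eigenpoly (sl_op x \<phi> \<psi>) (sl_ev \<phi> \<psi>) n"
  have "coeff ?Q n \<noteq> 0" using sep by (auto simp: T.coeff_eigenpoly eq_commute[of "sl_ev \<phi> \<psi> n"])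
  then have Q: "?Q \<noteq> 0" "degree ?Q = n" using T.degree_eigenpoly_le[of n]
    by (auto simp: le_antisym le_degree)
  have y': "y \<noteq> 0" "degree y = n" using y by (auto simp: sl_solution_def)
  have "y = smult (coeff y n / coeff ?Q n) ?Q"
    by (rule T.eigenvectors_proportional[OF sep T.eigenpoly_eigen Q(2,1) sl_solution_ev(1)[OF \<phi> \<psi> y]])
      (use y' in auto)
  then show ?thesis using y'(1) by (metis smult_0_left)
qed

end

section \<open>Coefficientwise limits\<close>

text \<open>The bound on the degrees is what makes this notion of limit compatible with arbitrary linear
  operators on polynomials.\<close>
definition coeffwise_limit :: "('t \<Rightarrow> complex poly) \<Rightarrow> complex poly \<Rightarrow> 't filter \<Rightarrow> bool" where
  "coeffwise_limit p p0 F \<longleftrightarrow> (\<exists>N. degree p0 \<le> N \<and> (\<forall>t. degree (p t) \<le> N)) \<and>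
     (\<forall>i. ((\<lambda>t. coeff (p t) i) \<longlongrightarrow> coeff p0 i) F)"

lemma coeffwise_limit_const: "coeffwise_limit (\<lambda>_. p) p F"
  unfolding coeffwise_limit_def by auto

lemma coeffwise_limitD: "coeffwise_limit p p0 F \<Longrightarrow> ((\<lambda>t. coeff (p t) i) \<longlongrightarrow> coeff p0 i) F"
  unfolding coeffwise_limit_def by auto

lemma coeffwise_limit_add:
  assumes "coeffwise_limit p p0 F" "coeffwise_limit q q0 F"
  shows "coeffwise_limit (\<lambda>t. p t + q t) (p0 + q0) F"
proof -
  obtain M N where "degree p0 \<le> M" "\<And>t. degree (p t) \<le> M" "degree q0 \<le> N" "\<And>t. degree (q t) \<le> N"
    using assms unfolding coeffwise_limit_def by blast
  then have "degree (p0 + q0) \<le> max M N \<and> (\<forall>t. degree (p t + q t) \<le> max M N)"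
    by (intro conjI allI degree_add_le) (simp_all add: le_max_iff_disj)
  moreover have "((\<lambda>t. coeff (p t + q t) i) \<longlongrightarrow> coeff (p0 + q0) i) F" for i
    unfolding coeff_add by (intro tendsto_add coeffwise_limitD assms)
  ultimately show ?thesis unfolding coeffwise_limit_def by blast
qed

lemma coeffwise_limit_mult:
  assumes "coeffwise_limit p p0 F" "coeffwise_limit q q0 F"
  shows "coeffwise_limit (\<lambda>t. p t * q t) (p0 * q0) F"
proof -
  obtain M N where "degree p0 \<le> M" "\<And>t. degree (p t) \<le> M" "degree q0 \<le> N" "\<And>t. degree (q t) \<le> N"
    using assms unfolding coeffwise_limit_def by blast
  then have "degree (p0 * q0) \<le> M + N \<and> (\<forall>t. degree (p t * q t) \<le> M + N)"
    by (auto intro: order_trans[OF degree_mult_le] add_mono)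
  moreover have "((\<lambda>t. coeff (p t * q t) i) \<longlongrightarrow> coeff (p0 * q0) i) F" for i
    unfolding coeff_mult by (intro tendsto_sum tendsto_mult coeffwise_limitD assms)
  ultimately show ?thesis unfolding coeffwise_limit_def by blast
qed

lemma coeffwise_limit_smult:
  assumes "(c \<longlongrightarrow> c0) F" "coeffwise_limit p p0 F"
  shows "coeffwise_limit (\<lambda>t. smult (c t) (p t)) (smult c0 p0) F"
proof -
  have "coeffwise_limit (\<lambda>t. [:c t:]) [:c0:] F"
    using assms(1) unfolding coeffwise_limit_def
    by (intro conjI exI[of _ 0]) (auto simp: coeff_pCons split: nat.split)
  from coeffwise_limit_mult[OF this assms(2)] show ?thesis by simp
qed

lemma coeffwise_limit_sum:
  assumes "\<And>i. i \<in> A \<Longrightarrow> coeffwise_limit (p i) (p0 i) F"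
  shows "coeffwise_limit (\<lambda>t. \<Sum>i\<in>A. p i t) (\<Sum>i\<in>A. p0 i) F"
  using assms
proof (induction A rule: infinite_finite_induct)
  case (insert i A)
  then show ?case using coeffwise_limit_add[of "p i" "p0 i" F] by simp
qed (simp_all add: coeffwise_limit_const)

lemma coeffwise_limit_linear:
  assumes "linear_poly_operator T" "coeffwise_limit p p0 F"
  shows "coeffwise_limit (\<lambda>t. T (p t)) (T p0) F"
proof -
  interpret linear_poly_operator T by fact
  obtain N where N: "degree p0 \<le> N" "\<And>t. degree (p t) \<le> N"
    using assms unfolding coeffwise_limit_def by blast
  have T: "T f = (\<Sum>i\<le>N. smult (coeff f i) (T (monom 1 i)))" if "degree f \<le> N" for f
  proof -
    have "T f = T (\<Sum>i\<le>N. smult (coeff f i) (monom 1 i))"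
      using poly_as_sum_of_monoms'[OF that] by (simp add: smult_monom)
    then show ?thesis by (simp add: sum smult)
  qed
  have "coeffwise_limit (\<lambda>t. \<Sum>i\<le>N. smult (coeff (p t) i) (T (monom 1 i)))
    (\<Sum>i\<le>N. smult (coeff p0 i) (T (monom 1 i))) F"
    by (intro coeffwise_limit_sum coeffwise_limit_smult coeffwise_limit_const coeffwise_limitD[OF assms(2)])
  then show ?thesis using N by (simp add: T)
qed

lemma coeffwise_limit_poly:
  assumes "coeffwise_limit p p0 F"
  shows "((\<lambda>t. poly (p t) z) \<longlongrightarrow> poly p0 z) F"
proof -
  obtain N where N: "degree p0 \<le> N" "\<And>t. degree (p t) \<le> N"
    using assms unfolding coeffwise_limit_def by blast
  have "poly f z = (\<Sum>i\<le>N. coeff f i * z ^ i)" if "degree f \<le> N" for f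
    unfolding poly_altdef by (rule sum.mono_neutral_left) (use that in \<open>auto simp: coeff_eq_0\<close>)
  then have e: "poly (p t) z = (\<Sum>i\<le>N. coeff (p t) i * z ^ i)" "poly p0 z = (\<Sum>i\<le>N. coeff p0 i * z ^ i)" for t
    using N by auto
  show ?thesis unfolding e by (intro tendsto_intros coeffwise_limitD assms)
qed

lemma coeffwise_limit_unique:
  assumes "coeffwise_limit p p0 F" "coeffwise_limit p p1 F" "F \<noteq> bot"
  shows "p0 = p1"
  using tendsto_unique[OF assms(3) coeffwise_limitD[OF assms(1)] coeffwise_limitD[OF assms(2)]]
  by (simp add: poly_eq_iff)

lemma coeffwise_limit_compose:
  assumes "coeffwise_limit p p0 F" "filterlim g F G"
  shows "coeffwise_limit (\<lambda>t. p (g t)) p0 G"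
proof -
  have "((\<lambda>t. coeff (p (g t)) i) \<longlongrightarrow> coeff p0 i) G" for i
    by (rule filterlim_compose[OF coeffwise_limitD[OF assms(1)] assms(2)])
  then show ?thesis using assms(1) unfolding coeffwise_limit_def by blast
qed

lemma coeffwise_limit_factor:
  assumes "(f \<longlongrightarrow> v) F" "(g \<longlongrightarrow> w) F"
  shows "coeffwise_limit (\<lambda>t. [:f t, g t:]) [:v, w :: complex:] F"
  unfolding coeffwise_limit_def
  by (intro conjI exI[of _ 1]) (use assms in \<open>auto simp: coeff_pCons split: nat.split\<close>)

text \<open>Used to see that a limit over the generic parameters determines its value: a curve through
  \<open>p\<close> that is eventually generic suffices.\<close>
lemma at_within_nontrivial:
  fixes \<gamma> :: "complex \<Rightarrow> 'a::t2_space"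
  assumes "(\<gamma> \<longlongrightarrow> p) (at 0)" "\<forall>\<^sub>F t in at 0. \<gamma> t \<noteq> p" "\<forall>\<^sub>F t in at 0. \<gamma> t \<in> S"
  shows "at p within S \<noteq> bot"
proof
  assume "at p within S = bot"
  moreover have "filterlim \<gamma> (at p within S) (at 0)"
    unfolding filterlim_at using assms by (auto elim: eventually_elim2)
  ultimately have "filtermap \<gamma> (at 0) = bot" by (simp add: filterlim_def bot_unique)
  then show False by (simp add: filtermap_bot_iff trivial_limit_at)
qed

lemma eventually_poly_nonzero:
  assumes "f \<noteq> (0 :: complex poly)"
  shows "\<forall>\<^sub>F t in at z. poly f t \<noteq> 0"
proof -
  have "\<forall>\<^sub>F t in at z. \<forall>y\<in>{t. poly f t = 0}. t \<noteq> y"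
    by (rule eventually_ball_finite[OF poly_roots_finite[OF assms]]) (simp add: eventually_neq_at_within)
  then show ?thesis by eventually_elim auto
qed

lemma tendsto_within_transform:
  assumes "(g \<longlongrightarrow> l) (at p within S)" "\<And>\<tau>. \<tau> \<in> S \<Longrightarrow> f \<tau> = g \<tau>"
  shows "(f \<longlongrightarrow> l) (at p within S)"
proof -
  have "\<forall>\<^sub>F \<tau> in at p within S. g \<tau> = f \<tau>" using assms(2) by (auto simp: eventually_at_filter)
  then show ?thesis using assms(1) by (rule Lim_transform_eventually[rotated])
qed

context quadratic_lattice
begin

lemma coeffwise_limit_sl_op:
  assumes "coeffwise_limit \<phi> \<phi>0 F" "coeffwise_limit \<psi> \<psi>0 F" "coeffwise_limit p p0 F"
  shows "coeffwise_limit (\<lambda>t. sl_op x (\<phi> t) (\<psi> t) (p t)) (sl_op x \<phi>0 \<psi>0 p0) F"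
proof -
  note D = coeffwise_limit_linear[OF D.linear_poly_operator_axioms]
  note S = coeffwise_limit_linear[OF S.linear_poly_operator_axioms]
  show ?thesis
    unfolding sl_op_def
    by (rule coeffwise_limit_add[OF coeffwise_limit_mult[OF assms(1) D[OF D[OF assms(3)]]]
          coeffwise_limit_mult[OF assms(2) S[OF D[OF assms(3)]]]])
qed

lemma tendsto_sl_ev:
  assumes "coeffwise_limit \<phi> \<phi>0 F" "coeffwise_limit \<psi> \<psi>0 F"
  shows "((\<lambda>t. sl_ev (\<phi> t) (\<psi> t) n) \<longlongrightarrow> sl_ev \<phi>0 \<psi>0 n) F"
  unfolding sl_ev_def
  by (intro tendsto_mult tendsto_add tendsto_const coeffwise_limitD[OF assms(1)] coeffwise_limitD[OF assms(2)])

lemma coeffwise_limit_eigenpoly: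
  assumes \<phi>: "coeffwise_limit \<phi> \<phi>0 F" and \<psi>: "coeffwise_limit \<psi> \<psi>0 F"
  shows "coeffwise_limit (\<lambda>t. eigenpoly (sl_op x (\<phi> t) (\<psi> t)) (sl_ev (\<phi> t) (\<psi> t)) n)
    (eigenpoly (sl_op x \<phi>0 \<psi>0) (sl_ev \<phi>0 \<psi>0) n) F"
proof -
  have "coeffwise_limit (\<lambda>t. annihilator (sl_op x (\<phi> t) (\<psi> t)) (sl_ev (\<phi> t) (\<psi> t)) k (p t))
    (annihilator (sl_op x \<phi>0 \<psi>0) (sl_ev \<phi>0 \<psi>0) k p0) F"
    if "coeffwise_limit p p0 F" for k p p0
    using that
  proof (induction k arbitrary: p p0)
    case (Suc k)
    have "coeffwise_limit (\<lambda>t. sl_op x (\<phi> t) (\<psi> t) (p t) + smult (- sl_ev (\<phi> t) (\<psi> t) k) (p t))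
      (sl_op x \<phi>0 \<psi>0 p0 + smult (- sl_ev \<phi>0 \<psi>0 k) p0) F"
      by (intro coeffwise_limit_add coeffwise_limit_smult tendsto_minus tendsto_sl_ev
          coeffwise_limit_sl_op \<phi> \<psi> Suc.prems)
    from Suc.IH[OF this] show ?case by simp
  qed simp
  then show ?thesis unfolding eigenpoly_def by (simp add: coeffwise_limit_const)
qed

end

section \<open>Affine changes of the lattice\<close>

context quadratic_lattice
begin

text \<open>For \<open>y = c x + d\<close> the substitution \<open>f \<mapsto> f \<circ> A\<close> turns \<open>D\<close> on the lattice \<open>y\<close> into \<open>1 / c\<close> times
  \<open>D\<close> on \<open>x\<close> and commutes with \<open>S\<close>; the powers of \<open>c\<close> are absorbed into \<open>\<phi>\<close> and \<open>\<psi>\<close>.\<close>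
lemma affine_lattice_transfer:
  fixes y :: "complex \<Rightarrow> complex"
  assumes ly: "quadratic_lattice y \<sigma>' \<delta>' \<alpha>' dd' mm'"
    and c: "c \<noteq> 0" and y: "\<And>s. y s = c * x s + d"
  defines "A \<equiv> [:d, c:]"
  assumes \<phi>: "pcompose \<phi> A = smult (c\<^sup>2) \<phi>'" and \<psi>: "pcompose \<psi> A = smult c \<psi>'"
  shows "sl_solution y \<phi> \<psi> l n f \<longleftrightarrow> sl_solution x \<phi>' \<psi>' l n (pcompose f A)"
    and "sl_unique y \<phi> \<psi> l n \<longleftrightarrow> sl_unique x \<phi>' \<psi>' l n"
proof -
  interpret Y: quadratic_lattice y \<sigma>' \<delta>' \<alpha>' dd' mm' by (rule ly)
  have A: "poly (pcompose f A) (x s) = poly f (y s)" for f s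
    by (simp add: A_def poly_pcompose y mult.commute add.commute)
  have D: "Dx x (pcompose f A) = smult c (pcompose (Dx y f) A)" for f
  proof (rule Dx_unique)
    fix s
    have "poly (pcompose f A) (x (s + 1/2)) - poly (pcompose f A) (x (s - 1/2)) =
      (y (s + 1/2) - y (s - 1/2)) * poly (Dx y f) (y s)"
      unfolding A by (rule Y.Dx_eq)
    also have "y (s + 1/2) - y (s - 1/2) = c * (x (s + 1/2) - x (s - 1/2))"
      unfolding y by (simp add: right_diff_distrib)
    finally show "poly (pcompose f A) (x (s + 1/2)) - poly (pcompose f A) (x (s - 1/2)) =
      (x (s + 1/2) - x (s - 1/2)) * poly (smult c (pcompose (Dx y f) A)) (x s)"
      by (simp add: A)
  qed
  have S: "Sx x (pcompose f A) = pcompose (Sx y f) A" for f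
    by (rule Sx_unique) (simp add: A Y.Sx_eq)
  have sol: "sl_solution y \<phi> \<psi> l n f \<longleftrightarrow> sl_solution x \<phi>' \<psi>' l n (pcompose f A)" for f
  proof -
    have "pcompose (\<phi> * Dx y (Dx y f) + \<psi> * Sx y (Dx y f) + smult l f) A =
      \<phi>' * Dx x (Dx x (pcompose f A)) + \<psi>' * Sx x (Dx x (pcompose f A)) + smult l (pcompose f A)"
      by (simp add: pcompose_add pcompose_mult pcompose_smult \<phi> \<psi> D S D.smult S.smult power2_eq_square)
    moreover have "degree A > 0" using c by (simp add: A_def)
    ultimately have "\<phi> * Dx y (Dx y f) + \<psi> * Sx y (Dx y f) + smult l f = 0 \<longleftrightarrow>
      \<phi>' * Dx x (Dx x (pcompose f A)) + \<psi>' * Sx x (Dx x (pcompose f A)) + smult l (pcompose f A) = 0"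
      by (metis pcompose_eq_0 pcompose_0)
    moreover have "degree (pcompose f A) = degree f" "pcompose f A = 0 \<longleftrightarrow> f = 0"
      using c by (auto simp: A_def degree_pcompose pcompose_eq_0_iff)
    ultimately show ?thesis unfolding sl_solution_def by simp
  qed
  then show "sl_solution y \<phi> \<psi> l n f \<longleftrightarrow> sl_solution x \<phi>' \<psi>' l n (pcompose f A)" .
  \<comment> \<open>\<open>B\<close> is the inverse substitution, used to carry solutions back.\<close>
  define B where "B = [:- d / c, 1 / c:]"
  have BA: "pcompose (pcompose f B) A = f" for f
  proof -
    have "pcompose B A = [:0, 1:]" using c by (simp add: A_def B_def pcompose_pCons)
    then show ?thesis by (simp flip: pcompose_assoc)
  qed
  have inj: "f = g" if "pcompose f A = pcompose g A" for f g
    by (rule Y.poly_eqI_lattice) (use that A in metis)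
  show "sl_unique y \<phi> \<psi> l n \<longleftrightarrow> sl_unique x \<phi>' \<psi>' l n"
  proof
    assume u: "sl_unique y \<phi> \<psi> l n"
    show "sl_unique x \<phi>' \<psi>' l n"
      unfolding sl_unique_def
    proof (intro allI impI)
      fix f g assume "sl_solution x \<phi>' \<psi>' l n f" "sl_solution x \<phi>' \<psi>' l n g"
      then have "sl_solution y \<phi> \<psi> l n (pcompose f B)" "sl_solution y \<phi> \<psi> l n (pcompose g B)"
        by (simp_all add: sol BA)
      then obtain k where "pcompose g B = smult k (pcompose f B)"
        using u unfolding sl_unique_def by blast
      from arg_cong[OF this, of "\<lambda>p. pcompose p A"] have "g = smult k f"
        by (simp add: pcompose_smult BA)
      then show "\<exists>k. g = smult k f" ..
    qed
  next
    assume u: "sl_unique x \<phi>' \<psi>' l n"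
    show "sl_unique y \<phi> \<psi> l n"
      unfolding sl_unique_def
    proof (intro allI impI)
      fix f g assume "sl_solution y \<phi> \<psi> l n f" "sl_solution y \<phi> \<psi> l n g"
      then obtain k where "pcompose g A = smult k (pcompose f A)"
        using u unfolding sl_unique_def sol by blast
      then have "pcompose g A = pcompose (smult k f) A" by (simp add: pcompose_smult)
      then have "g = smult k f" by (rule inj)
      then show "\<exists>k. g = smult k f" ..
    qed
  qed
qed

text \<open>The part of the argument common to both lattices. The family enters only through two
  properties: it contains multiples of the eigenpolynomials of each admissible equation, and each
  of its members of full degree solves an equation with distinct eigenvalues. The condition that
  \<open>\<psi>\<close> has degree exactly \<open>1\<close> comes for free in the converse, since the leading coefficient of \<open>\<psi>\<close> is
  \<open>ev 1\<close>, which differs from \<open>ev 0 = 0\<close>.\<close>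
lemma classification:
  fixes y :: "complex \<Rightarrow> complex" and family :: "(nat \<Rightarrow> complex poly) \<Rightarrow> bool"
  assumes ly: "quadratic_lattice y \<sigma>' \<delta>' \<alpha>' dd' mm'"
    and c: "c \<noteq> 0" and y: "\<And>s. y s = c * x s + d"
    and P: "\<And>n. P n \<noteq> 0 \<and> degree (P n) = n"
    and covers: "\<And>\<phi> \<psi>. degree \<phi> \<le> 2 \<Longrightarrow> degree \<psi> = 1 \<Longrightarrow>
      \<exists>R. family R \<and> (\<forall>n. \<exists>k. k \<noteq> 0 \<and>
        R n = smult k (eigenpoly (sl_op x \<phi> \<psi>) (sl_ev \<phi> \<psi>) n))"
    and solves: "\<And>R. family R \<Longrightarrow> (\<And>n. R n \<noteq> 0 \<and> degree (R n) = n) \<Longrightarrow>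
      \<exists>\<phi> \<psi>. degree \<phi> \<le> 2 \<and> degree \<psi> \<le> 1 \<and>
        (\<forall>n. sl_op x \<phi> \<psi> (R n) = smult (sl_ev \<phi> \<psi> n) (R n)) \<and>
        (\<forall>n. \<forall>j<n. sl_ev \<phi> \<psi> j \<noteq> sl_ev \<phi> \<psi> n)"
  shows "(\<exists>\<phi> \<psi> l. degree \<phi> \<le> 2 \<and> degree \<psi> = 1 \<and>
           (\<forall>n. sl_solution y \<phi> \<psi> (l n) n (P n) \<and> sl_unique y \<phi> \<psi> (l n) n))
         \<longleftrightarrow> (\<exists>R. family R \<and> (\<forall>n. \<exists>k. k \<noteq> 0 \<and> (\<forall>s. poly (P n) (y s) = k * poly (R n) (x s))))"
      (is "?L \<longleftrightarrow> ?R")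
    and "\<forall>\<phi> \<psi> l. degree \<phi> \<le> 2 \<and> degree \<psi> = 1 \<and> (\<forall>n. sl_solution y \<phi> \<psi> (l n) n (P n))
         \<longrightarrow> (\<exists>R. family R \<and> (\<forall>n. sl_unique y \<phi> \<psi> (l n) n \<longrightarrow>
              (\<exists>k. k \<noteq> 0 \<and> (\<forall>s. poly (P n) (y s) = k * poly (R n) (x s)))))"
proof -
  define A where "A = [:d, c:]"
  define B where "B = [:- d / c, 1 / c:]"
  have AB: "pcompose (pcompose f B) A = f" for f
  proof -
    have "pcompose B A = [:0, 1:]" using c by (simp add: A_def B_def pcompose_pCons)
    then show ?thesis by (simp flip: pcompose_assoc)
  qed
  have deg: "degree (pcompose f A) = degree f" "degree (pcompose f B) = degree f" for f
    using c by (simp_all add: A_def B_def degree_pcompose)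
  have A: "poly (pcompose f A) (x s) = poly f (y s)" for f s
    by (simp add: A_def poly_pcompose y mult.commute add.commute)
  have PA: "pcompose (P n) A \<noteq> 0" "degree (pcompose (P n) A) = n" for n
    using P c by (auto simp: A_def degree_pcompose pcompose_eq_0_iff)
  note transfer = affine_lattice_transfer[OF ly c y, folded A_def]
  have part: "\<exists>R. family R \<and> (\<forall>n. sl_unique y \<phi> \<psi> (l n) n \<longrightarrow>
              (\<exists>k. k \<noteq> 0 \<and> (\<forall>s. poly (P n) (y s) = k * poly (R n) (x s))))"
    if \<phi>: "degree \<phi> \<le> 2" and \<psi>: "degree \<psi> = 1" and sol: "\<And>n. sl_solution y \<phi> \<psi> (l n) n (P n)"
    for \<phi> \<psi> l
  proof -
    define \<phi>' where "\<phi>' = smult (1 / c\<^sup>2) (pcompose \<phi> A)"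
    define \<psi>' where "\<psi>' = smult (1 / c) (pcompose \<psi> A)"
    have d': "degree \<phi>' \<le> 2" "degree \<psi>' = 1" "degree \<psi>' \<le> 1"
      using \<phi> \<psi> c by (simp_all add: \<phi>'_def \<psi>'_def deg)
    have e: "pcompose \<phi> A = smult (c\<^sup>2) \<phi>'" "pcompose \<psi> A = smult c \<psi>'"
      using c by (simp_all add: \<phi>'_def \<psi>'_def)
    have sol': "sl_solution x \<phi>' \<psi>' (l n) n (pcompose (P n) A)" for n
      using sol transfer(1)[OF e] by blast
    obtain R where R: "family R"
      "\<And>n. \<exists>k. k \<noteq> 0 \<and> R n = smult k (eigenpoly (sl_op x \<phi>' \<psi>') (sl_ev \<phi>' \<psi>') n)"
      using covers[OF d'(1,2)] by blast
    show ?thesis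
    proof (intro exI[of _ R] conjI allI impI R(1))
      fix n assume "sl_unique y \<phi> \<psi> (l n) n"
      then have u: "sl_unique x \<phi>' \<psi>' (l n) n" using transfer(2)[OF e] by blast
      obtain k where k: "k \<noteq> 0" "pcompose (P n) A =
          smult k (eigenpoly (sl_op x \<phi>' \<psi>') (sl_ev \<phi>' \<psi>') n)"
        using sl_solution_eigenpoly[OF d'(1,3) separated_if_sl_unique[OF d'(1,3) sol' u] sol'] by blast
      obtain k' where k': "k' \<noteq> 0"
          "R n = smult k' (eigenpoly (sl_op x \<phi>' \<psi>') (sl_ev \<phi>' \<psi>') n)"
        using R(2) by blast
      have "pcompose (P n) A = smult (k / k') (R n)" using k k' by simp
      then have "\<forall>s. poly (P n) (y s) = k / k' * poly (R n) (x s)" by (metis A poly_smult)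
      then show "\<exists>k. k \<noteq> 0 \<and> (\<forall>s. poly (P n) (y s) = k * poly (R n) (x s))"
        using k(1) k'(1) by (intro exI[of _ "k / k'"]) simp
    qed
  qed
  then show "\<forall>\<phi> \<psi> l. degree \<phi> \<le> 2 \<and> degree \<psi> = 1 \<and> (\<forall>n. sl_solution y \<phi> \<psi> (l n) n (P n))
         \<longrightarrow> (\<exists>R. family R \<and> (\<forall>n. sl_unique y \<phi> \<psi> (l n) n \<longrightarrow>
              (\<exists>k. k \<noteq> 0 \<and> (\<forall>s. poly (P n) (y s) = k * poly (R n) (x s)))))"
    by blast
  show "?L \<longleftrightarrow> ?R"
  proof
    assume ?L
    then obtain \<phi> \<psi> l where "degree \<phi> \<le> 2" "degree \<psi> = 1"
      and s: "\<And>n. sl_solution y \<phi> \<psi> (l n) n (P n)" "\<And>n. sl_unique y \<phi> \<psi> (l n) n" by blast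
    then show ?R using part[of \<phi> \<psi> l] by blast
  next
    assume ?R
    then obtain R k where R: "family R" and k: "\<And>n. k n \<noteq> 0"
      and PR: "\<And>n s. poly (P n) (y s) = k n * poly (R n) (x s)" by metis
    have PR': "pcompose (P n) A = smult (k n) (R n)" for n
      by (rule poly_eqI_lattice) (simp add: A PR)
    have "R n \<noteq> 0 \<and> degree (R n) = n" for n
      using PA[of n] k[of n] unfolding PR' by simp
    then obtain \<phi>' \<psi>' where d': "degree \<phi>' \<le> 2" "degree \<psi>' \<le> 1"
      and eig: "\<And>n. sl_op x \<phi>' \<psi>' (R n) = smult (sl_ev \<phi>' \<psi>' n) (R n)"
      and sep: "\<And>n j. j < n \<Longrightarrow> sl_ev \<phi>' \<psi>' j \<noteq> sl_ev \<phi>' \<psi>' n"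
      using solves[OF R] by blast
    interpret T: triangular_operator "sl_op x \<phi>' \<psi>'" "sl_ev \<phi>' \<psi>'" by (rule sl_op_triangular[OF d'])
    have "sl_ev \<phi>' \<psi>' 0 \<noteq> sl_ev \<phi>' \<psi>' 1" by (rule sep) simp
    then have "coeff \<psi>' 1 \<noteq> 0" by (auto simp: sl_ev_def dd_0)
    then have d1: "degree \<psi>' = 1" using d'(2) by (metis le_antisym le_degree)
    define \<phi> where "\<phi> = smult (c\<^sup>2) (pcompose \<phi>' B)"
    define \<psi> where "\<psi> = smult c (pcompose \<psi>' B)"
    have e: "pcompose \<phi> A = smult (c\<^sup>2) \<phi>'" "pcompose \<psi> A = smult c \<psi>'"
      by (simp_all add: \<phi>_def \<psi>_def pcompose_smult AB)
    have "sl_solution x \<phi>' \<psi>' (- sl_ev \<phi>' \<psi>' n) n (pcompose (P n) A)" for n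
      unfolding sl_solution_eigen using PA by (simp add: PR' T.smult eig mult.commute)
    moreover have "sl_unique x \<phi>' \<psi>' (- sl_ev \<phi>' \<psi>' n) n" for n
      by (rule sl_unique_if_separated[OF d' sep])
    moreover have "degree \<phi> \<le> 2" "degree \<psi> = 1" using d' d1 c by (simp_all add: \<phi>_def \<psi>_def deg)
    ultimately show ?L
      using transfer[OF e] by (intro exI[of _ \<phi>] exI[of _ \<psi>] exI[of _ "\<lambda>n. - sl_ev \<phi>' \<psi>' n"]) blast
  qed
qed

end

section \<open>The quadratic lattice\<close>

lemma quad_lattice_instance:
  assumes "c4 \<noteq> (0 :: complex)"
  shows "quadratic_lattice (\<lambda>s. c4 * s\<^sup>2 + c5 * s + c0) [:c4 / 2, 2:] [:c5\<^sup>2 - 4 * c4 * c0, 4 * c4:] 1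
    of_nat (\<lambda>_. 1)"
proof
  show "surj (\<lambda>s. c4 * s\<^sup>2 + c5 * s + c0)"
  proof (rule surjI)
    fix v
    define r where "r = csqrt (c5\<^sup>2 - 4 * c4 * (c0 - v))"
    have "r\<^sup>2 = c5\<^sup>2 - 4 * c4 * (c0 - v)" by (simp add: r_def)
    define z where "z = (r - c5) / (2 * c4)"
    have "2 * c4 * z + c5 = r" using assms by (simp add: z_def)
    moreover have "4 * c4 * (c4 * z\<^sup>2 + c5 * z + c0) = (2 * c4 * z + c5)\<^sup>2 - c5\<^sup>2 + 4 * c4 * c0"
      by (simp add: power2_eq_square algebra_simps)
    ultimately have "4 * c4 * (c4 * z\<^sup>2 + c5 * z + c0) = 4 * c4 * v"
      using \<open>r\<^sup>2 = _\<close> by (simp add: algebra_simps)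
    then show "c4 * ((csqrt (c5\<^sup>2 - 4 * c4 * (c0 - v)) - c5) / (2 * c4))\<^sup>2 +
      c5 * ((csqrt (c5\<^sup>2 - 4 * c4 * (c0 - v)) - c5) / (2 * c4)) + c0 = v"
      using assms by (simp add: r_def z_def)
  qed
qed (use assms in \<open>simp_all add: field_simps power2_eq_square numeral_2_eq_2\<close>)

definition centred_square :: "complex \<Rightarrow> complex \<Rightarrow> complex" where
  "centred_square u s = - (s + u / 2)\<^sup>2"

lemma centred_square_lattice:
  "quadratic_lattice (centred_square u) [:- (1/2), 2:] [:0, - 4:] 1 of_nat (\<lambda>_. 1)"
proof -
  have "centred_square u = (\<lambda>s. (-1) * s\<^sup>2 + (- u) * s + (- (u\<^sup>2) / 4))"
    by (auto simp: fun_eq_iff centred_square_def power2_eq_square field_simps)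
  then show ?thesis using quad_lattice_instance[of "-1" "- u" "- (u\<^sup>2) / 4"] by simp
qed

lemma quad_lattice_eq_centred:
  assumes "c4 \<noteq> 0"
  shows "quad_lattice c4 c5 s = - c4 * centred_square (c5 / c4) s + (- (c5\<^sup>2) / (4 * c4))"
  using assms by (simp add: quad_lattice_def centred_square_def power2_eq_square field_simps)

text \<open>Together with \<open>wilson_psi\<close> this is the inverse of the linear bijection
  \<open>(\<phi>, \<psi>) \<mapsto> H\<close> with \<open>H w = \<phi> (- w\<^sup>2) - w \<psi> (- w\<^sup>2)\<close>: \<open>\<phi>\<close> gives the even part of \<open>H\<close>, \<open>\<psi>\<close> the odd part.\<close>
definition wilson_phi :: "complex poly \<Rightarrow> complex poly" where
  "wilson_phi H = [:coeff H 0, - coeff H 2, coeff H 4:]"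

definition wilson_psi :: "complex poly \<Rightarrow> complex poly" where
  "wilson_psi H = [:- coeff H 1, coeff H 3:]"

lemma wilson_phi_psi:
  assumes "degree H \<le> 4"
  shows "poly (wilson_phi H) (- w\<^sup>2) - w * poly (wilson_psi H) (- w\<^sup>2) = poly H w"
  unfolding poly_degree4[OF assms] wilson_phi_def wilson_psi_def
  by (simp add: algebra_simps eval_nat_numeral)

lemma degree_wilson_phi_psi: "degree (wilson_phi H) \<le> 2" "degree (wilson_psi H) \<le> 1"
  by (simp_all add: wilson_phi_def wilson_psi_def)

lemma wilson_phi_linear: "linear_poly_operator wilson_phi"
  and wilson_psi_linear: "linear_poly_operator wilson_psi"
  by (unfold_locales; simp add: wilson_phi_def wilson_psi_def)+

text \<open>The polynomial in \<open>- w\<^sup>2\<close> with value \<open>(a - w)\<^sub>k (a + w)\<^sub>k\<close>.\<close>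
definition wilson_basis :: "complex \<Rightarrow> nat \<Rightarrow> complex poly" where
  "wilson_basis a k = (\<Prod>j<k. [:(a + of_nat j)\<^sup>2, 1:])"

lemma poly_wilson_basis: "poly (wilson_basis a k) (- w\<^sup>2) = pochhammer (a - w) k * pochhammer (a + w) k"
proof (induction k)
  case (Suc k)
  have "poly (wilson_basis a (Suc k)) (- w\<^sup>2) = poly (wilson_basis a k) (- w\<^sup>2) * ((a + of_nat k)\<^sup>2 - w\<^sup>2)"
    by (simp add: wilson_basis_def algebra_simps)
  also have "(a + of_nat k)\<^sup>2 - w\<^sup>2 = (a - w + of_nat k) * (a + w + of_nat k)"
    by (simp add: power2_eq_square algebra_simps)
  finally show ?case unfolding Suc by (simp add: pochhammer_Suc)
qed (simp add: wilson_basis_def)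

lemma wilson_basis_monic: "degree (wilson_basis a k) = k \<and> coeff (wilson_basis a k) k = 1"
proof -
  have "degree (wilson_basis a k) = k"
    unfolding wilson_basis_def by (subst degree_prod_eq_sum_degree) auto
  moreover have "lead_coeff (wilson_basis a k) = 1"
    unfolding wilson_basis_def lead_coeff_prod by simp
  ultimately show ?thesis by simp
qed

text \<open>A shift of \<open>w\<close> moves one factor in each Pochhammer symbol; what the shifted and the
  unshifted product have in common is factored out.\<close>
lemma wilson_basis_shift:
  "poly (wilson_basis a (Suc k)) (- (w + 1)\<^sup>2) - poly (wilson_basis a (Suc k)) (- w\<^sup>2) =
    - (of_nat k + 1) * (2 * w + 1) * (pochhammer (a - w) k * pochhammer (a + w + 1) k)"
proof -
  have e: "a - (w + 1) + 1 = a - w" by simp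
  have "pochhammer (a - (w + 1)) (Suc k) = (a - (w + 1)) * pochhammer (a - w) k"
    unfolding pochhammer_rec e ..
  moreover have "pochhammer (a + (w + 1)) (Suc k) = pochhammer (a + w + 1) k * (a + w + 1 + of_nat k)"
    by (simp add: pochhammer_Suc add.assoc)
  moreover have "pochhammer (a + w) (Suc k) = (a + w) * pochhammer (a + w + 1) k"
    by (simp add: pochhammer_rec)
  moreover have "pochhammer (a - w) (Suc k) = pochhammer (a - w) k * (a - w + of_nat k)"
    by (simp add: pochhammer_Suc)
  ultimately show ?thesis unfolding poly_wilson_basis by (simp only:) (simp add: algebra_simps)
qed

lemma wilson_basis_shift_times:
  "(a + w) * (poly (wilson_basis a (Suc k)) (- (w + 1)\<^sup>2) - poly (wilson_basis a (Suc k)) (- w\<^sup>2)) =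
    - (of_nat k + 1) * (2 * w + 1) * (a + of_nat k + w) * poly (wilson_basis a k) (- w\<^sup>2)"
proof -
  have "(a + w) * pochhammer (a + w + 1) k = pochhammer (a + w) k * (a + of_nat k + w)"
    by (simp flip: pochhammer_rec) (simp add: pochhammer_Suc algebra_simps)
  then have "- (of_nat k + 1) * (2 * w + 1) * pochhammer (a - w) k * ((a + w) * pochhammer (a + w + 1) k) =
    - (of_nat k + 1) * (2 * w + 1) * pochhammer (a - w) k * (pochhammer (a + w) k * (a + of_nat k + w))"
    by simp
  then show ?thesis unfolding wilson_basis_shift unfolding poly_wilson_basis by (simp only: mult_ac)
qed

lemma monic_linear_factors:
  fixes H :: "complex poly"
  assumes "degree H = n"
  shows "\<exists>f. H = smult (lead_coeff H) (\<Prod>i<n. [:f i, 1:])"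
  using assms
proof -
  obtain root where "smult (lead_coeff H) (\<Prod>i<degree H. [:- root i, 1:]) = H"
    by (rule complex_poly_decompose')
  then show ?thesis using assms by (intro exI[of _ "\<lambda>i. - root i"]) simp
qed

context
  fixes u :: complex
begin

interpretation W: quadratic_lattice "centred_square u" "[:- (1/2), 2:]" "[:0, - 4:]" 1 of_nat "\<lambda>_. 1"
  by (rule centred_square_lattice)

abbreviation (input) Wop where "Wop H \<equiv> sl_op (centred_square u) (wilson_phi H) (wilson_psi H)"

definition wilson_ev :: "complex poly \<Rightarrow> nat \<Rightarrow> complex" where
  "wilson_ev H n = of_nat n * ((of_nat n - 1) * coeff H 4 + coeff H 3)"

lemma sl_ev_wilson: "W.sl_ev (wilson_phi H) (wilson_psi H) = wilson_ev H"
proof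
  fix n
  show "W.sl_ev (wilson_phi H) (wilson_psi H) n = wilson_ev H n"
    unfolding W.sl_ev_def wilson_ev_def wilson_phi_def wilson_psi_def
    by (cases n) (simp_all add: numeral_2_eq_2)
qed

lemma Wop_difference:
  assumes H: "degree H \<le> 4" and w: "w = s + u / 2" "w \<noteq> 0" "2 * w + 1 \<noteq> 0" "2 * w - 1 \<noteq> 0"
  shows "poly (Wop H f) (- w\<^sup>2) =
    poly H w * (poly f (- (w + 1)\<^sup>2) - poly f (- w\<^sup>2)) / (2 * w * (2 * w + 1)) +
    poly H (- w) * (poly f (- (w - 1)\<^sup>2) - poly f (- w\<^sup>2)) / (2 * w * (2 * w - 1))"
proof -
  have X: "centred_square u s = - w\<^sup>2" "centred_square u (s + 1) = - (w + 1)\<^sup>2"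
    "centred_square u (s - 1) = - (w - 1)\<^sup>2"
    by (simp_all add: centred_square_def w(1) algebra_simps)
  have D0: "centred_square u (s + 1/2) - centred_square u (s - 1/2) = - (2 * w)"
    and Dp: "- (w + 1)\<^sup>2 - (- w\<^sup>2) = - (2 * w + 1)" and Dm: "- w\<^sup>2 - (- (w - 1)\<^sup>2) = - (2 * w - 1)"
    by (simp_all add: centred_square_def w(1) power2_eq_square field_simps)
  have Hm: "poly H (- w) = poly (wilson_phi H) (- w\<^sup>2) + w * poly (wilson_psi H) (- w\<^sup>2)"
    using wilson_phi_psi[OF H, of "- w"] by simp
  have "poly (Wop H f) (centred_square u s) =
    (poly (wilson_phi H) (- w\<^sup>2) / (- (2 * w)) + poly (wilson_psi H) (- w\<^sup>2) / 2) *
      ((poly f (- (w + 1)\<^sup>2) - poly f (- w\<^sup>2)) / (- (2 * w + 1))) -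
    (poly (wilson_phi H) (- w\<^sup>2) / (- (2 * w)) - poly (wilson_psi H) (- w\<^sup>2) / 2) *
      ((poly f (- w\<^sup>2) - poly f (- (w - 1)\<^sup>2)) / (- (2 * w - 1)))"
    using W.sl_op_difference[of s "wilson_phi H" "wilson_psi H" f] D0 Dp Dm w(2-4)
    unfolding X by (metis (no_types, lifting) diff_self mult_eq_0_iff neg_equal_0_iff_equal zero_neq_numeral)
  also have "\<dots> = (poly (wilson_phi H) (- w\<^sup>2) - w * poly (wilson_psi H) (- w\<^sup>2)) * (poly f (- (w + 1)\<^sup>2) - poly f (- w\<^sup>2)) / (2 * w * (2 * w + 1)) +
    (poly (wilson_phi H) (- w\<^sup>2) + w * poly (wilson_psi H) (- w\<^sup>2)) * (poly f (- (w - 1)\<^sup>2) - poly f (- w\<^sup>2)) / (2 * w * (2 * w - 1))"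
  proof -
    have c: "p / (- (2 * w)) + r / 2 = - ((p - w * r) / (2 * w))"
      "p / (- (2 * w)) - r / 2 = - ((p + w * r) / (2 * w))" for p r
      using w(2) by (simp_all add: field_simps)
    have m1: "- (y / v) * (g / - z) = y * g / (v * z)" for v y z g :: complex
      by simp
    have m2: "t - y * (g - h) / z = t + y * (h - g) / z" for t y z g h :: complex
    proof -
      have "y * (g - h) = - (y * (h - g))" by (simp add: algebra_simps)
      then show ?thesis by simp
    qed
    show ?thesis unfolding c m1 by (rule m2)
  qed
  finally show ?thesis unfolding X(1) Hm wilson_phi_psi[OF H] .
qed

text \<open>Put \<open>g w = (a + k + w) G w\<close>. The forward and the backward difference of the basis element
  contribute \<open>g w\<close> and \<open>- g (- w)\<close> with the same factor, so only the odd part of \<open>g\<close> survives and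
  the denominator \<open>2 w\<close> cancels. The result is the lower basis element times an affine function of
  \<open>w\<^sup>2\<close>, that is, a combination of two consecutive basis elements.\<close>
lemma Wop_basis:
  assumes H: "H = [:a, 1:] * G" and G: "degree G \<le> 3"
  shows "Wop H (wilson_basis a (Suc k)) = smult (wilson_ev H (Suc k)) (wilson_basis a (Suc k)) +
    smult (- (of_nat (Suc k) * poly G (a + of_nat k))) (wilson_basis a k)"
proof (rule W.poly_eqI_nondegenerate)
  fix s
  assume nd: "centred_square u (s + 1/2) \<noteq> centred_square u (s - 1/2)"
    "centred_square u (s + 1) \<noteq> centred_square u s" "centred_square u (s - 1) \<noteq> centred_square u s"
  define w where "w = s + u / 2"
  let ?y = "- w\<^sup>2" and ?u = "- (w + 1)\<^sup>2" and ?d = "- (w - 1)\<^sup>2"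
  have w: "w \<noteq> 0" "2 * w + 1 \<noteq> 0" "2 * w - 1 \<noteq> 0"
  proof -
    have "centred_square u (s + 1/2) - centred_square u (s - 1/2) = - (2 * w)"
      "centred_square u (s + 1) - centred_square u s = - (2 * w + 1)"
      "centred_square u s - centred_square u (s - 1) = - (2 * w - 1)"
      by (simp_all add: centred_square_def w_def power2_eq_square field_simps)
    then have "- (2 * w) \<noteq> 0" "- (2 * w + 1) \<noteq> 0" "- (2 * w - 1) \<noteq> 0" using nd by (metis right_minus_eq)+
    then show "w \<noteq> 0" "2 * w + 1 \<noteq> 0" "2 * w - 1 \<noteq> 0"
      by (simp_all only: neg_equal_0_iff_equal mult_eq_0_iff simp_thms) simp_all
  qed
  have X: "centred_square u s = - w\<^sup>2" by (simp add: centred_square_def w_def)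
  have dH: "degree H \<le> 4"
    using G degree_mult_le[of "[:a, 1:]" G] by (simp add: H)
  obtain g0 g1 g2 g3 where Gc: "coeff G 0 = g0" "coeff G 1 = g1" "coeff G 2 = g2" "coeff G 3 = g3" by auto
  have "coeff G 4 = 0" using G by (simp add: coeff_eq_0)
  then have Gp: "poly G z = g0 + g1 * z + g2 * z ^ 2 + g3 * z ^ 3" for z
    using poly_degree4[of G z] G Gc by simp
  have Hc: "coeff H 4 = g3" "coeff H 3 = g2 + a * g3"
    using Gc \<open>coeff G 4 = 0\<close> by (simp_all add: H eval_nat_numeral)
  define A where "A = a + of_nat k"
  define b where "b = poly (wilson_basis a k) ?y"
  define f where "f = wilson_basis a (Suc k)"
  have b': "poly (wilson_basis a k) (- (- w)\<^sup>2) = b" by (simp add: b_def)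
  have sp: "(a + w) * (poly f ?u - poly f ?y) = - (of_nat k + 1) * (2 * w + 1) * (A + w) * b"
    using wilson_basis_shift_times[of a w k] by (simp add: f_def A_def b_def)
  have e: "- w + 1 = - (w - 1)" by simp
  have sm: "(a - w) * (poly f ?d - poly f ?y) = (of_nat k + 1) * (2 * w - 1) * (A - w) * b"
    using wilson_basis_shift_times[of a "- w" k] unfolding e power2_minus by (simp add: f_def A_def b_def algebra_simps)
  have fb: "poly f ?y = b * (A\<^sup>2 - w\<^sup>2)"
    by (simp add: f_def b_def A_def wilson_basis_def algebra_simps)
  have "poly (Wop H f) ?y =
    poly H w * (poly f ?u - poly f ?y) / (2 * w * (2 * w + 1)) +
    poly H (- w) * (poly f ?d - poly f ?y) / (2 * w * (2 * w - 1))"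
    by (rule Wop_difference[OF dH w_def w])
  also have "poly H w * (poly f ?u - poly f ?y) =
    poly G w * ((a + w) * (poly f ?u - poly f ?y))"
    by (simp add: H algebra_simps)
  also have "poly H (- w) * (poly f ?d - poly f ?y) =
    poly G (- w) * ((a - w) * (poly f ?d - poly f ?y))"
    by (simp add: H algebra_simps)
  also have "poly G w * ((a + w) * (poly f ?u - poly f ?y)) / (2 * w * (2 * w + 1)) =
    - (of_nat k + 1) * b * (poly G w * (A + w)) / (2 * w)"
    unfolding sp using w by (simp add: divide_simps)
  also have "poly G (- w) * ((a - w) * (poly f ?d - poly f ?y)) / (2 * w * (2 * w - 1)) =
    (of_nat k + 1) * b * (poly G (- w) * (A - w)) / (2 * w)"
    unfolding sm using w by (simp add: divide_simps)
  also have "- (of_nat k + 1) * b * (poly G w * (A + w)) / (2 * w) + (of_nat k + 1) * b * (poly G (- w) * (A - w)) / (2 * w) =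
    - (of_nat k + 1) * b * (poly G w * (A + w) - poly G (- w) * (A - w)) / (2 * w)"
    unfolding add_divide_distrib[symmetric]
    by (rule arg_cong[where f = "\<lambda>z. z / (2 * w)"]) (simp add: algebra_simps)
  also have "poly G w * (A + w) - poly G (- w) * (A - w) = (2 * w) * ((A * g3 + g2) * w\<^sup>2 + A * g1 + g0)"
    unfolding Gp by (simp add: algebra_simps eval_nat_numeral)
  also have "- (of_nat k + 1) * b * ((2 * w) * ((A * g3 + g2) * w\<^sup>2 + A * g1 + g0)) / (2 * w) =
    - (of_nat k + 1) * b * ((A * g3 + g2) * w\<^sup>2 + A * g1 + g0)"
    using w by simp
  also have "\<dots> = wilson_ev H (Suc k) * poly f ?y - of_nat (Suc k) * poly G A * b"
    unfolding fb wilson_ev_def Hc Gp A_def by (simp add: algebra_simps eval_nat_numeral)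
  finally show "poly (Wop H (wilson_basis a (Suc k))) (centred_square u s) =
    poly (smult (wilson_ev H (Suc k)) (wilson_basis a (Suc k)) +
      smult (- (of_nat (Suc k) * poly G (a + of_nat k))) (wilson_basis a k)) (centred_square u s)"
    unfolding X unfolding f_def b_def A_def by (simp add: algebra_simps)
qed

text \<open>With this factor the coefficient for \<open>k = 0\<close> in \<open>wilson_like_expansion\<close> is the product of the
  Pochhammer symbols by which the hypergeometric series is multiplied in the definitions of the
  Wilson and of the continuous dual Hahn polynomials.\<close>
definition wilson_like :: "complex poly \<Rightarrow> nat \<Rightarrow> complex poly" where
  "wilson_like H n = smult ((- 1) ^ n / fact n) (eigenpoly (Wop H) (wilson_ev H) n)"

lemma Wop_triangular: "triangular_operator (Wop H) (wilson_ev H)"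
  using W.sl_op_triangular[OF degree_wilson_phi_psi(1)[of H] degree_wilson_phi_psi(2)[of H]] unfolding sl_ev_wilson .

lemma wilson_like_expansion:
  assumes H: "H = [:a, 1:] * G" and G: "degree G \<le> 3"
  shows "wilson_like H n = (\<Sum>k\<le>n. smult (pochhammer (- of_nat n) k *
      (\<Prod>j<k. (of_nat n + of_nat j - 1) * coeff H 4 + coeff H 3) *
      (\<Prod>i\<in>{k..<n}. poly G (a + of_nat i)) / fact k) (wilson_basis a k))"
proof -
  interpret T: triangular_operator "Wop H" "wilson_ev H" by (rule Wop_triangular)
  define \<mu> where "\<mu> i = - (of_nat i * poly G (a + of_nat (i - 1)))" for i
  have "Wop H (wilson_basis a 0) = smult (wilson_ev H 0) (wilson_basis a 0)"
  proof -
    have "Dx (centred_square u) 1 = 0" by (rule W.Dx_unique) simp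
    then show ?thesis by (simp add: wilson_basis_def sl_op_def wilson_ev_def W.D.zero W.S.zero)
  qed
  moreover have "Wop H (wilson_basis a (Suc k)) = smult (wilson_ev H (Suc k)) (wilson_basis a (Suc k)) +
      smult (\<mu> (Suc k)) (wilson_basis a k)" for k
    using Wop_basis[OF assms, of k] by (simp add: \<mu>_def)
  ultimately have "annihilator (Wop H) (wilson_ev H) n (wilson_basis a n) =
    (\<Sum>k\<le>n. smult ((\<Prod>j<k. wilson_ev H n - wilson_ev H j) * (\<Prod>i\<in>{k<..n}. \<mu> i)) (wilson_basis a k))"
    by (rule T.annihilator_bidiagonal)
  moreover have "annihilator (Wop H) (wilson_ev H) n (wilson_basis a n) = eigenpoly (Wop H) (wilson_ev H) n"
    using T.annihilator_eq_eigenpoly[of "wilson_basis a n" n] wilson_basis_monic[of a n] by simp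
  ultimately have e: "eigenpoly (Wop H) (wilson_ev H) n =
    (\<Sum>k\<le>n. smult ((\<Prod>j<k. wilson_ev H n - wilson_ev H j) * (\<Prod>i\<in>{k<..n}. \<mu> i)) (wilson_basis a k))"
    by simp
  show ?thesis unfolding wilson_like_def e smult_sum_right smult_smult
  proof (rule sum.cong[OF refl], rule arg_cong2[where f = smult])
    fix k assume "k \<in> {..n}"
    then have k: "k \<le> n" by simp
    have "wilson_ev H n - wilson_ev H j =
        - ((- of_nat n + of_nat j) * ((of_nat n + of_nat j - 1) * coeff H 4 + coeff H 3))" for j
      unfolding wilson_ev_def by (simp add: algebra_simps)
    then have 1: "(\<Prod>j<k. wilson_ev H n - wilson_ev H j) =
       (- 1) ^ k * (pochhammer (- of_nat n) k * (\<Prod>j<k. (of_nat n + of_nat j - 1) * coeff H 4 + coeff H 3))"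
      by (simp only: prod_uminus prod.distrib pochhammer_prod atLeast0LessThan card_lessThan)
    have "{k<..n} = Suc ` {k..<n}" by (simp add: image_Suc_atLeastLessThan atLeastSucAtMost_greaterThanAtMost atLeastLessThanSuc_atLeastAtMost)
    then have "(\<Prod>i\<in>{k<..n}. \<mu> i) = prod \<mu> (Suc ` {k..<n})" by (rule arg_cong)
    also have "\<dots> = (\<Prod>i\<in>{k..<n}. (\<mu> \<circ> Suc) i)" by (rule prod.reindex) simp
    also have "\<dots> = (\<Prod>i\<in>{k..<n}. - (of_nat (Suc i) * poly G (a + of_nat i)))"
      by (simp add: \<mu>_def)
    also have "\<dots> = (- 1) ^ (n - k) * ((\<Prod>i\<in>{k..<n}. of_nat (Suc i)) * (\<Prod>i\<in>{k..<n}. poly G (a + of_nat i)))"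
      by (simp only: prod_uminus prod.distrib card_atLeastLessThan)
    also have "(\<Prod>i\<in>{k..<n}. of_nat (Suc i)) = (fact n / fact k :: complex)"
    proof -
      have "fact n = (fact k :: complex) * (\<Prod>i\<in>{k..<n}. of_nat (Suc i))"
        using k by (induction n rule: dec_induct) (simp_all add: mult.commute)
      then show ?thesis by simp
    qed
    finally have 2: "(\<Prod>i\<in>{k<..n}. \<mu> i) = (- 1) ^ (n - k) * (fact n / fact k * (\<Prod>i\<in>{k..<n}. poly G (a + of_nat i)))" .
    have s: "(- 1) ^ n * ((- 1) ^ k * (- 1) ^ (n - k)) = (1 :: complex)"
      using k by (simp flip: power_add power_mult_distrib)
    have "(- 1) ^ n / fact n * ((- 1) ^ k * p * ((- 1) ^ (n - k) * (fact n / fact k * q))) =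
      ((- 1) ^ n * ((- 1) ^ k * (- 1) ^ (n - k))) * (p * q / fact k)" for p q :: complex
      by simp
    then have r: "(- 1) ^ n / fact n * ((- 1) ^ k * p * ((- 1) ^ (n - k) * (fact n / fact k * q))) = p * q / fact k"
      for p q :: complex
      unfolding s by simp
    show "(- 1) ^ n / fact n * ((\<Prod>j<k. wilson_ev H n - wilson_ev H j) * (\<Prod>i\<in>{k<..n}. \<mu> i)) =
      pochhammer (- of_nat n) k * (\<Prod>j<k. (of_nat n + of_nat j - 1) * coeff H 4 + coeff H 3) *
      (\<Prod>i\<in>{k..<n}. poly G (a + of_nat i)) / fact k"
      unfolding 1 2 by (rule r)
  qed (rule refl)
qed

lemma pochhammer_split: "k \<le> n \<Longrightarrow> pochhammer (z :: complex) n = pochhammer z k * (\<Prod>i\<in>{k..<n}. z + of_nat i)"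
  unfolding pochhammer_prod by (simp add: prod.atLeastLessThan_concat)

lemma pochhammer_neg_vanishes: "n < k \<Longrightarrow> pochhammer (- of_nat n :: complex) k = 0"
  by (simp add: pochhammer_of_nat_eq_0_iff)

definition wilson_quartic :: "complex \<Rightarrow> complex \<Rightarrow> complex \<Rightarrow> complex \<Rightarrow> complex poly" where
  "wilson_quartic a b c d = [:a, 1:] * ([:b, 1:] * [:c, 1:] * [:d, 1:])"

definition dual_hahn_cubic :: "complex \<Rightarrow> complex \<Rightarrow> complex \<Rightarrow> complex poly" where
  "dual_hahn_cubic a b c = [:a, 1:] * ([:b, 1:] * [:c, 1:])"

lemma hyp_wilson_like:
  assumes nz: "pochhammer (a + b) n \<noteq> 0" "pochhammer (a + c) n \<noteq> 0" "pochhammer (a + d) n \<noteq> 0"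
  shows "pochhammer (a + b) n * pochhammer (a + c) n * pochhammer (a + d) n *
      hyp [- of_nat n, of_nat n + a + b + c + d - 1, a - w, a + w] [a + b, a + c, a + d] 1 =
    poly (wilson_like (wilson_quartic a b c d) n) (- w\<^sup>2)"
proof -
  define G where "G = [:b, 1:] * [:c, 1:] * [:d, 1:]"
  define H where "H = [:a, 1:] * G"
  have dG: "degree G \<le> 3" unfolding G_def by (subst degree_mult_eq; simp)+
  have c: "coeff H 4 = 1" "coeff H 3 = a + b + c + d"
    by (simp_all add: H_def G_def eval_nat_numeral)
  have f: "(\<Prod>j<k. (of_nat n + of_nat j - 1) * coeff H 4 + coeff H 3) = pochhammer (of_nat n + a + b + c + d - 1) k" for k
    unfolding c pochhammer_prod atLeast0LessThan by (rule prod.cong) (simp_all add: algebra_simps)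
  have nzk: "pochhammer (a + z) k \<noteq> 0" if "k \<le> n" "pochhammer (a + z) n \<noteq> 0" for k z
    using that pochhammer_split[of k n "a + z"] by auto
  have "hyp [- of_nat n, of_nat n + a + b + c + d - 1, a - w, a + w] [a + b, a + c, a + d] 1 =
    (\<Sum>k\<le>n. pochhammer (- of_nat n) k * pochhammer (of_nat n + a + b + c + d - 1) k *
      poly (wilson_basis a k) (- w\<^sup>2) /
      (pochhammer (a + b) k * pochhammer (a + c) k * pochhammer (a + d) k) / fact k)"
    unfolding hyp_def poly_wilson_basis
    by (subst suminf_finite[where N = "{..n}"]) (auto simp: pochhammer_neg_vanishes mult.assoc)
  also have "pochhammer (a + b) n * pochhammer (a + c) n * pochhammer (a + d) n * \<dots> =
    poly (wilson_like H n) (- w\<^sup>2)"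
    unfolding wilson_like_expansion[OF H_def dG] f poly_sum sum_distrib_left
  proof (rule sum.cong[OF refl])
    fix k assume "k \<in> {..n}"
    then have k: "k \<le> n" by simp
    have "(\<Prod>i\<in>{k..<n}. poly G (a + of_nat i)) = (\<Prod>i\<in>{k..<n}. a + b + of_nat i) *
      (\<Prod>i\<in>{k..<n}. a + c + of_nat i) * (\<Prod>i\<in>{k..<n}. a + d + of_nat i)"
      unfolding prod.distrib[symmetric] by (rule prod.cong) (simp_all add: G_def algebra_simps)
    then show "pochhammer (a + b) n * pochhammer (a + c) n * pochhammer (a + d) n *
      (pochhammer (- of_nat n) k * pochhammer (of_nat n + a + b + c + d - 1) k *
        poly (wilson_basis a k) (- w\<^sup>2) /
        (pochhammer (a + b) k * pochhammer (a + c) k * pochhammer (a + d) k) / fact k) =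
      poly (smult (pochhammer (- of_nat n) k * pochhammer (of_nat n + a + b + c + d - 1) k *
        (\<Prod>i\<in>{k..<n}. poly G (a + of_nat i)) / fact k) (wilson_basis a k)) (- w\<^sup>2)"
      using nzk[OF k nz(1)] nzk[OF k nz(2)] nzk[OF k nz(3)]
      unfolding pochhammer_split[OF k, of "a + b"] pochhammer_split[OF k, of "a + c"] pochhammer_split[OF k, of "a + d"]
      by simp
  qed
  finally show ?thesis by (simp add: wilson_quartic_def H_def G_def)
qed

lemma hyp_dual_hahn_like:
  assumes nz: "pochhammer (a + b) n \<noteq> 0" "pochhammer (a + c) n \<noteq> 0"
  shows "pochhammer (a + b) n * pochhammer (a + c) n * hyp [- of_nat n, a - w, a + w] [a + b, a + c] 1 =
    poly (wilson_like (dual_hahn_cubic a b c) n) (- w\<^sup>2)"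
proof -
  define G where "G = [:b, 1:] * [:c, 1:]"
  define H where "H = [:a, 1:] * G"
  have dG: "degree G \<le> 3" unfolding G_def by (subst degree_mult_eq; simp)+
  have c: "coeff H 4 = 0" "coeff H 3 = 1"
    by (simp_all add: H_def G_def eval_nat_numeral)
  have f: "(\<Prod>j<k. (of_nat n + of_nat j - 1) * coeff H 4 + coeff H 3) = 1" for k
    unfolding c by simp
  have nzk: "pochhammer (a + z) k \<noteq> 0" if "k \<le> n" "pochhammer (a + z) n \<noteq> 0" for k z
    using that pochhammer_split[of k n "a + z"] by auto
  have "hyp [- of_nat n, a - w, a + w] [a + b, a + c] 1 =
    (\<Sum>k\<le>n. pochhammer (- of_nat n) k * poly (wilson_basis a k) (- w\<^sup>2) /
      (pochhammer (a + b) k * pochhammer (a + c) k) / fact k)"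
    unfolding hyp_def poly_wilson_basis
    by (subst suminf_finite[where N = "{..n}"]) (auto simp: pochhammer_neg_vanishes mult.assoc)
  also have "pochhammer (a + b) n * pochhammer (a + c) n * \<dots> =
    poly (wilson_like H n) (- w\<^sup>2)"
    unfolding wilson_like_expansion[OF H_def dG] f poly_sum sum_distrib_left
  proof (rule sum.cong[OF refl])
    fix k assume "k \<in> {..n}"
    then have k: "k \<le> n" by simp
    have "(\<Prod>i\<in>{k..<n}. poly G (a + of_nat i)) = (\<Prod>i\<in>{k..<n}. a + b + of_nat i) *
      (\<Prod>i\<in>{k..<n}. a + c + of_nat i)"
      unfolding prod.distrib[symmetric] by (rule prod.cong) (simp_all add: G_def algebra_simps)
    then show "pochhammer (a + b) n * pochhammer (a + c) n *
      (pochhammer (- of_nat n) k * poly (wilson_basis a k) (- w\<^sup>2) /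
        (pochhammer (a + b) k * pochhammer (a + c) k) / fact k) =
      poly (smult (pochhammer (- of_nat n) k * 1 *
        (\<Prod>i\<in>{k..<n}. poly G (a + of_nat i)) / fact k) (wilson_basis a k)) (- w\<^sup>2)"
      using nzk[OF k nz(1)] nzk[OF k nz(2)]
      unfolding pochhammer_split[OF k, of "a + b"] pochhammer_split[OF k, of "a + c"]
      by simp
  qed
  finally show ?thesis by (simp add: dual_hahn_cubic_def H_def G_def)
qed

lemma coeffwise_limit_wilson_like:
  assumes "coeffwise_limit H H0 F"
  shows "coeffwise_limit (\<lambda>t. wilson_like (H t) n) (wilson_like H0 n) F"
  unfolding wilson_like_def
  using W.coeffwise_limit_eigenpoly[OF coeffwise_limit_linear[OF wilson_phi_linear assms]
      coeffwise_limit_linear[OF wilson_psi_linear assms]]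
  unfolding sl_ev_wilson by (intro coeffwise_limit_smult tendsto_const)

lemma eventually_pochhammer_nonzero:
  "\<forall>\<^sub>F t in at 0. pochhammer ((a + t) + (b + t) :: complex) n \<noteq> 0"
proof -
  have "\<forall>\<^sub>F t in at 0. \<forall>k\<in>{..<n}. poly [:a + b + of_nat k, 2:] t \<noteq> 0"
    by (rule eventually_ball_finite) (simp_all only: finite_lessThan, intro ballI eventually_poly_nonzero, simp)
  then show ?thesis
  proof eventually_elim
    case (elim t)
    show ?case
    proof
      assume "pochhammer ((a + t) + (b + t)) n = 0"
      then obtain k where "k < n" "(a + t) + (b + t) = - of_nat k" by (auto simp: pochhammer_eq_0_iff)
      moreover have "poly [:a + b + of_nat k, 2:] t = ((a + t) + (b + t)) + of_nat k" by (simp add: algebra_simps)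
      ultimately have "poly [:a + b + of_nat k, 2:] t = 0" by simp
      then show False using elim \<open>k < n\<close> by blast
    qed
  qed
qed

text \<open>At generic parameters the expression whose limit defines the left-hand side is a value of the
  right-hand side, which is continuous in the parameters.\<close>
lemma wilson_eq: "wilson n a b c d = wilson_like (wilson_quartic a b c d) n"
proof -
  let ?H = "\<lambda>\<tau>. wilson_quartic (fst \<tau>) (fst (snd \<tau>)) (fst (snd (snd \<tau>))) (snd (snd (snd \<tau>)))"
  let ?S = "{(a, b, c, d). pochhammer (a + b) n \<noteq> (0::complex) \<and>
        pochhammer (a + c) n \<noteq> 0 \<and> pochhammer (a + d) n \<noteq> 0}"
  let ?F = "at (a, b, c, d) within ?S"
  let ?g = "\<lambda>t (a, b, c, d). pochhammer (a + b) n * pochhammer (a + c) n * pochhammer (a + d) n *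
          hyp [- of_nat n, of_nat n + a + b + c + d - 1, a - \<i> * t, a + \<i> * t]
              [a + b, a + c, a + d] 1"
  have nontriv: "?F \<noteq> bot"
  proof (rule at_within_nontrivial[where \<gamma> = "\<lambda>t. (a + t, b + t, c + t, d + t)"])
    have "((\<lambda>t. (a + t, b + t, c + t, d + t)) \<longlongrightarrow> (a + 0, b + 0, c + 0, d + 0)) (at 0)"
      by (intro tendsto_intros)
    then show "((\<lambda>t. (a + t, b + t, c + t, d + t)) \<longlongrightarrow> (a, b, c, d)) (at 0)" by simp
    show "\<forall>\<^sub>F t in at 0. (a + t, b + t, c + t, d + t) \<noteq> (a, b, c, d)"
      by (simp add: eventually_at_filter)
    show "\<forall>\<^sub>F t in at 0. (a + t, b + t, c + t, d + t) \<in> ?S"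
      using eventually_pochhammer_nonzero[of a b n] eventually_pochhammer_nonzero[of a c n]
        eventually_pochhammer_nonzero[of a d n]
      by eventually_elim simp
  qed
  have lim: "(?g t \<longlongrightarrow> poly (wilson_like (wilson_quartic a b c d) n) (t\<^sup>2)) ?F" for t
  proof (rule tendsto_within_transform)
    have id: "((\<lambda>\<tau>. \<tau>) \<longlongrightarrow> (a, b, c, d)) ?F" by (rule tendsto_ident_at)
    note p = tendsto_fst[OF id] tendsto_fst[OF tendsto_snd[OF id]]
      tendsto_fst[OF tendsto_snd[OF tendsto_snd[OF id]]] tendsto_snd[OF tendsto_snd[OF tendsto_snd[OF id]]]
    have "coeffwise_limit (\<lambda>\<tau>. ?H \<tau>)
        (wilson_quartic a b c d) ?F"
      unfolding wilson_quartic_def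
      using p by (intro coeffwise_limit_mult coeffwise_limit_factor tendsto_const) simp_all
    from coeffwise_limit_poly[OF coeffwise_limit_wilson_like[OF this]]
    show "((\<lambda>\<tau>. poly (wilson_like (?H \<tau>) n) (t\<^sup>2))
      \<longlongrightarrow> poly (wilson_like (wilson_quartic a b c d) n) (t\<^sup>2)) ?F" .
    fix \<tau> assume "\<tau> \<in> ?S"
    then show "?g t \<tau> = poly (wilson_like (?H \<tau>) n) (t\<^sup>2)"
      using hyp_wilson_like[of _ _ n _ _ "\<i> * t"] by (auto simp: power_mult_distrib)
  qed
  show ?thesis unfolding wilson_def
  proof (rule the_equality)
    fix p assume "\<forall>t. (?g t \<longlongrightarrow> poly p (t\<^sup>2)) ?F"
    then have "poly p (t\<^sup>2) = poly (wilson_like (wilson_quartic a b c d) n) (t\<^sup>2)" for t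
      using tendsto_unique[OF nontriv _ lim] by blast
    then have "poly p = poly (wilson_like (wilson_quartic a b c d) n)" by (metis ext power2_csqrt)
    then show "p = wilson_like (wilson_quartic a b c d) n" by (simp add: poly_eq_poly_eq_iff)
  qed (use lim in blast)
qed

lemma cont_dual_hahn_eq: "cont_dual_hahn n a b c = wilson_like (dual_hahn_cubic a b c) n"
proof -
  let ?H = "\<lambda>\<tau>. dual_hahn_cubic (fst \<tau>) (fst (snd \<tau>)) (snd (snd \<tau>))"
  let ?S = "{(a, b, c). pochhammer (a + b) n \<noteq> (0::complex) \<and> pochhammer (a + c) n \<noteq> 0}"
  let ?F = "at (a, b, c) within ?S"
  let ?g = "\<lambda>t (a, b, c). pochhammer (a + b) n * pochhammer (a + c) n *
          hyp [- of_nat n, a - \<i> * t, a + \<i> * t] [a + b, a + c] 1"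
  have nontriv: "?F \<noteq> bot"
  proof (rule at_within_nontrivial[where \<gamma> = "\<lambda>t. (a + t, b + t, c + t)"])
    have "((\<lambda>t. (a + t, b + t, c + t)) \<longlongrightarrow> (a + 0, b + 0, c + 0)) (at 0)"
      by (intro tendsto_intros)
    then show "((\<lambda>t. (a + t, b + t, c + t)) \<longlongrightarrow> (a, b, c)) (at 0)" by simp
    show "\<forall>\<^sub>F t in at 0. (a + t, b + t, c + t) \<noteq> (a, b, c)"
      by (simp add: eventually_at_filter)
    show "\<forall>\<^sub>F t in at 0. (a + t, b + t, c + t) \<in> ?S"
      using eventually_pochhammer_nonzero[of a b n] eventually_pochhammer_nonzero[of a c n]
      by eventually_elim simp
  qed
  have lim: "(?g t \<longlongrightarrow> poly (wilson_like (dual_hahn_cubic a b c) n) (t\<^sup>2)) ?F" for t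
  proof (rule tendsto_within_transform)
    have id: "((\<lambda>\<tau>. \<tau>) \<longlongrightarrow> (a, b, c)) ?F" by (rule tendsto_ident_at)
    note p = tendsto_fst[OF id] tendsto_fst[OF tendsto_snd[OF id]] tendsto_snd[OF tendsto_snd[OF id]]
    have "coeffwise_limit (\<lambda>\<tau>. ?H \<tau>)
        (dual_hahn_cubic a b c) ?F"
      unfolding dual_hahn_cubic_def
      using p by (intro coeffwise_limit_mult coeffwise_limit_factor tendsto_const) simp_all
    from coeffwise_limit_poly[OF coeffwise_limit_wilson_like[OF this]]
    show "((\<lambda>\<tau>. poly (wilson_like (?H \<tau>) n) (t\<^sup>2))
      \<longlongrightarrow> poly (wilson_like (dual_hahn_cubic a b c) n) (t\<^sup>2)) ?F" .
    fix \<tau> assume "\<tau> \<in> ?S"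
    then show "?g t \<tau> = poly (wilson_like (?H \<tau>) n) (t\<^sup>2)"
      using hyp_dual_hahn_like[of _ _ n _ "\<i> * t"] by (auto simp: power_mult_distrib)
  qed
  show ?thesis unfolding cont_dual_hahn_def
  proof (rule the_equality)
    fix p assume "\<forall>t. (?g t \<longlongrightarrow> poly p (t\<^sup>2)) ?F"
    then have "poly p (t\<^sup>2) = poly (wilson_like (dual_hahn_cubic a b c) n) (t\<^sup>2)" for t
      using tendsto_unique[OF nontriv _ lim] by blast
    then have "poly p = poly (wilson_like (dual_hahn_cubic a b c) n)" by (metis ext power2_csqrt)
    then show "p = wilson_like (dual_hahn_cubic a b c) n" by (simp add: poly_eq_poly_eq_iff)
  qed (use lim in blast)
qed

lemma wilson_like_smult: "wilson_like (smult c H) n = smult (c ^ n) (wilson_like H n)"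
proof -
  interpret T: triangular_operator "Wop H" "wilson_ev H" by (rule Wop_triangular)
  have "Wop (smult c H) = (\<lambda>p. smult c (Wop H p))"
    by (simp add: fun_eq_iff sl_op_def linear_poly_operator.smult[OF wilson_phi_linear]
        linear_poly_operator.smult[OF wilson_psi_linear] smult_add_right)
  moreover have "wilson_ev (smult c H) = (\<lambda>k. c * wilson_ev H k)"
    by (simp add: fun_eq_iff wilson_ev_def algebra_simps)
  ultimately show ?thesis
    unfolding wilson_like_def by (simp add: T.eigenpoly_scale mult.commute)
qed

lemma wilson_like_eigen: "Wop H (wilson_like H n) = smult (wilson_ev H n) (wilson_like H n)"
proof -
  interpret T: triangular_operator "Wop H" "wilson_ev H" by (rule Wop_triangular)
  show ?thesis unfolding wilson_like_def by (simp add: T.smult T.eigenpoly_eigen mult.commute)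
qed

lemma wilson_ev_separated:
  assumes "wilson_like H n \<noteq> 0" "degree (wilson_like H n) = n" "j < n"
  shows "wilson_ev H j \<noteq> wilson_ev H n"
proof -
  interpret T: triangular_operator "Wop H" "wilson_ev H" by (rule Wop_triangular)
  have "coeff (wilson_like H n) n \<noteq> 0" using assms by (metis leading_coeff_0_iff)
  then have "\<forall>i\<in>{..<n}. wilson_ev H n \<noteq> wilson_ev H i" by (simp add: wilson_like_def T.coeff_eigenpoly)
  then show ?thesis using assms(3) by (metis lessThan_iff)
qed

text \<open>The coefficients of \<open>w\<^sup>4\<close> and \<open>w\<^sup>3\<close> in \<open>H\<close> are the leading coefficients of \<open>\<phi>\<close> and \<open>\<psi>\<close> (as
  polynomials of degree \<open>2\<close> and \<open>1\<close>), so \<open>H\<close> has degree \<open>4\<close> or \<open>3\<close>. Normalizing \<open>H\<close> to be monic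
  rescales the eigenpolynomials by homogeneity.\<close>
lemma wilson_family_covers:
  assumes \<phi>: "degree \<phi> \<le> 2" and \<psi>: "degree \<psi> = 1"
  shows "\<exists>R. wilson_family u R \<and> (\<forall>n. \<exists>k. k \<noteq> 0 \<and>
    R n = smult k (eigenpoly (sl_op (centred_square u) \<phi> \<psi>) (W.sl_ev \<phi> \<psi>) n))"
proof -
  \<comment> \<open>The polynomial \<open>\<phi> (- w\<^sup>2) - w \<psi> (- w\<^sup>2)\<close> in \<open>w\<close>.\<close>
  define H where "H = [:coeff \<phi> 0, - coeff \<psi> 0, - coeff \<phi> 1, coeff \<psi> 1, coeff \<phi> 2:]"
  have "wilson_phi H = \<phi>"
    using \<phi> by (auto simp: poly_eq_iff wilson_phi_def H_def coeff_pCons eval_nat_numeral coeff_eq_0 split: nat.split)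
  moreover have "wilson_psi H = \<psi>"
    using \<psi> by (auto simp: poly_eq_iff wilson_psi_def H_def coeff_pCons eval_nat_numeral coeff_eq_0 split: nat.split)
  ultimately have R: "wilson_like H n = smult ((- 1) ^ n / fact n) (eigenpoly (sl_op (centred_square u) \<phi> \<psi>) (W.sl_ev \<phi> \<psi>) n)" for n
    unfolding wilson_like_def sl_ev_wilson[symmetric] by simp
  have c1: "coeff \<psi> 1 \<noteq> 0" using \<psi> by (metis leading_coeff_0_iff degree_0 zero_neq_one)
  have "\<exists>R c. wilson_family u R \<and> c \<noteq> 0 \<and> (\<forall>n. wilson_like H n = smult (c ^ n) (R n))"
  proof (cases "coeff \<phi> 2 = 0")
    case True
    then have d: "degree H = 3" "lead_coeff H = coeff \<psi> 1" using c1 by (simp_all add: H_def)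
    then obtain f :: "nat \<Rightarrow> complex" where f: "H = smult (coeff \<psi> 1) (\<Prod>i<3. [:f i, 1:])"
      using monic_linear_factors[OF d(1)] unfolding d(2) by blast
    have e: "H = smult (coeff \<psi> 1) (dual_hahn_cubic (f 0) (f 1) (f 2))"
      by (subst f) (simp only: dual_hahn_cubic_def prod_lessThan_3)
    then have w: "wilson_like H n = smult (coeff \<psi> 1 ^ n) (cont_dual_hahn n (f 0) (f 1) (f 2))" for n
      by (simp only: e wilson_like_smult cont_dual_hahn_eq)
    have "wilson_family u (\<lambda>n. cont_dual_hahn n (f 0) (f 1) (f 2))"
      unfolding wilson_family_def
      by (rule disjI2, intro exI[of _ "f 0 - u / 2"] exI[of _ "f 1 - u / 2"] exI[of _ "f 2 - u / 2"]) simp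
    then show ?thesis using w c1 by blast
  next
    case False
    then have d: "degree H = 4" "lead_coeff H = coeff \<phi> 2" by (simp_all add: H_def)
    then obtain f :: "nat \<Rightarrow> complex" where f: "H = smult (coeff \<phi> 2) (\<Prod>i<4. [:f i, 1:])"
      using monic_linear_factors[OF d(1)] unfolding d(2) by blast
    have e: "H = smult (coeff \<phi> 2) (wilson_quartic (f 0) (f 1) (f 2) (f 3))"
      by (subst f) (simp only: wilson_quartic_def prod_lessThan_4)
    then have w: "wilson_like H n = smult (coeff \<phi> 2 ^ n) (wilson n (f 0) (f 1) (f 2) (f 3))" for n
      by (simp only: e wilson_like_smult wilson_eq)
    have "wilson_family u (\<lambda>n. wilson n (f 0) (f 1) (f 2) (f 3))"
      unfolding wilson_family_def
      by (rule disjI1, intro exI[of _ "f 0 - u / 2"] exI[of _ "f 1 - u / 2"] exI[of _ "f 2 - u / 2"]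
          exI[of _ "f 3 - u / 2"]) simp
    then show ?thesis using w False by blast
  qed
  then obtain R c where Rc: "wilson_family u R" "c \<noteq> 0" "\<And>n. wilson_like H n = smult (c ^ n) (R n)" by blast
  have "R n = smult ((- 1) ^ n / fact n / c ^ n) (eigenpoly (sl_op (centred_square u) \<phi> \<psi>) (W.sl_ev \<phi> \<psi>) n)" for n
  proof -
    have "smult (1 / c ^ n) (wilson_like H n) = R n" using Rc(2) Rc(3)[of n] by simp
    then show ?thesis unfolding R by (simp add: mult.commute)
  qed
  moreover have "(- 1) ^ n / fact n / c ^ n \<noteq> 0" for n using Rc(2) by simp
  ultimately show ?thesis using Rc(1) by blast
qed

lemma wilson_family_solves:
  assumes R: "wilson_family u R" and deg: "\<And>n. R n \<noteq> 0 \<and> degree (R n) = n"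
  shows "\<exists>\<phi> \<psi>. degree \<phi> \<le> 2 \<and> degree \<psi> \<le> 1 \<and>
    (\<forall>n. sl_op (centred_square u) \<phi> \<psi> (R n) = smult (W.sl_ev \<phi> \<psi> n) (R n)) \<and>
    (\<forall>n. \<forall>j<n. W.sl_ev \<phi> \<psi> j \<noteq> W.sl_ev \<phi> \<psi> n)"
proof -
  obtain H where H: "\<And>n. R n = wilson_like H n"
    using R unfolding wilson_family_def wilson_eq cont_dual_hahn_eq by blast
  show ?thesis
    using degree_wilson_phi_psi[of H] wilson_like_eigen[of H] wilson_ev_separated[of H] deg
    unfolding H sl_ev_wilson[symmetric] by blast
qed

end

lemma wilson_classification:
  fixes P :: "nat \<Rightarrow> complex poly" and c4 c5 :: complex
  assumes P: "\<And>n. P n \<noteq> 0 \<and> degree (P n) = n" and c4: "c4 \<noteq> 0"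
  defines "x \<equiv> quad_lattice c4 c5" and "u \<equiv> c5 / c4"
  shows "(\<exists>\<phi> \<psi> l. degree \<phi> \<le> 2 \<and> degree \<psi> = 1 \<and>
           (\<forall>n. sl_solution x \<phi> \<psi> (l n) n (P n) \<and> sl_unique x \<phi> \<psi> (l n) n))
         \<longleftrightarrow> (\<exists>R. wilson_family u R \<and>
           (\<forall>n. \<exists>k. k \<noteq> 0 \<and> (\<forall>s. poly (P n) (x s) = k * poly (R n) (- (s + u / 2)\<^sup>2))))" (is ?equivalence)
    and "\<forall>\<phi> \<psi> l. degree \<phi> \<le> 2 \<and> degree \<psi> = 1 \<and> (\<forall>n. sl_solution x \<phi> \<psi> (l n) n (P n))
         \<longrightarrow> (\<exists>R. wilson_family u R \<and> (\<forall>n. sl_unique x \<phi> \<psi> (l n) n \<longrightarrow>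
              (\<exists>k. k \<noteq> 0 \<and> (\<forall>s. poly (P n) (x s) = k * poly (R n) (- (s + u / 2)\<^sup>2)))))" (is ?covered)
proof -
  interpret W: quadratic_lattice "centred_square u" "[:- (1/2), 2:]" "[:0, - 4:]" 1 of_nat "\<lambda>_. 1"
    by (rule centred_square_lattice)
  have "x = (\<lambda>s. c4 * s\<^sup>2 + c5 * s + 0)" by (auto simp: x_def quad_lattice_def)
  then have x: "quadratic_lattice x [:c4 / 2, 2:] [:c5\<^sup>2 - 4 * c4 * 0, 4 * c4:] 1 of_nat (\<lambda>_. 1)"
    using quad_lattice_instance[OF c4, of c5 0] by simp
  have "- c4 \<noteq> 0" using c4 by simp
  note * = W.classification[OF x this quad_lattice_eq_centred[OF c4, of c5, folded x_def u_def] P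
      wilson_family_covers wilson_family_solves, unfolded centred_square_def]
  show ?equivalence by (rule *(1))
  show ?covered by (rule *(2))
qed

lemma hyp_eq_wilson:
  assumes "pochhammer (a + b + u) n * pochhammer (a + c + u) n * pochhammer (a + d + u) n \<noteq> 0"
  shows "hyp [- of_nat n, a + b + c + d + 2 * u + of_nat n - 1, a - s, a + u + s]
              [a + b + u, a + c + u, a + d + u] 1
          = poly (wilson n (a + u/2) (b + u/2) (c + u/2) (d + u/2)) (- (s + u / 2)\<^sup>2) /
            (pochhammer (a + b + u) n * pochhammer (a + c + u) n * pochhammer (a + d + u) n)"
proof -
  have e: "a + u/2 + (z + u/2) = a + z + u" for z by (simp add: field_simps)
  have l: "of_nat n + (a + u/2) + (b + u/2) + (c + u/2) + (d + u/2) - 1 = a + b + c + d + 2 * u + of_nat n - 1"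
    "a + u/2 - (s + u/2) = a - s" "a + s + u = a + u + s" by (simp_all add: field_simps)
  have "pochhammer (a + b + u) n * pochhammer (a + c + u) n * pochhammer (a + d + u) n *
      hyp [- of_nat n, a + b + c + d + 2 * u + of_nat n - 1, a - s, a + u + s]
        [a + b + u, a + c + u, a + d + u] 1 =
    poly (wilson n (a + u/2) (b + u/2) (c + u/2) (d + u/2)) (- (s + u / 2)\<^sup>2)"
    using hyp_wilson_like[where u = u and a = "a + u/2" and b = "b + u/2" and c = "c + u/2"
        and d = "d + u/2" and w = "s + u/2" and n = n] assms
    unfolding e l wilson_eq[where u = u, symmetric] by simp
  then show ?thesis using assms by (metis nonzero_mult_div_cancel_left)
qed

lemma hyp_eq_cont_dual_hahn:
  assumes "pochhammer (a + b + u) n * pochhammer (a + c + u) n \<noteq> 0"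
  shows "hyp [- of_nat n, a - s, a + u + s] [a + b + u, a + c + u] 1
          = poly (cont_dual_hahn n (a + u/2) (b + u/2) (c + u/2)) (- (s + u / 2)\<^sup>2) /
            (pochhammer (a + b + u) n * pochhammer (a + c + u) n)"
proof -
  have e: "a + u/2 + (z + u/2) = a + z + u" for z by (simp add: field_simps)
  have l: "a + u/2 - (s + u/2) = a - s" "a + s + u = a + u + s" by (simp_all add: field_simps)
  have "pochhammer (a + b + u) n * pochhammer (a + c + u) n *
      hyp [- of_nat n, a - s, a + u + s] [a + b + u, a + c + u] 1 =
    poly (cont_dual_hahn n (a + u/2) (b + u/2) (c + u/2)) (- (s + u / 2)\<^sup>2)"
    using hyp_dual_hahn_like[where u = u and a = "a + u/2" and b = "b + u/2" and c = "c + u/2"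
        and w = "s + u/2" and n = n] assms
    unfolding e l cont_dual_hahn_eq[where u = u, symmetric] by simp
  then show ?thesis using assms by (metis nonzero_mult_div_cancel_left)
qed

section \<open>The q-lattice\<close>

lemma powr_half_complex: "q > 0 \<Longrightarrow> complex_of_real q powr (1/2) = of_real (sqrt q)"
proof -
  assume "q > 0"
  then have "complex_of_real q powr (of_real (1/2)) = of_real (q powr (1/2))"
    by (subst powr_of_real) auto
  then show ?thesis using \<open>q > 0\<close> by (simp add: powr_half_sqrt)
qed

lemma powr_surj_nonzero:
  assumes "q > 0" "q \<noteq> 1" "z \<noteq> 0"
  shows "\<exists>s. complex_of_real q powr s = z"
proof
  have "ln q \<noteq> 0" using assms by simp
  then show "complex_of_real q powr (Ln z / of_real (ln q)) = z"
    using assms by (simp add: powr_def Ln_of_real)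
qed

text \<open>A half step on the lattice multiplies \<open>q\<^sup>s\<close> by \<open>p\<close>, so the difference of neighbouring values is
  a multiple of \<open>\<kappa> = p - 1 / p\<close>.\<close>
context
  fixes q :: real and p Q \<kappa> :: complex
  assumes q: "q > 0" "q \<noteq> 1"
  defines "p \<equiv> of_real (sqrt q)" and "Q \<equiv> of_real q"
  defines "\<kappa> \<equiv> p - inverse p"
begin

lemma p_facts: "p \<noteq> 0" "p\<^sup>2 = Q" "Q \<noteq> 0" "Q \<noteq> 1" "\<kappa> \<noteq> 0" "p + inverse p \<noteq> 0"
proof -
  show p0: "p \<noteq> 0" using q by (simp add: p_def)
  show pQ: "p\<^sup>2 = Q" using q by (simp add: p_def Q_def flip: of_real_power)
  show "Q \<noteq> 0" "Q \<noteq> 1" using q by (simp_all add: Q_def)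
  show "\<kappa> \<noteq> 0"
  proof
    assume "\<kappa> = 0"
    then have "p\<^sup>2 = 1" using p0 by (simp add: \<kappa>_def field_simps power2_eq_square)
    then show False using pQ \<open>Q \<noteq> 1\<close> by simp
  qed
  show "p + inverse p \<noteq> 0"
  proof
    assume "p + inverse p = 0"
    then have "p * (p + inverse p) = 0" by simp
    then have "Q + 1 = 0" using p0 pQ by (simp add: distrib_left power2_eq_square)
    then have "of_real (q + 1) = (0 :: complex)" by (simp add: Q_def)
    then show False using q by (simp only: of_real_eq_0_iff)
  qed
qed

lemma Q_power_neq_1: "n > 0 \<Longrightarrow> Q ^ n \<noteq> 1"
proof
  assume "n > 0" "Q ^ n = 1"
  then have "q ^ n = 1" unfolding Q_def by (metis of_real_1 of_real_eq_iff of_real_power)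
  then show False using q \<open>n > 0\<close> power_eq_imp_eq_base[of q n 1] by simp
qed

lemma Q_power_inj: "Q ^ m = Q ^ n \<Longrightarrow> m = n"
proof (induction m n rule: linorder_wlog)
  case (le m n)
  have "Q ^ m * Q ^ (n - m) = Q ^ n" using le(1) by (simp flip: power_add)
  then have "Q ^ m * Q ^ (n - m) = Q ^ m * 1" using le(2) by simp
  then have "Q ^ (n - m) = 1" using p_facts(3) by simp
  then show ?case using Q_power_neq_1[of "n - m"] le by fastforce
qed metis

text \<open>The leading coefficients of \<open>D x\<^sup>n\<close> and \<open>S x\<^sup>n\<close>: in terms of \<open>q = e\<^sup>2\<^sup>h\<close> these are
  \<open>sinh (n h) / sinh h\<close> and \<open>cosh (n h)\<close>, and the recurrences are addition theorems.\<close>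
definition half_powers_diff :: "nat \<Rightarrow> complex" where
  "half_powers_diff n = (p ^ n - inverse p ^ n) / \<kappa>"

definition half_powers_mean :: "nat \<Rightarrow> complex" where
  "half_powers_mean n = (p ^ n + inverse p ^ n) / 2"

lemma powr_steps:
  "Q powr (s + 1/2) = Q powr s * p" "Q powr (s - 1/2) = Q powr s * inverse p"
  "Q powr (s + 1) = Q powr s * Q" "Q powr (s - 1) = Q powr s * inverse Q"
proof -
  have h: "Q powr (1/2) = p" unfolding Q_def p_def by (rule powr_half_complex[OF q(1)])
  show "Q powr (s + 1/2) = Q powr s * p" by (simp only: powr_add h)
  show "Q powr (s - 1/2) = Q powr s * inverse p" unfolding powr_diff h by (rule divide_inverse)
  show "Q powr (s + 1) = Q powr s * Q" using p_facts(3) by (simp only: powr_add powr_to_1)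
  show "Q powr (s - 1) = Q powr s * inverse Q" using p_facts(3) unfolding powr_diff by (simp add: divide_inverse)
qed

lemma q_lattice_instance:
  assumes c: "c1 \<noteq> 0" "c2 \<noteq> 0"
  shows "quadratic_lattice (q_lattice q c1 c2) [:0, p + inverse p:] (smult (\<kappa>\<^sup>2) [:- 4 * c1 * c2, 0, 1:])
    ((p + inverse p) / 2) half_powers_diff half_powers_mean"
proof
  define i where "i = inverse p"
  have pi: "p * i = 1" "i * p = 1" using p_facts(1) by (simp_all add: i_def)
  have k: "\<kappa> = p - i" by (simp add: \<kappa>_def i_def)
  have x: "q_lattice q c1 c2 s = c1 * inverse (Q powr s) + c2 * Q powr s" for s
    by (simp add: q_lattice_def Q_def powr_minus)
  have nz: "Q powr s \<noteq> 0" for s using p_facts(3) by simp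
  show "surj (q_lattice q c1 c2)"
  proof -
    have "\<exists>s. v = q_lattice q c1 c2 s" for v
    proof -
      \<comment> \<open>A solution of \<open>c2 z\<^sup>2 - v z + c1 = 0\<close>; it is nonzero because \<open>c1\<close> is.\<close>
      define r where "r = csqrt (v\<^sup>2 - 4 * c1 * c2)"
      define z where "z = (v + r) / (2 * c2)"
      have r2: "r\<^sup>2 = v\<^sup>2 - 4 * c1 * c2" by (simp add: r_def)
      have "2 * c2 * z - v = r" using c by (simp add: z_def)
      then have "(2 * c2 * z - v)\<^sup>2 = v\<^sup>2 - 4 * c1 * c2" using r2 by simp
      then have "4 * c2 * (c2 * z\<^sup>2 + c1) = 4 * c2 * (v * z)"
        by (simp add: power2_eq_square algebra_simps)
      then have eq: "c2 * z\<^sup>2 + c1 = v * z" using c by simp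
      then have z0: "z \<noteq> 0" using c by auto
      obtain s where s: "Q powr s = z" unfolding Q_def using powr_surj_nonzero[OF q z0] by blast
      have "(c2 * z\<^sup>2 + c1) / z = v" using eq z0 by simp
      then have "v = q_lattice q c1 c2 s"
        unfolding x s using z0 by (simp add: field_simps power2_eq_square)
      then show ?thesis ..
    qed
    then show ?thesis by (simp add: surj_def)
  qed
  fix s
  define z where "z = Q powr s"
  define y where "y = inverse z"
  have zy: "z * y = 1" using nz[of s] by (simp add: z_def y_def)
  have xs: "q_lattice q c1 c2 s = c1 * y + c2 * z" by (simp add: x y_def z_def)
  have xp: "q_lattice q c1 c2 (s + 1/2) = c1 * y * i + c2 * z * p"
    by (simp add: x y_def z_def powr_steps i_def)
  have xm: "q_lattice q c1 c2 (s - 1/2) = c1 * y * p + c2 * z * i"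
    by (simp add: x y_def z_def powr_steps i_def)
  show "q_lattice q c1 c2 (s + 1/2) + q_lattice q c1 c2 (s - 1/2) =
    poly [:0, p + inverse p:] (q_lattice q c1 c2 s)"
    unfolding xs xp xm by (simp flip: i_def add: algebra_simps)
  have "q_lattice q c1 c2 (s + 1/2) - q_lattice q c1 c2 (s - 1/2) = (p - i) * (c2 * z - c1 * y)"
    unfolding xp xm by (simp add: algebra_simps)
  moreover have "(c2 * z - c1 * y)\<^sup>2 = (c1 * y + c2 * z)\<^sup>2 - 4 * c1 * c2 * (z * y)"
    by (simp add: power2_eq_square algebra_simps)
  moreover have pv: "poly (smult v [:- 4 * c1 * c2, 0, 1:]) w = v * (w\<^sup>2 - 4 * c1 * c2)" for v w
    by (simp add: algebra_simps power2_eq_square)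
  ultimately have "(q_lattice q c1 c2 (s + 1/2) - q_lattice q c1 c2 (s - 1/2))\<^sup>2 =
    (p - i)\<^sup>2 * ((c1 * y + c2 * z)\<^sup>2 - 4 * c1 * c2)"
    by (simp only: power_mult_distrib zy mult_1_right)
  then show "(q_lattice q c1 c2 (s + 1/2) - q_lattice q c1 c2 (s - 1/2))\<^sup>2 =
    poly (smult (\<kappa>\<^sup>2) [:- 4 * c1 * c2, 0, 1:]) (q_lattice q c1 c2 s)"
    unfolding xs k pv .
  have a: "((p + i) / 2)\<^sup>2 - 1 = \<kappa>\<^sup>2 / 4"
  proof -
    have "(p + i)\<^sup>2 = (p - i)\<^sup>2 + 4 * (p * i)" by (simp add: power2_eq_square algebra_simps)
    then show ?thesis unfolding pi k by (simp add: power_divide field_simps)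
  qed
  show "coeff (smult (\<kappa>\<^sup>2) [:- 4 * c1 * c2, 0, 1:]) 2 = 4 * (((p + inverse p) / 2)\<^sup>2 - 1)"
    unfolding i_def[symmetric] a by (simp add: numeral_2_eq_2)
  fix n
  \<comment> \<open>The addition theorems for \<open>sinh\<close> and \<open>cosh\<close>, with the denominators of both sequences.\<close>
  have g: "(u * v + \<kappa> * w) / 2 / \<kappa> = u / 2 * (v / \<kappa>) + w / 2"
    "(u * v + \<kappa> * w) / 4 = u / 2 * (v / 2) + \<kappa>\<^sup>2 / 4 * (w / \<kappa>)" for u v w
    using p_facts(5) by (simp_all add: field_simps power2_eq_square)
  have "half_powers_diff (Suc n) = ((p + i) * (p ^ n - i ^ n) + (p - i) * (p ^ n + i ^ n)) / 2 / \<kappa>"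
    unfolding half_powers_diff_def i_def[symmetric]
    by (rule arg_cong[where f = "\<lambda>v. v / \<kappa>"]) (simp add: field_simps)
  also have "\<dots> = (p + i) / 2 * half_powers_diff n + half_powers_mean n"
    unfolding half_powers_diff_def half_powers_mean_def i_def[symmetric] k[symmetric] by (rule g(1))
  finally show "half_powers_diff (Suc n) = (p + inverse p) / 2 * half_powers_diff n + half_powers_mean n"
    by (simp add: i_def)
  have "half_powers_mean (Suc n) = ((p + i) * (p ^ n + i ^ n) + (p - i) * (p ^ n - i ^ n)) / 4"
    unfolding half_powers_mean_def i_def[symmetric] by (simp add: field_simps)
  also have "\<dots> = (p + i) / 2 * half_powers_mean n + \<kappa>\<^sup>2 / 4 * half_powers_diff n"
    unfolding half_powers_diff_def half_powers_mean_def i_def[symmetric] k[symmetric] by (rule g(2))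
  finally show "half_powers_mean (Suc n) = (p + inverse p) / 2 * half_powers_mean n +
    (((p + inverse p) / 2)\<^sup>2 - 1) * half_powers_diff n"
    unfolding i_def[symmetric] a .
qed (use p_facts in \<open>simp_all add: half_powers_diff_def half_powers_mean_def\<close>)

text \<open>Together with \<open>aw_psi_poly\<close> this inverts the linear bijection \<open>(\<phi>, \<psi>) \<mapsto> E\<close> of
  \<open>aw_phi_psi\<close>: the symmetric part of \<open>E z / z\<^sup>2\<close> under \<open>z \<mapsto> 1 / z\<close> comes from \<open>\<phi>\<close>, the antisymmetric
  part from \<open>\<psi>\<close>.\<close>
definition aw_phi_poly :: "complex poly \<Rightarrow> complex poly" where
  "aw_phi_poly E = smult (\<kappa>\<^sup>2 / (4 * p))
     [:coeff E 2 - coeff E 4 - coeff E 0, coeff E 1 + coeff E 3, 2 * (coeff E 4 + coeff E 0):]"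

definition aw_psi_poly :: "complex poly \<Rightarrow> complex poly" where
  "aw_psi_poly E = smult (\<kappa> / (2 * p)) [:coeff E 3 - coeff E 1, 2 * (coeff E 4 - coeff E 0):]"

lemma aw_phi_psi:
  assumes "degree E \<le> 4" "z \<noteq> 0"
  shows "p * z\<^sup>2 * (4 * poly (aw_phi_poly E) ((z + inverse z) / 2) / \<kappa>\<^sup>2 +
    poly (aw_psi_poly E) ((z + inverse z) / 2) * (z - inverse z) / \<kappa>) = poly E z"
proof -
  define y where "y = inverse z"
  have zy: "z * y = 1" using assms by (simp add: y_def)
  obtain e0 e1 e2 e3 e4 where e: "coeff E 0 = e0" "coeff E 1 = e1" "coeff E 2 = e2" "coeff E 3 = e3" "coeff E 4 = e4"
    by auto
  define \<Phi> where "\<Phi> = e2 - e4 - e0 + (e1 + e3) * (z + y) / 2 + (e4 + e0) * (z + y)\<^sup>2 / 2"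
  define \<Psi> where "\<Psi> = e3 - e1 + (e4 - e0) * (z + y)"
  have "4 * poly (aw_phi_poly E) ((z + y) / 2) / \<kappa>\<^sup>2 = \<Phi> / p"
    using p_facts(1,5) by (simp add: aw_phi_poly_def e e[unfolded One_nat_def] \<Phi>_def power2_eq_square field_simps)
  moreover have "poly (aw_psi_poly E) ((z + y) / 2) / \<kappa> = \<Psi> / (2 * p)"
    using p_facts(1,5) by (simp add: aw_psi_poly_def e e[unfolded One_nat_def] \<Psi>_def field_simps)
  moreover have "poly (aw_psi_poly E) ((z + y) / 2) * (z - y) / \<kappa> = poly (aw_psi_poly E) ((z + y) / 2) / \<kappa> * (z - y)"
    by simp
  ultimately have "p * z\<^sup>2 * (4 * poly (aw_phi_poly E) ((z + y) / 2) / \<kappa>\<^sup>2 +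
    poly (aw_psi_poly E) ((z + y) / 2) * (z - y) / \<kappa>) = p * z\<^sup>2 * (\<Phi> / p + \<Psi> / (2 * p) * (z - y))"
    by simp
  also have "\<dots> = z\<^sup>2 * (\<Phi> + \<Psi> * (z - y) / 2)" using p_facts(1) by (simp add: field_simps)
  also have "\<dots> = e4 * z ^ 4 + e3 * z ^ 3 + (e2 - e4 - e0 + (e4 + e0) * (z * y)) * z ^ 2 + e1 * z * (z * y) + e0 * (z * y) ^ 2"
    unfolding \<Phi>_def \<Psi>_def by (simp add: field_simps eval_nat_numeral)
  also have "\<dots> = poly E z" unfolding zy poly_degree4[OF assms(1)] e by simp
  finally show ?thesis by (simp add: y_def)
qed

lemma degree_aw_phi_psi: "degree (aw_phi_poly E) \<le> 2" "degree (aw_psi_poly E) \<le> 1"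
  by (simp_all add: aw_phi_poly_def aw_psi_poly_def)

lemma aw_phi_linear: "linear_poly_operator aw_phi_poly"
  and aw_psi_linear: "linear_poly_operator aw_psi_poly"
  by (unfold_locales; simp add: aw_phi_poly_def aw_psi_poly_def add_divide_distrib diff_divide_distrib algebra_simps)+

definition aw_ev :: "complex poly \<Rightarrow> nat \<Rightarrow> complex" where
  "aw_ev E n = (1 / Q ^ n - 1) * (coeff E 0 - coeff E 4 * Q ^ n / Q)"

lemma aw_ev_gap: "aw_ev E n - aw_ev E j = (1 / Q ^ n - 1 / Q ^ j) * (coeff E 0 - coeff E 4 * Q ^ (n + j) / Q)"
  using p_facts(3) unfolding aw_ev_def by (simp add: field_simps power_add)

text \<open>The polynomial in \<open>(z + 1 / z) / 2\<close> with value \<open>(a z; q)\<^sub>k (a / z; q)\<^sub>k\<close>. For \<open>a = 0\<close> its degree drops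
  to \<open>0\<close>; the identities below remain true, and no case distinction is needed.\<close>
definition aw_basis :: "complex \<Rightarrow> nat \<Rightarrow> complex poly" where
  "aw_basis a k = (\<Prod>j<k. [:1 + (a * Q ^ j)\<^sup>2, - 2 * a * Q ^ j:])"

lemma qpoch_Suc: "qpoch a Q (Suc k) = qpoch a Q k * (1 - a * Q ^ k)"
  by (simp add: qpoch_def)

lemma qpoch_rec: "qpoch a Q (Suc k) = (1 - a) * qpoch (a * Q) Q k"
  unfolding qpoch_def by (simp only: prod.lessThan_Suc_shift) (simp add: mult.assoc)

lemma poly_aw_basis:
  assumes "z \<noteq> 0"
  shows "poly (aw_basis a k) ((z + inverse z) / 2) = qpoch (a * z) Q k * qpoch (a / z) Q k"
proof (induction k)
  case (Suc k)
  have "(1 - a * z * Q ^ k) * (1 - a / z * Q ^ k) = 1 + (a * Q ^ k)\<^sup>2 - a * Q ^ k * (z + inverse z)"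
    using assms by (simp add: field_simps power2_eq_square)
  then show ?case using Suc by (simp add: aw_basis_def qpoch_Suc mult_ac) (simp add: algebra_simps)
qed (simp add: aw_basis_def qpoch_def)

lemma aw_basis_top: "degree (aw_basis a k) \<le> k \<and> coeff (aw_basis a k) k = a ^ k * ((- 2) ^ k * (\<Prod>j<k. Q ^ j))"
proof (induction k)
  case (Suc k)
  let ?l = "[:1 + (a * Q ^ k)\<^sup>2, - 2 * a * Q ^ k:]"
  have e: "aw_basis a (Suc k) = aw_basis a k * ?l" by (simp add: aw_basis_def)
  have l: "degree ?l \<le> 1" by simp
  have "coeff (aw_basis a (Suc k)) (k + 1) = coeff (aw_basis a k) k * coeff ?l 1"
    unfolding e using Suc l by (intro coeff_mult_top) auto
  moreover have "degree (aw_basis a (Suc k)) \<le> k + 1"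
    unfolding e using Suc l degree_mult_le[of "aw_basis a k" ?l] by linarith
  ultimately show ?case using Suc by (simp add: algebra_simps)
qed (simp add: aw_basis_def)

text \<open>Multiplying \<open>z\<close> by \<open>q\<close> moves one factor in each of the two products; \<open>M\<close> is what they have in
  common.\<close>
lemma aw_basis_shift_times:
  assumes z: "z \<noteq> 0"
  shows "(1 - a * z) * (poly (aw_basis a (Suc k)) ((Q * z + inverse (Q * z)) / 2) -
      poly (aw_basis a (Suc k)) ((z + inverse z) / 2)) =
    a * (1 - Q ^ Suc k) * (Q * z\<^sup>2 - 1) / (Q * z) * (1 - a * Q ^ k * z) * poly (aw_basis a k) ((z + inverse z) / 2)"
proof -
  have Qz: "Q * z \<noteq> 0" using z p_facts(3) by simp
  define M where "M = qpoch (a * z * Q) Q k * qpoch (a / z) Q k"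
  have 1: "poly (aw_basis a (Suc k)) ((z + inverse z) / 2) = M * ((1 - a * z) * (1 - a / z * Q ^ k))"
    unfolding poly_aw_basis[OF z] qpoch_rec[of "a * z"] qpoch_Suc[of "a / z"] M_def by simp
  have e: "a / (Q * z) * Q = a / z" "a * (Q * z) = a * z * Q" using p_facts(3) by simp_all
  have 2: "poly (aw_basis a (Suc k)) ((Q * z + inverse (Q * z)) / 2) =
      M * ((1 - a * z * Q * Q ^ k) * (1 - a / (Q * z)))"
    unfolding poly_aw_basis[OF Qz] qpoch_rec[of "a / (Q * z)"] e qpoch_Suc[of "a * z * Q"] M_def
    by (simp only: mult_ac)
  have "(1 - a * z * Q * Q ^ k) * (1 - a / (Q * z)) - (1 - a * z) * (1 - a / z * Q ^ k) =
    a * (1 - Q ^ Suc k) * (Q * z\<^sup>2 - 1) / (Q * z)"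
    using z p_facts(3) by (simp add: field_simps power2_eq_square)
  then have "poly (aw_basis a (Suc k)) ((Q * z + inverse (Q * z)) / 2) - poly (aw_basis a (Suc k)) ((z + inverse z) / 2) =
    M * (a * (1 - Q ^ Suc k) * (Q * z\<^sup>2 - 1) / (Q * z))"
    unfolding 1 2 by (simp only: right_diff_distrib[symmetric])
  moreover have "(1 - a * z) * M = (1 - a * Q ^ k * z) * poly (aw_basis a k) ((z + inverse z) / 2)"
  proof -
    have "(1 - a * z) * qpoch (a * z * Q) Q k = qpoch (a * z) Q k * (1 - a * Q ^ k * z)"
      by (simp flip: qpoch_rec) (simp add: qpoch_Suc mult_ac)
    then show ?thesis unfolding M_def poly_aw_basis[OF z] by (simp only: mult_ac) (simp flip: mult.assoc)
  qed
  moreover have "y * d = v * w * t" if "d = m * v" "y * m = w * t" for y d v w t m :: complex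
  proof -
    have "y * d = v * (y * m)" using that(1) by simp
    then show ?thesis using that(2) by simp
  qed
  ultimately show ?thesis by blast
qed

context
  fixes r :: complex
  assumes r: "r \<noteq> 0"
begin

definition aw_lattice :: "complex \<Rightarrow> complex" where
  "aw_lattice s = (r * Q powr s + inverse (r * Q powr s)) / 2"

lemma aw_lattice_alt: "aw_lattice = q_lattice q (inverse r / 2) (r / 2)"
  by (auto simp: fun_eq_iff aw_lattice_def q_lattice_def powr_minus add_divide_distrib simp flip: Q_def)

interpretation X: quadratic_lattice aw_lattice "[:0, p + inverse p:]"
  "smult (\<kappa>\<^sup>2) [:- 4 * (inverse r / 2) * (r / 2), 0, 1:]" "(p + inverse p) / 2"
  half_powers_diff half_powers_mean
  unfolding aw_lattice_alt by (rule q_lattice_instance) (use r in auto)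

abbreviation (input) Aop where "Aop E \<equiv> sl_op aw_lattice (aw_phi_poly E) (aw_psi_poly E)"

lemma sl_ev_aw: "X.sl_ev (aw_phi_poly E) (aw_psi_poly E) = aw_ev E"
proof
  fix n
  show "X.sl_ev (aw_phi_poly E) (aw_psi_poly E) n = aw_ev E n"
  proof (cases n)
    case 0
    then show ?thesis by (simp add: X.sl_ev_def aw_ev_def half_powers_diff_def)
  next
    case (Suc m)
    define P where "P = p ^ m"
    have P: "P \<noteq> 0" using p_facts(1) by (simp add: P_def)
    obtain e0 e4 where e: "coeff E 0 = e0" "coeff E 4 = e4" by auto
    have d: "half_powers_diff n = (p * P - inverse (p * P)) / \<kappa>"
      "half_powers_diff m = (P - inverse P) / \<kappa>" "half_powers_mean m = (P + inverse P) / 2"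
      by (simp_all add: half_powers_diff_def half_powers_mean_def Suc P_def power_inverse)
    have c: "coeff (aw_phi_poly E) 2 = \<kappa>\<^sup>2 / (2 * p) * (e4 + e0)" "coeff (aw_psi_poly E) 1 = \<kappa> / p * (e4 - e0)"
      using p_facts(1) by (simp_all add: aw_phi_poly_def aw_psi_poly_def e numeral_2_eq_2 field_simps)
    have Qn: "Q ^ n = p\<^sup>2 * P\<^sup>2" "Q = p\<^sup>2"
      unfolding p_facts(2)[symmetric] Suc P_def by (simp_all add: power_mult_distrib flip: power_mult) (simp add: mult.commute power_add power2_eq_square)
    have "X.sl_ev (aw_phi_poly E) (aw_psi_poly E) n =
      (p * P - inverse (p * P)) / \<kappa> * ((P - inverse P) / \<kappa> * (\<kappa>\<^sup>2 / (2 * p) * (e4 + e0)) + (P + inverse P) / 2 * (\<kappa> / p * (e4 - e0)))"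
      unfolding X.sl_ev_def c d(1) by (simp add: Suc d)
    also have "\<dots> = (p * P - inverse (p * P)) / p * (P * e4 - inverse P * e0)"
      using p_facts(1,5) by (simp add: field_simps power2_eq_square)
    also have "\<dots> = (1 / (p\<^sup>2 * P\<^sup>2) - 1) * (e0 - e4 * P\<^sup>2)"
      using p_facts(1) P by (simp add: field_simps power2_eq_square)
    also have "\<dots> = aw_ev E n"
      unfolding aw_ev_def Qn(1) unfolding Qn(2) e using p_facts(1) by simp
    finally show ?thesis .
  qed
qed

lemma Aop_difference:
  assumes E: "degree E \<le> 4" and z: "z = r * Q powr s" and nd: "z\<^sup>2 \<noteq> 1" "Q * z\<^sup>2 \<noteq> 1" "z\<^sup>2 \<noteq> Q"
  shows "poly (Aop E f) ((z + inverse z) / 2) =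
    poly E z * (poly f ((Q * z + inverse (Q * z)) / 2) - poly f ((z + inverse z) / 2)) / ((z\<^sup>2 - 1) * (Q * z\<^sup>2 - 1)) +
    poly E (inverse z) * z ^ 4 * (poly f ((z / Q + inverse (z / Q)) / 2) - poly f ((z + inverse z) / 2)) / ((z\<^sup>2 - 1) * (z\<^sup>2 - Q))"
proof -
  have z0: "z \<noteq> 0" using z r p_facts(3) by simp
  have x: "aw_lattice s = (z + inverse z) / 2" "aw_lattice (s + 1) = (Q * z + inverse (Q * z)) / 2"
    "aw_lattice (s - 1) = (z / Q + inverse (z / Q)) / 2"
    unfolding aw_lattice_def powr_steps z by (simp_all only: divide_inverse mult_ac)
  have D0: "aw_lattice (s + 1/2) - aw_lattice (s - 1/2) = \<kappa> * (z\<^sup>2 - 1) / (2 * z)"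
    unfolding aw_lattice_def powr_steps mult.assoc[symmetric] z[symmetric] \<kappa>_def
    using z0 p_facts(1) by (simp add: field_simps power2_eq_square)
  have Q2: "Q = p * p" using p_facts(2) by (simp add: power2_eq_square)
  have Dp: "aw_lattice (s + 1) - aw_lattice s = \<kappa> * (Q * z\<^sup>2 - 1) / (2 * p * z)"
    unfolding x \<kappa>_def unfolding Q2 using z0 p_facts(1) by (simp add: field_simps power2_eq_square)
  have Dm: "aw_lattice s - aw_lattice (s - 1) = \<kappa> * (z\<^sup>2 - Q) / (2 * p * z)"
    unfolding x \<kappa>_def unfolding Q2 using z0 p_facts(1) by (simp add: field_simps power2_eq_square)
  have ne: "aw_lattice (s + 1/2) \<noteq> aw_lattice (s - 1/2)" "aw_lattice (s + 1) \<noteq> aw_lattice s"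
    "aw_lattice (s - 1) \<noteq> aw_lattice s"
  proof -
    have "aw_lattice (s + 1/2) - aw_lattice (s - 1/2) \<noteq> 0" "aw_lattice (s + 1) - aw_lattice s \<noteq> 0"
      "aw_lattice s - aw_lattice (s - 1) \<noteq> 0"
      unfolding D0 Dp Dm using nd z0 p_facts(1,5) by simp_all
    then show "aw_lattice (s + 1/2) \<noteq> aw_lattice (s - 1/2)" "aw_lattice (s + 1) \<noteq> aw_lattice s"
    "aw_lattice (s - 1) \<noteq> aw_lattice s" by auto
  qed
  define \<Phi> where "\<Phi> = poly (aw_phi_poly E) ((z + inverse z) / 2)"
  define \<Psi> where "\<Psi> = poly (aw_psi_poly E) ((z + inverse z) / 2)"
  have Ep: "poly E z = p * z\<^sup>2 * (4 * \<Phi> / \<kappa>\<^sup>2 + \<Psi> * (z - inverse z) / \<kappa>)"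
    using aw_phi_psi[OF E z0] by (simp add: \<Phi>_def \<Psi>_def)
  have "inverse z + inverse (inverse z) = z + inverse z" by simp
  then have Em: "poly E (inverse z) = p * (inverse z)\<^sup>2 * (4 * \<Phi> / \<kappa>\<^sup>2 + \<Psi> * (inverse z - z) / \<kappa>)"
    using aw_phi_psi[OF E, of "inverse z"] z0 unfolding \<Phi>_def \<Psi>_def by (simp add: add.commute)
  define w where "w = z\<^sup>2 - 1"
  define wp where "wp = Q * z\<^sup>2 - 1"
  define wm where "wm = z\<^sup>2 - Q"
  have w: "w \<noteq> 0" "wp \<noteq> 0" "wm \<noteq> 0" using nd by (simp_all add: w_def wp_def wm_def)
  have zw: "z - inverse z = w / z" "inverse z - z = - (w / z)"
    using z0 by (simp_all add: w_def field_simps power2_eq_square)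
  have Vp: "(\<Phi> / (\<kappa> * w / (2 * z)) + \<Psi> / 2) / (\<kappa> * wp / (2 * p * z)) = poly E z / (w * wp)"
    unfolding Ep zw using z0 p_facts(1,5) w by (simp add: field_simps power2_eq_square)
  have Vm: "(\<Phi> / (\<kappa> * w / (2 * z)) - \<Psi> / 2) / (\<kappa> * wm / (2 * p * z)) = poly E (inverse z) * z ^ 4 / (w * wm)"
    unfolding Em zw using z0 p_facts(1,5) w by (simp add: field_simps eval_nat_numeral)
  have m: "t * (g / v) - u * (h / y) = t / v * g - u / y * h" for t u v y g h :: complex by simp
  have "poly (Aop E f) (aw_lattice s) =
    (\<Phi> / (\<kappa> * w / (2 * z)) + \<Psi> / 2) / (\<kappa> * wp / (2 * p * z)) * (poly f (aw_lattice (s + 1)) - poly f (aw_lattice s)) -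
    (\<Phi> / (\<kappa> * w / (2 * z)) - \<Psi> / 2) / (\<kappa> * wm / (2 * p * z)) * (poly f (aw_lattice s) - poly f (aw_lattice (s - 1)))"
    unfolding X.sl_op_difference[OF ne]
    unfolding D0 Dp Dm w_def wp_def wm_def \<Phi>_def \<Psi>_def unfolding x(1) by (rule m)
  also have "\<dots> = poly E z * (poly f (aw_lattice (s + 1)) - poly f (aw_lattice s)) / (w * wp) +
     poly E (inverse z) * z ^ 4 * (poly f (aw_lattice (s - 1)) - poly f (aw_lattice s)) / (w * wm)"
  proof -
    have "a / b * g - c / d * (h - k) = a * g / b + c * (k - h) / d" for a b g c d h k :: complex
    proof -
      have "c * (k - h) = - (c * (h - k))" by (simp add: algebra_simps)
      then show ?thesis by simp
    qed
    then show ?thesis unfolding Vp Vm .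
  qed
  finally show ?thesis unfolding x w_def wp_def wm_def .
qed

text \<open>Put \<open>h z = (1 - a q\<^sup>k z) G z\<close>. The forward difference contributes \<open>h z\<close>, the
  backward difference \<open>- z\<^sup>4 h (1 / z)\<close> with the same factor, whose denominator \<open>z (z\<^sup>2 - 1)\<close>
  divides their sum. The quotient is an affine function of \<open>z + 1 / z\<close>, so that the
  lower basis element times this function is a combination of two consecutive basis elements.\<close>
lemma Aop_basis:
  assumes E: "E = [:1, - a:] * G" and G: "degree G \<le> 3"
  shows "Aop E (aw_basis a (Suc k)) = smult (aw_ev E (Suc k)) (aw_basis a (Suc k)) +
    smult ((1 - 1 / Q ^ Suc k) * poly G (a * Q ^ k)) (aw_basis a k)"
proof (rule X.poly_eqI_nondegenerate)
  fix s
  assume nd: "aw_lattice (s + 1/2) \<noteq> aw_lattice (s - 1/2)" "aw_lattice (s + 1) \<noteq> aw_lattice s"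
    "aw_lattice (s - 1) \<noteq> aw_lattice s"
  define z where "z = r * Q powr s"
  let ?y = "(z + inverse z) / 2" and ?u = "(Q * z + inverse (Q * z)) / 2" and ?d = "(z / Q + inverse (z / Q)) / 2"
  have z0: "z \<noteq> 0" using z_def r p_facts(3) by simp
  have zn: "z\<^sup>2 \<noteq> 1" "Q * z\<^sup>2 \<noteq> 1" "z\<^sup>2 \<noteq> Q"
  proof -
    have "z\<^sup>2 = 1 \<Longrightarrow> inverse z = z" using z0 by (simp add: field_simps power2_eq_square)
    then show "z\<^sup>2 \<noteq> 1" using nd(1) 
      unfolding aw_lattice_def powr_steps mult.assoc[symmetric] z_def[symmetric] inverse_mult_distrib inverse_inverse_eq
      by (auto simp: mult.commute add.commute)
    have "Q * z\<^sup>2 = 1 \<Longrightarrow> inverse z = z * Q" using z0 by (simp add: field_simps power2_eq_square)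
    moreover have "Q * z\<^sup>2 = 1 \<Longrightarrow> inverse (z * Q) = z" using z0 p_facts(3) by (simp add: field_simps power2_eq_square)
    ultimately show "Q * z\<^sup>2 \<noteq> 1" using nd(2)
      unfolding aw_lattice_def powr_steps mult.assoc[symmetric] z_def[symmetric]
      by (auto simp: add.commute)
    have "z\<^sup>2 = Q \<Longrightarrow> inverse z = z * inverse Q" using z0 p_facts(3) by (simp add: field_simps power2_eq_square)
    moreover have "z\<^sup>2 = Q \<Longrightarrow> inverse (z * inverse Q) = z" using z0 p_facts(3) by (simp add: field_simps power2_eq_square)
    ultimately show "z\<^sup>2 \<noteq> Q" using nd(3)
      unfolding aw_lattice_def powr_steps mult.assoc[symmetric] z_def[symmetric]
      by (metis add.commute)
  qed
  have x: "aw_lattice s = (z + inverse z) / 2" unfolding aw_lattice_def z_def ..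
  have dE: "degree E \<le> 4"
    using G degree_mult_le[of "[:1, - a:]" G] by (simp add: E split: if_splits)
  obtain g0 g1 g2 g3 where Gc: "coeff G 0 = g0" "coeff G 1 = g1" "coeff G 2 = g2" "coeff G 3 = g3" by auto
  have "coeff G 4 = 0" using G by (simp add: coeff_eq_0)
  then have Gp: "poly G v = g0 + g1 * v + g2 * v ^ 2 + g3 * v ^ 3" for v
    using poly_degree4[of G v] G Gc by simp
  have Ec: "coeff E 4 = - a * g3" "coeff E 0 = g0"
    using Gc \<open>coeff G 4 = 0\<close> by (simp_all add: E eval_nat_numeral)
  define A where "A = a * Q ^ k"
  define b where "b = poly (aw_basis a k) ?y"
  define f where "f = aw_basis a (Suc k)"
  define T where "T = a * (1 - Q ^ Suc k) / Q"
  have y0: "inverse z \<noteq> 0" using z0 by simp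
  have inv: "inverse z + inverse (inverse z) = z + inverse z" by simp
  have invQ: "Q * inverse z + inverse (Q * inverse z) = z / Q + inverse (z / Q)"
    using z0 p_facts(3) by (simp add: divide_inverse add.commute)
  have sp: "(1 - a * z) * (poly f ?u - poly f ?y) =
      T * (Q * z\<^sup>2 - 1) / z * (1 - A * z) * b"
    using aw_basis_shift_times[OF z0, of a k] by (simp add: f_def b_def A_def T_def mult_ac)
  have "(1 - a * inverse z) * (poly f ?d - poly f ?y) =
      T * (Q * (inverse z)\<^sup>2 - 1) / inverse z * (1 - A * inverse z) * b"
    using aw_basis_shift_times[OF y0, of a k] unfolding inv invQ by (simp add: f_def b_def A_def T_def mult_ac)
  also have "T * (Q * (inverse z)\<^sup>2 - 1) / inverse z = - T * (z\<^sup>2 - Q) / z"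
    using z0 by (simp add: field_simps power2_eq_square)
  finally have sm: "(1 - a * inverse z) * (poly f ?d - poly f ?y) =
     - T * (z\<^sup>2 - Q) / z * (1 - A * inverse z) * b" .
  have fb: "poly f ?y = b * (1 + A\<^sup>2 - A * (z + inverse z))"
    by (simp add: f_def b_def A_def aw_basis_def algebra_simps)
  have "poly (Aop E f) ?y =
    poly E z * (poly f ?u - poly f ?y) / ((z\<^sup>2 - 1) * (Q * z\<^sup>2 - 1)) +
    poly E (inverse z) * z ^ 4 * (poly f ?d - poly f ?y) / ((z\<^sup>2 - 1) * (z\<^sup>2 - Q))"
    by (rule Aop_difference[OF dE z_def zn])
  also have "poly E z * (poly f ?u - poly f ?y) =
    poly G z * ((1 - a * z) * (poly f ?u - poly f ?y))"
    by (simp add: E algebra_simps)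
  also have "poly E (inverse z) * z ^ 4 * (poly f ?d - poly f ?y) =
    poly G (inverse z) * z ^ 4 * ((1 - a * inverse z) * (poly f ?d - poly f ?y))"
    by (simp add: E algebra_simps)
  also have "poly G z * ((1 - a * z) * (poly f ?u - poly f ?y)) / ((z\<^sup>2 - 1) * (Q * z\<^sup>2 - 1)) =
    T * b * (poly G z * (1 - A * z)) / (z * (z\<^sup>2 - 1))"
    unfolding sp using zn z0 by (simp add: divide_simps)
  also have "poly G (inverse z) * z ^ 4 * ((1 - a * inverse z) * (poly f ?d - poly f ?y)) / ((z\<^sup>2 - 1) * (z\<^sup>2 - Q)) =
    - (T * b * (poly G (inverse z) * z ^ 4 * (1 - A * inverse z)) / (z * (z\<^sup>2 - 1)))"
    unfolding sm using zn z0 by (simp add: divide_simps)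
  also have "T * b * (poly G z * (1 - A * z)) / (z * (z\<^sup>2 - 1)) + - (T * b * (poly G (inverse z) * z ^ 4 * (1 - A * inverse z)) / (z * (z\<^sup>2 - 1))) =
    T * b * (poly G z * (1 - A * z) - poly G (inverse z) * z ^ 4 * (1 - A * inverse z)) / (z * (z\<^sup>2 - 1))"
    by (simp add: diff_divide_distrib right_diff_distrib)
  also have "poly G z * (1 - A * z) - poly G (inverse z) * z ^ 4 * (1 - A * inverse z) =
    - ((z * (z\<^sup>2 - 1)) * ((g0 + A * g3) * (z + inverse z) + (g1 - A * g0 - g3 + A * g2)))"
    unfolding Gp using z0 by (simp add: field_simps eval_nat_numeral)
  also have "T * b * - ((z * (z\<^sup>2 - 1)) * ((g0 + A * g3) * (z + inverse z) + (g1 - A * g0 - g3 + A * g2))) / (z * (z\<^sup>2 - 1)) =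
    - (T * b * ((g0 + A * g3) * (z + inverse z) + (g1 - A * g0 - g3 + A * g2)))"
    using z0 zn(1) by simp
  also have "\<dots> = aw_ev E (Suc k) * poly f ?y + (1 - 1 / Q ^ Suc k) * poly G A * b"
  proof -
    define t where "t = 1 / Q ^ Suc k - 1"
    have T: "T = A * t" using p_facts(3) by (simp add: T_def A_def t_def field_simps)
    have ev: "aw_ev E (Suc k) = t * (g0 + A * g3)"
      using p_facts(3) by (simp add: aw_ev_def Ec t_def A_def)
    have "1 - 1 / Q ^ Suc k = - t" by (simp add: t_def)
    then show ?thesis
      unfolding T ev fb Gp by (simp only:) (simp add: algebra_simps eval_nat_numeral)
  qed
  finally show "poly (Aop E (aw_basis a (Suc k))) (aw_lattice s) =
    poly (smult (aw_ev E (Suc k)) (aw_basis a (Suc k)) +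
      smult ((1 - 1 / Q ^ Suc k) * poly G (a * Q ^ k)) (aw_basis a k)) (aw_lattice s)"
    unfolding x unfolding f_def b_def A_def by simp
qed

lemma Aop_triangular: "triangular_operator (Aop E) (aw_ev E)"
  using X.sl_op_triangular[OF degree_aw_phi_psi(1)[of E] degree_aw_phi_psi(2)[of E]] unfolding sl_ev_aw .

definition aw_norm :: "nat \<Rightarrow> complex" where
  "aw_norm n = (\<Prod>i\<in>{0<..n}. 1 - 1 / Q ^ i)"

text \<open>Besides the normalization \<open>aw_norm n\<close> of the hypergeometric series, the constant contains the
  leading coefficient of \<open>aw_basis a n\<close> without its factor \<open>a\<^sup>n\<close>, in accordance with the factor
  \<open>1 / a\<^sup>n\<close> in the definition of the Askey--Wilson polynomials.\<close>
definition aw_like :: "complex poly \<Rightarrow> nat \<Rightarrow> complex poly" where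
  "aw_like E n = smult ((- 2) ^ n * (\<Prod>j<n. Q ^ j) / aw_norm n) (eigenpoly (Aop E) (aw_ev E) n)"

lemma aw_norm_nonzero: "aw_norm n \<noteq> 0"
  unfolding aw_norm_def using Q_power_neq_1 p_facts(3) by (auto simp: field_simps)

lemma aw_const_nonzero: "(- 2) ^ n * (\<Prod>j<n. Q ^ j) / aw_norm n \<noteq> 0"
  using aw_norm_nonzero p_facts(3) by simp

lemma qpoch_Q_nonzero: "qpoch Q Q k \<noteq> 0"
  unfolding qpoch_def using Q_power_neq_1[of "Suc _"] by (auto simp flip: power_Suc)

text \<open>Up to signs and powers of \<open>q\<close>, the first product is \<open>(1 / q\<^sup>n; q)\<^sub>k\<close> and the second is the quotient
  of \<open>aw_norm n\<close> by \<open>(q; q)\<^sub>k\<close>; the signs cancel and the powers combine to \<open>q\<^sup>k\<close>, the power of the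
  argument of the series.\<close>
lemma aw_weights:
  assumes "k \<le> n"
  shows "(\<Prod>j<k. 1 / Q ^ n - 1 / Q ^ j) * (\<Prod>i\<in>{k<..n}. 1 - 1 / Q ^ i) =
    aw_norm n * (qpoch (1 / Q ^ n) Q k * Q ^ k / qpoch Q Q k)"
  using assms
proof (induction k)
  case 0
  then show ?case by (simp add: aw_norm_def qpoch_def)
next
  case (Suc k)
  define V where "V = (\<Prod>i\<in>{Suc k<..n}. 1 - 1 / Q ^ i)"
  define U where "U = (\<Prod>j<k. 1 / Q ^ n - 1 / Q ^ j)"
  have "{k<..n} = insert (Suc k) {Suc k<..n}" using Suc.prems by auto
  then have IH: "U * ((1 - 1 / Q ^ Suc k) * V) = aw_norm n * (qpoch (1 / Q ^ n) Q k * Q ^ k / qpoch Q Q k)"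
    using Suc by (simp add: U_def V_def)
  have Q1: "1 - Q ^ Suc k \<noteq> 0" using Q_power_neq_1[of "Suc k"] by simp
  have v: "V * U = aw_norm n * (qpoch (1 / Q ^ n) Q k * Q ^ k / qpoch Q Q k) * (- (Q ^ Suc k / (1 - Q ^ Suc k)))"
  proof -
    have "(1 - 1 / Q ^ Suc k) * (- (Q ^ Suc k / (1 - Q ^ Suc k))) = 1"
      using p_facts(3) Q1 by (simp add: field_simps)
    then have "V * U = U * ((1 - 1 / Q ^ Suc k) * V) * (- (Q ^ Suc k / (1 - Q ^ Suc k)))"
      by (metis (no_types, lifting) mult.assoc mult.commute mult_1_right)
    then show ?thesis unfolding IH .
  qed
  have "U * (1 / Q ^ n - 1 / Q ^ k) * V = V * U * (- ((1 - 1 / Q ^ n * Q ^ k) / Q ^ k))"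
    using p_facts(3) by (simp add: field_simps)
  also have "\<dots> = aw_norm n * (qpoch (1 / Q ^ n) Q k * (1 - 1 / Q ^ n * Q ^ k) * Q ^ Suc k / (qpoch Q Q k * (1 - Q * Q ^ k)))"
    unfolding v using p_facts(3) qpoch_Q_nonzero[of k] Q1 by (simp add: divide_simps)
  finally show ?case by (simp add: U_def V_def qpoch_Suc)
qed

lemma aw_like_expansion:
  assumes E: "E = [:1, - a:] * G" and G: "degree G \<le> 3"
  shows "smult (a ^ n) (aw_like E n) = (\<Sum>k\<le>n. smult (qpoch (1 / Q ^ n) Q k *
      (\<Prod>j<k. coeff E 0 - coeff E 4 * Q ^ (n + j) / Q) *
      (\<Prod>i\<in>{k..<n}. poly G (a * Q ^ i)) * (Q ^ k / qpoch Q Q k)) (aw_basis a k))"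
proof -
  interpret T: triangular_operator "Aop E" "aw_ev E" by (rule Aop_triangular)
  define \<mu> where "\<mu> i = (1 - 1 / Q ^ i) * poly G (a * Q ^ (i - 1))" for i
  have "Aop E (aw_basis a 0) = smult (aw_ev E 0) (aw_basis a 0)"
  proof -
    have "Dx aw_lattice 1 = 0" by (rule X.Dx_unique) simp
    then show ?thesis by (simp add: aw_basis_def sl_op_def aw_ev_def X.D.zero X.S.zero)
  qed
  moreover have "Aop E (aw_basis a (Suc k)) = smult (aw_ev E (Suc k)) (aw_basis a (Suc k)) +
      smult (\<mu> (Suc k)) (aw_basis a k)" for k
    using Aop_basis[OF assms, of k] by (simp add: \<mu>_def)
  ultimately have ann: "annihilator (Aop E) (aw_ev E) n (aw_basis a n) =
    (\<Sum>k\<le>n. smult ((\<Prod>j<k. aw_ev E n - aw_ev E j) * (\<Prod>i\<in>{k<..n}. \<mu> i)) (aw_basis a k))"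
    by (rule T.annihilator_bidiagonal)
  have "smult (a ^ n) (aw_like E n) = smult (1 / aw_norm n) (annihilator (Aop E) (aw_ev E) n (aw_basis a n))"
    using T.annihilator_eq_eigenpoly[of "aw_basis a n" n] aw_basis_top[of a n]
    by (simp add: aw_like_def mult_ac)
  then show ?thesis unfolding ann smult_sum_right smult_smult
  proof (simp only:, intro sum.cong[OF refl] arg_cong2[where f = smult] refl)
    fix k assume "k \<in> {..n}"
    then have k: "k \<le> n" by simp
    have 1: "(\<Prod>j<k. aw_ev E n - aw_ev E j) =
      (\<Prod>j<k. 1 / Q ^ n - 1 / Q ^ j) * (\<Prod>j<k. coeff E 0 - coeff E 4 * Q ^ (n + j) / Q)"
      unfolding aw_ev_gap by (rule prod.distrib)
    have "{k<..n} = Suc ` {k..<n}" by (simp add: image_Suc_atLeastLessThan atLeastSucAtMost_greaterThanAtMost atLeastLessThanSuc_atLeastAtMost)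
    then have "(\<Prod>i\<in>{k<..n}. poly G (a * Q ^ (i - 1))) = prod (\<lambda>i. poly G (a * Q ^ (i - 1))) (Suc ` {k..<n})"
      by (rule arg_cong)
    also have "\<dots> = (\<Prod>i\<in>{k..<n}. ((\<lambda>i. poly G (a * Q ^ (i - 1))) \<circ> Suc) i)" by (rule prod.reindex) simp
    finally have 2: "(\<Prod>i\<in>{k<..n}. \<mu> i) = (\<Prod>i\<in>{k<..n}. 1 - 1 / Q ^ i) * (\<Prod>i\<in>{k..<n}. poly G (a * Q ^ i))"
      by (simp add: \<mu>_def prod.distrib)
    have r: "1 / aw_norm n * ((g * h) * (v * w)) = x * h * w * y"
      if "g * v = aw_norm n * (x * Q ^ k / qpoch Q Q k)" "y = Q ^ k / qpoch Q Q k" for g h v w x y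
    proof -
      have "1 / aw_norm n * ((g * h) * (v * w)) = 1 / aw_norm n * (g * v) * (h * w)" by simp
      then show ?thesis unfolding that using aw_norm_nonzero[of n] by simp
    qed
    show "1 / aw_norm n * ((\<Prod>j<k. aw_ev E n - aw_ev E j) * (\<Prod>i\<in>{k<..n}. \<mu> i)) =
      qpoch (1 / Q ^ n) Q k * (\<Prod>j<k. coeff E 0 - coeff E 4 * Q ^ (n + j) / Q) *
      (\<Prod>i\<in>{k..<n}. poly G (a * Q ^ i)) * (Q ^ k / qpoch Q Q k)"
      unfolding 1 2 by (rule r[OF aw_weights[OF k] refl])
  qed
qed

lemma qpoch_split: "k \<le> n \<Longrightarrow> qpoch v Q n = qpoch v Q k * (\<Prod>i\<in>{k..<n}. 1 - v * Q ^ i)"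
  unfolding qpoch_def lessThan_atLeast0 by (simp add: prod.atLeastLessThan_concat)

lemma qpoch_neg_vanishes: "n < k \<Longrightarrow> qpoch (1 / Q ^ n) Q k = 0"
  unfolding qpoch_def using p_facts(3) by (intro prod_zero) auto

definition aw_quartic :: "complex \<Rightarrow> complex \<Rightarrow> complex \<Rightarrow> complex \<Rightarrow> complex poly" where
  "aw_quartic a b c d = [:1, - a:] * ([:1, - b:] * [:1, - c:] * [:1, - d:])"

text \<open>For \<open>E = (1 - a z) G z\<close> with \<open>G z = (1 - b z) (1 - c z) (1 - d z)\<close> the values \<open>G (a q\<^sup>i)\<close> in the
  expansion are the factors of the denominators of the series from the \<open>k\<close>-th on.\<close>
lemma basic_hyp_aw_like:
  assumes nz: "qpoch (a * b) Q n \<noteq> 0" "qpoch (a * c) Q n \<noteq> 0" "qpoch (a * d) Q n \<noteq> 0"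
    and z: "z \<noteq> 0"
  shows "qpoch (a * b) Q n * qpoch (a * c) Q n * qpoch (a * d) Q n *
      basic_hyp [Q powi (- int n), a * b * c * d * Q powi (int n - 1), a / z, a * z]
        [a * b, a * c, a * d] Q Q =
    a ^ n * poly (aw_like (aw_quartic a b c d) n) ((z + inverse z) / 2)"
proof -
  define G where "G = [:1, - b:] * [:1, - c:] * [:1, - d:]"
  define E where "E = [:1, - a:] * G"
  have dG: "degree G \<le> 3"
    unfolding G_def by (intro order_trans[OF degree_mult_le] order_trans[OF add_mono[OF degree_mult_le order_refl]]) simp
  have c: "coeff E 0 = 1" "coeff E 4 = a * b * c * d"
    by (simp_all add: E_def G_def eval_nat_numeral)
  have pn: "Q powi (- int n) = 1 / Q ^ n" "Q powi (int n - 1) = Q ^ n / Q"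
    using p_facts(3) by (simp_all add: power_int_minus power_int_diff field_simps)
  have f: "(\<Prod>j<k. coeff E 0 - coeff E 4 * Q ^ (n + j) / Q) = qpoch (a * b * c * d * (Q ^ n / Q)) Q k" for k
    unfolding c qpoch_def by (simp add: power_add mult.assoc)
  have nzk: "qpoch (a * v) Q k \<noteq> 0" if "k \<le> n" "qpoch (a * v) Q n \<noteq> 0" for k v
    using that qpoch_split[of k n "a * v"] by auto
  have "basic_hyp [Q powi (- int n), a * b * c * d * Q powi (int n - 1), a / z, a * z]
        [a * b, a * c, a * d] Q Q =
    (\<Sum>k\<le>n. qpoch (1 / Q ^ n) Q k * qpoch (a * b * c * d * (Q ^ n / Q)) Q k *
      poly (aw_basis a k) ((z + inverse z) / 2) /
      (qpoch (a * b) Q k * qpoch (a * c) Q k * qpoch (a * d) Q k) * (Q ^ k / qpoch Q Q k))"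
    unfolding basic_hyp_def poly_aw_basis[OF z] pn
    by (subst suminf_finite[where N = "{..n}"]) (auto simp: qpoch_neg_vanishes mult_ac)
  also have "qpoch (a * b) Q n * qpoch (a * c) Q n * qpoch (a * d) Q n * \<dots> =
    poly (smult (a ^ n) (aw_like E n)) ((z + inverse z) / 2)"
    unfolding aw_like_expansion[OF E_def dG] f poly_sum sum_distrib_left
  proof (rule sum.cong[OF refl])
    fix k assume "k \<in> {..n}"
    then have k: "k \<le> n" by simp
    have "(\<Prod>i\<in>{k..<n}. poly G (a * Q ^ i)) = (\<Prod>i\<in>{k..<n}. 1 - a * b * Q ^ i) *
      (\<Prod>i\<in>{k..<n}. 1 - a * c * Q ^ i) * (\<Prod>i\<in>{k..<n}. 1 - a * d * Q ^ i)"
      unfolding prod.distrib[symmetric] by (rule prod.cong) (simp_all add: G_def algebra_simps)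
    then show "qpoch (a * b) Q n * qpoch (a * c) Q n * qpoch (a * d) Q n *
      (qpoch (1 / Q ^ n) Q k * qpoch (a * b * c * d * (Q ^ n / Q)) Q k *
        poly (aw_basis a k) ((z + inverse z) / 2) /
        (qpoch (a * b) Q k * qpoch (a * c) Q k * qpoch (a * d) Q k) * (Q ^ k / qpoch Q Q k)) =
      poly (smult (qpoch (1 / Q ^ n) Q k * qpoch (a * b * c * d * (Q ^ n / Q)) Q k *
        (\<Prod>i\<in>{k..<n}. poly G (a * Q ^ i)) * (Q ^ k / qpoch Q Q k)) (aw_basis a k)) ((z + inverse z) / 2)"
      using nzk[OF k nz(1)] nzk[OF k nz(2)] nzk[OF k nz(3)]
      unfolding qpoch_split[OF k, of "a * b"] qpoch_split[OF k, of "a * c"] qpoch_split[OF k, of "a * d"]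
      by simp
  qed
  finally show ?thesis by (simp add: aw_quartic_def E_def G_def)
qed

lemma coeffwise_limit_aw_like:
  assumes "coeffwise_limit E E0 F"
  shows "coeffwise_limit (\<lambda>t. aw_like (E t) n) (aw_like E0 n) F"
  unfolding aw_like_def
  using X.coeffwise_limit_eigenpoly[OF coeffwise_limit_linear[OF aw_phi_linear assms]
      coeffwise_limit_linear[OF aw_psi_linear assms]]
  unfolding sl_ev_aw by (intro coeffwise_limit_smult tendsto_const)

lemma eventually_qpoch_nonzero:
  "\<forall>\<^sub>F t in at 0. qpoch ((a + t) * (b + t)) Q n \<noteq> 0"
proof -
  have "\<forall>\<^sub>F t in at 0. \<forall>k\<in>{..<n}. poly [:1 - a * b * Q ^ k, - (a + b) * Q ^ k, - (Q ^ k):] t \<noteq> 0"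
    by (rule eventually_ball_finite) (simp_all only: finite_lessThan, intro ballI eventually_poly_nonzero,
        use p_facts(3) in simp)
  then show ?thesis
  proof eventually_elim
    case (elim t)
    have e: "1 - (a + t) * (b + t) * Q ^ k = poly [:1 - a * b * Q ^ k, - (a + b) * Q ^ k, - (Q ^ k):] t" for k
      by (simp add: algebra_simps)
    show ?case unfolding qpoch_def e prod_zero_iff[OF finite_lessThan] using elim by blast
  qed
qed

text \<open>The right-hand side is continuous at all parameters, \<open>a = 0\<close> included, whereas the
  defining expression on the left has a factor \<open>1 / a\<^sup>n\<close>.\<close>
lemma askey_wilson_eq: "askey_wilson q n a b c d = aw_like (aw_quartic a b c d) n"
proof -
  let ?H = "\<lambda>\<tau>. aw_quartic (fst \<tau>) (fst (snd \<tau>)) (fst (snd (snd \<tau>))) (snd (snd (snd \<tau>)))"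
  let ?S = "aw_generic q n"
  let ?F = "at (a, b, c, d) within ?S"
  let ?g = "\<lambda>z (a, b, c, d). qpoch (a * b) (of_real q) n * qpoch (a * c) (of_real q) n *
          qpoch (a * d) (of_real q) n / a ^ n * aw_phi q n a b c d z"
  have nontriv: "?F \<noteq> bot"
  proof (rule at_within_nontrivial[where \<gamma> = "\<lambda>t. (a + t, b + t, c + t, d + t)"])
    have "((\<lambda>t. (a + t, b + t, c + t, d + t)) \<longlongrightarrow> (a + 0, b + 0, c + 0, d + 0)) (at 0)"
      by (intro tendsto_intros)
    then show "((\<lambda>t. (a + t, b + t, c + t, d + t)) \<longlongrightarrow> (a, b, c, d)) (at 0)" by simp
    show "\<forall>\<^sub>F t in at 0. (a + t, b + t, c + t, d + t) \<noteq> (a, b, c, d)"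
      by (simp add: eventually_at_filter)
    have "\<forall>\<^sub>F t in at 0. poly [:a, 1:] t \<noteq> 0" by (rule eventually_poly_nonzero) simp
    then show "\<forall>\<^sub>F t in at 0. (a + t, b + t, c + t, d + t) \<in> ?S"
      using eventually_qpoch_nonzero[of a b n] eventually_qpoch_nonzero[of a c n]
        eventually_qpoch_nonzero[of a d n]
      by eventually_elim (simp add: aw_generic_def Q_def)
  qed
  have lim: "(?g z \<longlongrightarrow> poly (aw_like (aw_quartic a b c d) n) ((z + 1 / z) / 2)) ?F" if z: "z \<noteq> 0" for z
  proof (rule tendsto_within_transform)
    have id: "((\<lambda>\<tau>. \<tau>) \<longlongrightarrow> (a, b, c, d)) ?F" by (rule tendsto_ident_at)
    note p = tendsto_fst[OF id] tendsto_fst[OF tendsto_snd[OF id]]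
      tendsto_fst[OF tendsto_snd[OF tendsto_snd[OF id]]] tendsto_snd[OF tendsto_snd[OF tendsto_snd[OF id]]]
    have "coeffwise_limit (\<lambda>\<tau>. ?H \<tau>)
        (aw_quartic a b c d) ?F"
      unfolding aw_quartic_def
      using p by (intro coeffwise_limit_mult coeffwise_limit_factor tendsto_const tendsto_minus) simp_all
    from coeffwise_limit_poly[OF coeffwise_limit_aw_like[OF this]]
    show "((\<lambda>\<tau>. poly (aw_like (?H \<tau>) n) ((z + 1 / z) / 2))
      \<longlongrightarrow> poly (aw_like (aw_quartic a b c d) n) ((z + 1 / z) / 2)) ?F" .
    fix \<tau> assume \<tau>: "\<tau> \<in> ?S"
    obtain a' b' c' d' where t: "\<tau> = (a', b', c', d')" by (metis prod.exhaust)
    have nz: "a' \<noteq> 0" "qpoch (a' * b') Q n \<noteq> 0" "qpoch (a' * c') Q n \<noteq> 0" "qpoch (a' * d') Q n \<noteq> 0"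
      using \<tau> by (auto simp: t aw_generic_def Q_def)
    have "?g z \<tau> = qpoch (a' * b') Q n * qpoch (a' * c') Q n * qpoch (a' * d') Q n * aw_phi q n a' b' c' d' z / a' ^ n"
      by (simp add: t Q_def)
    also have "\<dots> = poly (aw_like (aw_quartic a' b' c' d') n) ((z + inverse z) / 2)"
      unfolding aw_phi_def Q_def[symmetric] basic_hyp_aw_like[OF nz(2-4) z] using nz(1) by simp
    finally show "?g z \<tau> = poly (aw_like (?H \<tau>) n) ((z + 1 / z) / 2)"
      by (simp add: t inverse_eq_divide)
  qed
  show ?thesis unfolding askey_wilson_def
  proof (rule the_equality)
    fix p assume p: "\<forall>z. z \<noteq> 0 \<longrightarrow> (?g z \<longlongrightarrow> poly p ((z + 1 / z) / 2)) ?F"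
    show "p = aw_like (aw_quartic a b c d) n"
    proof (rule X.poly_eqI_lattice)
      fix s
      have z: "r * Q powr s \<noteq> 0" using r p_facts(3) by simp
      show "poly p (aw_lattice s) = poly (aw_like (aw_quartic a b c d) n) (aw_lattice s)"
        using tendsto_unique[OF nontriv _ lim[OF z]] p z by (simp add: aw_lattice_def inverse_eq_divide)
    qed
  qed (use lim in blast)
qed

lemma aw_like_smult: "aw_like (smult c E) n = smult (c ^ n) (aw_like E n)"
proof -
  interpret T: triangular_operator "Aop E" "aw_ev E" by (rule Aop_triangular)
  have "Aop (smult c E) = (\<lambda>p. smult c (Aop E p))"
    by (simp add: fun_eq_iff sl_op_def linear_poly_operator.smult[OF aw_phi_linear]
        linear_poly_operator.smult[OF aw_psi_linear] smult_add_right)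
  moreover have "aw_ev (smult c E) = (\<lambda>k. c * aw_ev E k)"
    by (simp add: fun_eq_iff aw_ev_def algebra_simps)
  ultimately show ?thesis
    unfolding aw_like_def by (simp add: T.eigenpoly_scale mult.commute)
qed

lemma aw_like_eigen: "Aop E (aw_like E n) = smult (aw_ev E n) (aw_like E n)"
proof -
  interpret T: triangular_operator "Aop E" "aw_ev E" by (rule Aop_triangular)
  show ?thesis unfolding aw_like_def by (simp add: T.smult T.eigenpoly_eigen mult.commute)
qed

lemma degree_aw_like: "degree (aw_like E n) \<le> n"
proof -
  interpret T: triangular_operator "Aop E" "aw_ev E" by (rule Aop_triangular)
  show ?thesis unfolding aw_like_def by (rule order_trans[OF degree_smult_le T.degree_eigenpoly_le])
qed

lemma aw_ev_separated:
  assumes "aw_like E n \<noteq> 0" "degree (aw_like E n) = n" "j < n"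
  shows "aw_ev E j \<noteq> aw_ev E n"
proof -
  interpret T: triangular_operator "Aop E" "aw_ev E" by (rule Aop_triangular)
  have "coeff (aw_like E n) n \<noteq> 0" using assms by (metis leading_coeff_0_iff)
  then have "\<forall>i\<in>{..<n}. aw_ev E n \<noteq> aw_ev E i" by (simp add: aw_like_def T.coeff_eigenpoly)
  then show ?thesis using assms(3) by (metis lessThan_iff)
qed

text \<open>The linear factor of \<open>E\<close> that belongs to a parameter; for a parameter tending to infinity,
  the limit of the factor after division by \<open>r\<close> times the parameter (\<open>aw_scale\<close>).\<close>
definition aw_factor :: "complex option \<Rightarrow> complex poly" where
  "aw_factor v = (case v of None \<Rightarrow> [:0, - 1:] | Some v \<Rightarrow> [:1, - (r * v):])"

definition aw_scale :: "complex option \<Rightarrow> complex \<Rightarrow> complex" where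
  "aw_scale v a = (case v of None \<Rightarrow> inverse (r * a) | Some _ \<Rightarrow> 1)"

lemma aw_factor_nonzero: "aw_factor v \<noteq> 0"
  by (cases v) (simp_all add: aw_factor_def)

lemma degree_aw_factor: "degree (aw_factor v) \<le> 1"
  by (cases v) (simp_all add: aw_factor_def)

lemma scaled_factor_limit:
  "coeffwise_limit (\<lambda>a. smult (aw_scale v a) [:1, - (r * a):]) (aw_factor v) (param_filter v)"
proof (cases v)
  case None
  have "((\<lambda>a. inverse r * inverse a) \<longlongrightarrow> inverse r * 0) at_infinity"
    by (intro tendsto_intros tendsto_inverse_0)
  then have 1: "((\<lambda>a. inverse (r * a)) \<longlongrightarrow> 0) at_infinity" by simp
  have "\<forall>\<^sub>F a in at_infinity. - 1 = inverse (r * a) * - (r * a)"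
    using eventually_not_equal_at_infinity[of 0] by eventually_elim (use r in \<open>simp add: field_simps\<close>)
  then have 2: "((\<lambda>a. inverse (r * a) * - (r * a)) \<longlongrightarrow> - 1) at_infinity"
    by (rule Lim_transform_eventually[OF tendsto_const])
  show ?thesis using coeffwise_limit_factor[OF 1 2]
    by (simp add: None aw_scale_def aw_factor_def param_filter_def)
next
  case (Some w)
  have "((\<lambda>a. - (r * a)) \<longlongrightarrow> - (r * w)) (principal {w})"
    using tendsto_principal_singleton[of "\<lambda>a. - (r * a)" w] by simp
  from coeffwise_limit_factor[OF tendsto_const this] show ?thesis
    by (simp add: Some aw_scale_def aw_factor_def param_filter_def)
qed

lemma param_filter_nontrivial: "param_filter v \<noteq> bot"
  by (cases v) (simp_all add: param_filter_def trivial_limit_at_infinity principal_eq_bot_iff)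

definition aw_scales ::
  "complex option \<Rightarrow> complex option \<Rightarrow> complex option \<Rightarrow> complex option \<Rightarrow> complex \<times> complex \<times> complex \<times> complex \<Rightarrow> complex" where
  "aw_scales A B C D = (\<lambda>(a, b, c, d). aw_scale A a * (aw_scale B b * aw_scale C c * aw_scale D d))"

definition aw_factors ::
  "complex option \<Rightarrow> complex option \<Rightarrow> complex option \<Rightarrow> complex option \<Rightarrow> complex poly" where
  "aw_factors A B C D = aw_factor A * (aw_factor B * aw_factor C * aw_factor D)"

lemma aw_quartic_limit:
  "coeffwise_limit (\<lambda>t. smult (aw_scales A B C D t) (case t of (a, b, c, d) \<Rightarrow> aw_quartic (r * a) (r * b) (r * c) (r * d)))
     (aw_factors A B C D) (param_filter A \<times>\<^sub>F (param_filter B \<times>\<^sub>F (param_filter C \<times>\<^sub>F param_filter D)))"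
proof -
  let ?F = "param_filter A \<times>\<^sub>F (param_filter B \<times>\<^sub>F (param_filter C \<times>\<^sub>F param_filter D))"
  have p: "filterlim fst (param_filter A) ?F" "filterlim (\<lambda>t. fst (snd t)) (param_filter B) ?F"
    "filterlim (\<lambda>t. fst (snd (snd t))) (param_filter C) ?F" "filterlim (\<lambda>t. snd (snd (snd t))) (param_filter D) ?F"
    by (rule filterlim_fst filterlim_snd filterlim_compose[OF filterlim_fst] filterlim_compose[OF filterlim_snd])+
  have e: "smult (aw_scales A B C D t) (case t of (a, b, c, d) \<Rightarrow> aw_quartic (r * a) (r * b) (r * c) (r * d)) =
    smult (aw_scale A (fst t)) [:1, - (r * fst t):] * (smult (aw_scale B (fst (snd t))) [:1, - (r * fst (snd t)):] *
      smult (aw_scale C (fst (snd (snd t)))) [:1, - (r * fst (snd (snd t))):] *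
      smult (aw_scale D (snd (snd (snd t)))) [:1, - (r * snd (snd (snd t))):])" for t
    by (cases t) (simp only: aw_scales_def aw_quartic_def prod.case fst_conv snd_conv mult_smult_left mult_smult_right smult_smult mult_ac)
  show ?thesis unfolding e aw_factors_def
    by (rule coeffwise_limit_mult coeffwise_limit_compose[OF scaled_factor_limit] p)+
qed

lemma aw_factors_Some: "aw_factors (Some a) (Some b) (Some c) (Some d) = aw_quartic (r * a) (r * b) (r * c) (r * d)"
  by (simp add: aw_factors_def aw_factor_def aw_quartic_def)

text \<open>In the limiting case the normalizing factor is the \<open>n\<close>-th power of the scale of the quartic
  polynomial, because \<open>aw_like\<close> is homogeneous of degree \<open>n\<close> in it.\<close>
lemma aw_factors_family: "askey_wilson_family q r (aw_like (aw_factors A B C D))"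
proof (cases "None \<in> {A, B, C, D}")
  case True
  define \<kappa>' where "\<kappa>' n t = aw_scales A B C D t ^ n" for n t
  have "((\<lambda>(a, b, c, d). \<kappa>' n (a, b, c, d) * coeff (askey_wilson q n (r * a) (r * b) (r * c) (r * d)) i)
          \<longlongrightarrow> coeff (aw_like (aw_factors A B C D) n) i)
          (param_filter A \<times>\<^sub>F (param_filter B \<times>\<^sub>F (param_filter C \<times>\<^sub>F param_filter D)))" for n i
    using coeffwise_limitD[OF coeffwise_limit_aw_like[OF aw_quartic_limit[of A B C D], of n], of i]
    unfolding aw_like_smult coeff_smult by (simp add: \<kappa>'_def askey_wilson_eq case_prod_unfold)
  then show ?thesis unfolding askey_wilson_family_def using True by blast
next
  case False
  then obtain a b c d where "A = Some a" "B = Some b" "C = Some c" "D = Some d"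
    by (cases A; cases B; cases C; cases D) auto
  then have "\<forall>n. aw_like (aw_factors A B C D) n = askey_wilson q n (r * a) (r * b) (r * c) (r * d)"
    by (simp add: aw_factors_Some askey_wilson_eq)
  then show ?thesis unfolding askey_wilson_family_def by blast
qed

text \<open>A root \<open>\<rho> \<noteq> 0\<close> belongs to the parameter \<open>v\<close> with \<open>r v = 1 / \<rho>\<close>, a root \<open>0\<close> to an
  infinite parameter, and each degree missing from \<open>4\<close> to a parameter \<open>0\<close>.\<close>
lemma quartic_factorization:
  assumes "E \<noteq> 0" "degree E \<le> 4"
  shows "\<exists>c A B C D. c \<noteq> 0 \<and> E = smult c (aw_factors A B C D)"
proof -
  obtain root where R: "smult (lead_coeff E) (\<Prod>i<degree E. [:- root i, 1:]) = E"
    by (rule complex_poly_decompose')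
  define f where "f i = (if i < degree E then (if root i = 0 then None else Some (1 / (r * root i))) else Some 0)" for i
  define g where "g i = (if i < degree E then (if root i = 0 then - 1 else - root i) else 1)" for i
  have fg: "(if i < degree E then [:- root i, 1:] else 1) = smult (g i) (aw_factor (f i))" for i
    using r by (auto simp: f_def g_def aw_factor_def)
  have "(\<Prod>i<4. if i < degree E then [:- root i, 1:] else 1) = (\<Prod>i<degree E. [:- root i, 1:])"
  proof -
    have "{..<4} \<inter> {i. i < degree E} = {..<degree E}" using assms(2) by auto
    then show ?thesis by (simp add: prod.If_cases)
  qed
  then have "(\<Prod>i<degree E. [:- root i, 1:]) = (\<Prod>i<4. smult (g i) (aw_factor (f i)))"
    unfolding fg by simp
  also have "\<dots> = smult (g 0) (aw_factor (f 0)) *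
      (smult (g 1) (aw_factor (f 1)) * smult (g 2) (aw_factor (f 2)) * smult (g 3) (aw_factor (f 3)))"
    by (rule prod_lessThan_4)
  also have "\<dots> = smult (g 0 * g 1 * g 2 * g 3) (aw_factors (f 0) (f 1) (f 2) (f 3))"
    by (simp only: aw_factors_def mult_smult_left mult_smult_right smult_smult mult_ac)
  finally have P: "(\<Prod>i<degree E. [:- root i, 1:]) =
    smult (g 0 * g 1 * g 2 * g 3) (aw_factors (f 0) (f 1) (f 2) (f 3))" .
  have "E = smult (lead_coeff E * (g 0 * g 1 * g 2 * g 3)) (aw_factors (f 0) (f 1) (f 2) (f 3))"
    using R[symmetric] unfolding P smult_smult .
  moreover have "g i \<noteq> 0" for i by (simp add: g_def)
  then have "lead_coeff E * (g 0 * g 1 * g 2 * g 3) \<noteq> 0" using assms(1) by simp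
  ultimately show ?thesis by blast
qed

lemma askey_wilson_family_covers:
  assumes \<phi>: "degree \<phi> \<le> 2" and \<psi>: "degree \<psi> = 1"
  shows "\<exists>R. askey_wilson_family q r R \<and> (\<forall>n. \<exists>k. k \<noteq> 0 \<and>
    R n = smult k (eigenpoly (sl_op aw_lattice \<phi> \<psi>) (X.sl_ev \<phi> \<psi>) n))"
proof -
  define v where "v i = p * coeff \<phi> i / \<kappa>\<^sup>2" for i
  define w where "w i = p * coeff \<psi> i / \<kappa>" for i
  \<comment> \<open>The coefficients of \<open>p z\<^sup>2 (4 \<phi> / \<kappa>\<^sup>2 + \<psi> (z - 1 / z) / \<kappa>)\<close>, as in \<open>aw_phi_psi\<close>.\<close>
  define E where "E = [:v 2 - w 1 / 2, 2 * v 1 - w 0, 2 * v 2 + 4 * v 0, 2 * v 1 + w 0, v 2 + w 1 / 2:]"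
  have cv: "coeff \<phi> i = \<kappa>\<^sup>2 / p * v i" and cw: "coeff \<psi> i = \<kappa> / p * w i" for i
    using p_facts(1,5) by (simp_all add: v_def w_def)
  have cE: "coeff E 0 = v 2 - w 1 / 2" "coeff E 1 = 2 * v 1 - w 0" "coeff E 2 = 2 * v 2 + 4 * v 0"
    "coeff E 3 = 2 * v 1 + w 0" "coeff E 4 = v 2 + w 1 / 2"
    by (simp_all add: E_def eval_nat_numeral)
  have dE: "degree E \<le> 4" unfolding E_def by (simp add: Polynomial.degree_le coeff_pCons split: nat.split)
  have "\<phi> = [:coeff \<phi> 0, coeff \<phi> 1, coeff \<phi> 2:]"
    using \<phi> by (auto simp: poly_eq_iff coeff_pCons eval_nat_numeral coeff_eq_0 split: nat.split)
  moreover have "aw_phi_poly E = [:coeff \<phi> 0, coeff \<phi> 1, coeff \<phi> 2:]"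
    unfolding aw_phi_poly_def cE cv using p_facts(1) by (simp add: field_simps)
  ultimately have ph: "aw_phi_poly E = \<phi>" by simp
  have "\<psi> = [:coeff \<psi> 0, coeff \<psi> 1:]"
    using \<psi> by (auto simp: poly_eq_iff coeff_pCons eval_nat_numeral coeff_eq_0 split: nat.split)
  moreover have "aw_psi_poly E = [:coeff \<psi> 0, coeff \<psi> 1:]"
    unfolding aw_psi_poly_def cE cw using p_facts(1) by (simp add: field_simps)
  ultimately have ps: "aw_psi_poly E = \<psi>" by simp
  have "coeff \<psi> 1 \<noteq> 0" using \<psi> by (metis leading_coeff_0_iff degree_0 zero_neq_one)
  then have "E \<noteq> 0" using ps by (auto simp: aw_psi_poly_def)
  then obtain c A B C D where c: "c \<noteq> 0" and Ec: "E = smult c (aw_factors A B C D)"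
    using quartic_factorization[OF _ dE] by blast
  have R: "aw_like E n = smult (c ^ n) (aw_like (aw_factors A B C D) n)" for n
    unfolding Ec by (rule aw_like_smult)
  have "aw_like (aw_factors A B C D) n = smult (((- 2) ^ n * (\<Prod>j<n. Q ^ j) / aw_norm n) / c ^ n)
      (eigenpoly (sl_op aw_lattice \<phi> \<psi>) (X.sl_ev \<phi> \<psi>) n)" for n
  proof -
    have "aw_like (aw_factors A B C D) n = smult (1 / c ^ n) (aw_like E n)" using R[of n] c by simp
    also have "aw_like E n = smult ((- 2) ^ n * (\<Prod>j<n. Q ^ j) / aw_norm n)
      (eigenpoly (sl_op aw_lattice \<phi> \<psi>) (X.sl_ev \<phi> \<psi>) n)"
      unfolding aw_like_def sl_ev_aw[symmetric] ph ps ..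
    finally show ?thesis by (simp add: mult.commute)
  qed
  moreover have "((- 2) ^ n * (\<Prod>j<n. Q ^ j) / aw_norm n) / c ^ n \<noteq> 0" for n
    using aw_const_nonzero[of n] c by simp
  ultimately show ?thesis using aw_factors_family[of A B C D] by blast
qed

text \<open>Equation and eigenvalue are linear in the quartic polynomial, so they may be divided by its
  scale. Both sides then converge coefficientwise, whatever the normalizing factors \<open>\<theta>\<close> are.\<close>
lemma aw_limit_eigen:
  assumes lim: "\<And>n i. ((\<lambda>(a, b, c, d). \<theta> n (a, b, c, d) * coeff (askey_wilson q n (r * a) (r * b) (r * c) (r * d)) i)
      \<longlongrightarrow> coeff (R n) i) (param_filter A \<times>\<^sub>F (param_filter B \<times>\<^sub>F (param_filter C \<times>\<^sub>F param_filter D)))"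
    and deg: "degree (R n) \<le> n"
  shows "Aop (aw_factors A B C D) (R n) = smult (aw_ev (aw_factors A B C D) n) (R n)"
proof -
  let ?F = "param_filter A \<times>\<^sub>F (param_filter B \<times>\<^sub>F (param_filter C \<times>\<^sub>F param_filter D))"
  have F: "?F \<noteq> bot" by (simp add: prod_filter_eq_bot param_filter_nontrivial)
  define H where "H t = (case t of (a, b, c, d) \<Rightarrow> aw_quartic (r * a) (r * b) (r * c) (r * d))" for t
  define E where "E t = smult (aw_scales A B C D t) (H t)" for t
  define g where "g t = smult (\<theta> n t) (aw_like (H t) n)" for t
  have E: "coeffwise_limit E (aw_factors A B C D) ?F"
    using aw_quartic_limit[of A B C D] unfolding E_def H_def .
  have g: "coeffwise_limit g (R n) ?F"
    unfolding coeffwise_limit_def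
  proof (intro conjI exI[of _ n] allI deg)
    show "degree (g t) \<le> n" for t
      unfolding g_def by (rule order_trans[OF degree_smult_le degree_aw_like])
    show "((\<lambda>t. coeff (g t) i) \<longlongrightarrow> coeff (R n) i) ?F" for i
      using lim[of n i] by (simp add: g_def H_def askey_wilson_eq case_prod_unfold)
  qed
  have "Aop (E t) (g t) = smult (aw_ev (E t) n) (g t)" for t
  proof -
    interpret T: triangular_operator "Aop (E t)" "aw_ev (E t)" by (rule Aop_triangular)
    show ?thesis
    proof (cases "aw_scales A B C D t = 0")
      \<comment> \<open>This happens where a parameter that tends to infinity takes the value \<open>0\<close>, as \<open>inverse 0 = 0\<close>.\<close>
      case True
      then show ?thesis by (simp add: E_def aw_ev_def aw_phi_poly_def aw_psi_poly_def sl_op_def)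
    next
      case False
      have "aw_like (E t) n = smult (aw_scales A B C D t ^ n) (aw_like (H t) n)"
        unfolding E_def by (rule aw_like_smult)
      then have "g t = smult (\<theta> n t / aw_scales A B C D t ^ n) (aw_like (E t) n)"
        using False by (simp add: g_def)
      then show ?thesis by (simp add: T.smult aw_like_eigen mult.commute)
    qed
  qed
  then have e: "(\<lambda>t. Aop (E t) (g t)) = (\<lambda>t. smult (aw_ev (E t) n) (g t))" by (rule ext)
  have "coeffwise_limit (\<lambda>t. Aop (E t) (g t)) (Aop (aw_factors A B C D) (R n)) ?F"
    by (rule X.coeffwise_limit_sl_op[OF coeffwise_limit_linear[OF aw_phi_linear E] coeffwise_limit_linear[OF aw_psi_linear E] g])
  moreover have "coeffwise_limit (\<lambda>t. smult (aw_ev (E t) n) (g t)) (smult (aw_ev (aw_factors A B C D) n) (R n)) ?F"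
    unfolding aw_ev_def
    by (intro coeffwise_limit_smult g tendsto_mult tendsto_divide tendsto_diff tendsto_const coeffwise_limitD[OF E] p_facts(3))
  ultimately show ?thesis using coeffwise_limit_unique[OF _ _ F] unfolding e by blast
qed

text \<open>The \<open>R n\<close> span all polynomials. If the operator annihilates \<open>x\<close>, then \<open>\<psi> = 0\<close>; if it then
  annihilates \<open>x\<^sup>2\<close>, also \<open>\<phi> = 0\<close>.\<close>
lemma Aop_zero_on_basis:
  assumes E: "degree E \<le> 4" and R: "\<And>n. R n \<noteq> 0 \<and> degree (R n) = n" and z: "\<And>n. Aop E (R n) = 0"
  shows "E = 0"
proof -
  interpret T: triangular_operator "Aop E" "aw_ev E" by (rule Aop_triangular)
  have all: "Aop E f = 0" for f
  proof (induction "degree f" arbitrary: f rule: less_induct)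
    case less
    let ?m = "degree f"
    have Rm: "coeff (R ?m) ?m \<noteq> 0" using R[of ?m] by (metis leading_coeff_0_iff)
    let ?c = "coeff f ?m / coeff (R ?m) ?m"
    let ?g = "f - smult ?c (R ?m)"
    have L: "Aop E f = Aop E ?g" by (simp add: T.diff T.smult z)
    show ?case
    proof (cases "?g = 0")
      case True
      then show ?thesis unfolding L by (simp add: T.zero)
    next
      case False
      have "degree ?g \<le> ?m" using R[of ?m] by (intro degree_diff_le) (auto intro: order_trans[OF degree_smult_le])
      moreover have "coeff ?g ?m = 0" using Rm by simp
      ultimately have "degree ?g < ?m" using False by (metis leading_coeff_0_iff le_neq_implies_less)
      then show ?thesis unfolding L by (rule less)
    qed
  qed
  have top: "half_powers_diff 1 = 1" "half_powers_diff 2 \<noteq> 0"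
    using p_facts(5,6) X.dd_Suc[of 1] X.mm_Suc[of 0] X.dd_Suc[of 0]
    by (simp_all add: numeral_2_eq_2 X.dd_0 X.mm_0)
  have D1: "Dx aw_lattice (monom 1 1) = 1"
  proof -
    have "degree (Dx aw_lattice (monom 1 1)) \<le> 0" "coeff (Dx aw_lattice (monom 1 1)) 0 = 1"
      using X.Dx_Sx_top[of "monom 1 1" 1] top by (simp_all add: degree_monom_eq)
    then show ?thesis by (metis degree_eq_zeroE le_zero_eq coeff_pCons_0 one_pCons)
  qed
  have D0: "Dx aw_lattice 1 = 0" by (rule X.Dx_unique) simp
  have S0: "Sx aw_lattice 1 = 1" by (rule X.Sx_unique) simp
  have ps: "aw_psi_poly E = 0" using all[of "monom 1 1"] unfolding sl_op_def D1 D0 S0 by simp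
  have "Dx aw_lattice (Dx aw_lattice (monom 1 2)) \<noteq> 0"
  proof -
    have d: "degree (Dx aw_lattice (monom 1 2)) \<le> 1" "coeff (Dx aw_lattice (monom 1 2)) 1 = half_powers_diff 2"
      using X.Dx_Sx_top[of "monom 1 2" 2] by (simp_all add: degree_monom_eq)
    have "coeff (Dx aw_lattice (Dx aw_lattice (monom 1 2))) (1 - 1) = half_powers_diff 1 * half_powers_diff 2"
      using X.Dx_Sx_top(3)[OF d(1)] d(2) by simp
    then show ?thesis using top by auto
  qed
  then have ph: "aw_phi_poly E = 0" using all[of "monom 1 2"] by (simp add: sl_op_def ps)
  show "E = 0"
  proof (rule X.poly_eqI_cofinite[of "{0}"])
    fix s assume "aw_lattice s \<notin> {0}"
    then show "poly E (aw_lattice s) = poly 0 (aw_lattice s)"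
      using aw_phi_psi[OF E, of "aw_lattice s"] by (simp add: ph ps)
  qed simp
qed

text \<open>In the limiting case \<open>E\<close> vanishes at \<open>0\<close>, so \<open>ev n - ev j\<close> is a nonzero multiple of the
  coefficient of \<open>z\<^sup>4\<close>. If this were zero too, all eigenvalues and hence the operator would vanish.\<close>
lemma askey_wilson_family_solves:
  assumes R: "askey_wilson_family q r R" and deg: "\<And>n. R n \<noteq> 0 \<and> degree (R n) = n"
  shows "\<exists>\<phi> \<psi>. degree \<phi> \<le> 2 \<and> degree \<psi> \<le> 1 \<and>
    (\<forall>n. sl_op aw_lattice \<phi> \<psi> (R n) = smult (X.sl_ev \<phi> \<psi> n) (R n)) \<and>
    (\<forall>n. \<forall>j<n. X.sl_ev \<phi> \<psi> j \<noteq> X.sl_ev \<phi> \<psi> n)"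
proof -
  have "\<exists>E. (\<forall>n. Aop E (R n) = smult (aw_ev E n) (R n)) \<and> (\<forall>n. \<forall>j<n. aw_ev E j \<noteq> aw_ev E n)"
    using R unfolding askey_wilson_family_def
  proof (elim disjE exE conjE)
    fix a b c d assume "\<forall>n. R n = askey_wilson q n (r * a) (r * b) (r * c) (r * d)"
    then have "R n = aw_like (aw_quartic (r * a) (r * b) (r * c) (r * d)) n" for n by (simp add: askey_wilson_eq)
    then show ?thesis using aw_like_eigen aw_ev_separated deg by metis
  next
    fix A B C D \<theta>
    assume N: "None \<in> {A, B, C, D}" and lim: "\<forall>n i. ((\<lambda>(a, b, c, d).
        \<theta> n (a, b, c, d) * coeff (askey_wilson q n (r * a) (r * b) (r * c) (r * d)) i)
      \<longlongrightarrow> coeff (R n) i) (param_filter A \<times>\<^sub>F (param_filter B \<times>\<^sub>F (param_filter C \<times>\<^sub>F param_filter D)))"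
    let ?E = "aw_factors A B C D"
    have eig: "Aop ?E (R n) = smult (aw_ev ?E n) (R n)" for n
      by (rule aw_limit_eigen) (use lim deg in auto)
    have E0: "coeff ?E 0 = 0"
      using N by (auto simp: aw_factors_def aw_factor_def coeff_mult)
    have dE: "degree ?E \<le> 4"
    proof -
      have "degree ?E \<le> degree (aw_factor A) + (degree (aw_factor B) + degree (aw_factor C) + degree (aw_factor D))"
        unfolding aw_factors_def
        by (intro order_trans[OF degree_mult_le] add_mono order_refl)
      then show ?thesis using degree_aw_factor[of A] degree_aw_factor[of B] degree_aw_factor[of C] degree_aw_factor[of D]
        by linarith
    qed
    have "?E \<noteq> 0" by (simp add: aw_factors_def aw_factor_nonzero)
    have E4: "coeff ?E 4 \<noteq> 0"
    proof
      assume "coeff ?E 4 = 0"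
      then have "Aop ?E (R n) = 0" for n unfolding eig by (simp add: aw_ev_def E0)
      then have "?E = 0" by (rule Aop_zero_on_basis[OF dE deg])
      then show False using \<open>?E \<noteq> 0\<close> by simp
    qed
    have "aw_ev ?E j \<noteq> aw_ev ?E n" if "j < n" for n j
    proof -
      have "Q ^ n \<noteq> Q ^ j" using Q_power_inj[of n j] that by auto
      then have "aw_ev ?E n - aw_ev ?E j \<noteq> 0"
        unfolding aw_ev_gap E0 using E4 p_facts(3) by simp
      then show ?thesis by auto
    qed
    then show ?thesis using eig by blast
  qed
  then show ?thesis using degree_aw_phi_psi unfolding sl_ev_aw[symmetric] by blast
qed

lemma aw_lattice_eq: "(r * of_real q powr s + inverse r * of_real q powr (- s)) / 2 = aw_lattice s"
  by (simp add: aw_lattice_def powr_minus flip: Q_def)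

text \<open>With \<open>r\<^sup>2 = c\<^sub>2 / c\<^sub>1\<close> and \<open>z = r q\<^sup>s\<close> the lattice is \<open>c\<^sub>1 r (z + 1 / z)\<close>.\<close>
lemma askey_wilson_classification:
  fixes P :: "nat \<Rightarrow> complex poly"
  assumes P: "\<And>n. P n \<noteq> 0 \<and> degree (P n) = n" and c: "c1 \<noteq> 0" "c2 \<noteq> 0" and r2: "r\<^sup>2 = c2 / c1"
  defines "x \<equiv> q_lattice q c1 c2"
  shows "(\<exists>\<phi> \<psi> l. degree \<phi> \<le> 2 \<and> degree \<psi> = 1 \<and>
           (\<forall>n. sl_solution x \<phi> \<psi> (l n) n (P n) \<and> sl_unique x \<phi> \<psi> (l n) n))
         \<longleftrightarrow> (\<exists>R. askey_wilson_family q r R \<and>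
           (\<forall>n. \<exists>k. k \<noteq> 0 \<and> (\<forall>s. poly (P n) (x s) = k * poly (R n) (aw_lattice s))))" (is ?equivalence)
    and "\<forall>\<phi> \<psi> l. degree \<phi> \<le> 2 \<and> degree \<psi> = 1 \<and> (\<forall>n. sl_solution x \<phi> \<psi> (l n) n (P n))
         \<longrightarrow> (\<exists>R. askey_wilson_family q r R \<and> (\<forall>n. sl_unique x \<phi> \<psi> (l n) n \<longrightarrow>
              (\<exists>k. k \<noteq> 0 \<and> (\<forall>s. poly (P n) (x s) = k * poly (R n) (aw_lattice s)))))" (is ?covered)
proof -
  have nz: "2 * c1 * r \<noteq> 0" using c r by simp
  have "x s = 2 * c1 * r * aw_lattice s + 0" for s
  proof -
    have "2 * c1 * r * aw_lattice s = c1 * inverse (Q powr s) + c1 * r\<^sup>2 * Q powr s"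
      using r by (simp add: aw_lattice_def field_simps power2_eq_square)
    also have "c1 * r\<^sup>2 = c2" using c by (simp add: r2)
    finally show ?thesis by (simp add: x_def q_lattice_def powr_minus flip: Q_def)
  qed
  note * = X.classification[OF q_lattice_instance[OF c, folded x_def] nz this P
      askey_wilson_family_covers askey_wilson_family_solves]
  show ?equivalence by (rule *(1))
  show ?covered by (rule *(2))
qed

lemma basic_hyp_eq_askey_wilson:
  assumes u: "r\<^sup>2 = u"
    and nz: "qpoch (a * b * u) Q n * qpoch (a * c * u) Q n * qpoch (a * d * u) Q n \<noteq> 0"
  shows "basic_hyp [Q powi (- int n), u\<^sup>2 * a * b * c * d * Q powi (int n - 1),
             a * Q powr (- s), a * u * Q powr s] [a * b * u, a * c * u, a * d * u] Q Q
          = (r * a) ^ n * poly (askey_wilson q n (r * a) (r * b) (r * c) (r * d)) (aw_lattice s) /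
            (qpoch (a * b * u) Q n * qpoch (a * c * u) Q n * qpoch (a * d * u) Q n)"
proof -
  define z where "z = r * Q powr s"
  have z: "z \<noteq> 0" using r p_facts(3) by (simp add: z_def)
  have e: "r * a * (r * v) = a * v * u" for v by (simp add: u[symmetric] power2_eq_square)
  have e4: "a * b * u * (r * c) * (r * d) = u\<^sup>2 * a * b * c * d"
    by (simp add: u[symmetric] power2_eq_square)
  have ez: "r * a / z = a * Q powr (- s)" "r * a * z = a * u * Q powr s"
    using r by (simp_all add: z_def u[symmetric] power2_eq_square powr_minus divide_inverse)
  have "qpoch (a * b * u) Q n * qpoch (a * c * u) Q n * qpoch (a * d * u) Q n *
    basic_hyp [Q powi (- int n), u\<^sup>2 * a * b * c * d * Q powi (int n - 1),
             a * Q powr (- s), a * u * Q powr s] [a * b * u, a * c * u, a * d * u] Q Q =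
    (r * a) ^ n * poly (askey_wilson q n (r * a) (r * b) (r * c) (r * d)) (aw_lattice s)"
    using basic_hyp_aw_like[of "r * a" "r * b" n "r * c" "r * d" z] nz z
    unfolding e e4 ez askey_wilson_eq aw_lattice_def z_def[symmetric] by simp
  then show ?thesis using nz by (metis nonzero_mult_div_cancel_left)
qed

end

end

section \<open>The classification on both lattices\<close>

theorem theorem3p6:
  fixes P :: "nat \<Rightarrow> complex poly" and q :: real and c1 c2 c4 c5 :: complex
  assumes P: "\<And>n. P n \<noteq> 0 \<and> degree (P n) = n"
    and q: "q > 0" "q \<noteq> 1"
    and c12: "c1 * c2 \<noteq> 0"
    and c4: "c4 \<noteq> 0"
  shows
   "(let x = q_lattice q c1 c2; u = c2 / c1; r = csqrt u;
         X = (\<lambda>s. (r * of_real q powr s + inverse r * of_real q powr (- s)) / 2)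
     in
       ((\<exists>\<phi> \<psi> l. degree \<phi> \<le> 2 \<and> degree \<psi> = 1 \<and>
           (\<forall>n. sl_solution x \<phi> \<psi> (l n) n (P n) \<and> sl_unique x \<phi> \<psi> (l n) n))
         \<longleftrightarrow>
        (\<exists>R. askey_wilson_family q r R \<and>
           (\<forall>n. \<exists>k. k \<noteq> 0 \<and> (\<forall>s. poly (P n) (x s) = k * poly (R n) (X s))))) \<and>
       (\<forall>\<phi> \<psi> l. degree \<phi> \<le> 2 \<and> degree \<psi> = 1 \<and> (\<forall>n. sl_solution x \<phi> \<psi> (l n) n (P n))
         \<longrightarrow>
        (\<exists>R. askey_wilson_family q r R \<and>
           (\<forall>n. sl_unique x \<phi> \<psi> (l n) n \<longrightarrow>
              (\<exists>k. k \<noteq> 0 \<and> (\<forall>s. poly (P n) (x s) = k * poly (R n) (X s)))))) \<and>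
       (\<forall>n a b c d s.
          qpoch (a * b * u) (of_real q) n * qpoch (a * c * u) (of_real q) n *
            qpoch (a * d * u) (of_real q) n \<noteq> 0 \<longrightarrow>
          basic_hyp
            [of_real q powi (- int n), u\<^sup>2 * a * b * c * d * of_real q powi (int n - 1),
             a * of_real q powr (- s), a * u * of_real q powr s]
            [a * b * u, a * c * u, a * d * u] (of_real q) (of_real q)
          = (r * a) ^ n * poly (askey_wilson q n (r * a) (r * b) (r * c) (r * d)) (X s) /
            (qpoch (a * b * u) (of_real q) n * qpoch (a * c * u) (of_real q) n *
             qpoch (a * d * u) (of_real q) n)))
    \<and>
    (let x = quad_lattice c4 c5; u = c5 / c4; X = (\<lambda>s. - (s + u / 2)\<^sup>2)
     in
       ((\<exists>\<phi> \<psi> l. degree \<phi> \<le> 2 \<and> degree \<psi> = 1 \<and>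
           (\<forall>n. sl_solution x \<phi> \<psi> (l n) n (P n) \<and> sl_unique x \<phi> \<psi> (l n) n))
         \<longleftrightarrow>
        (\<exists>R. wilson_family u R \<and>
           (\<forall>n. \<exists>k. k \<noteq> 0 \<and> (\<forall>s. poly (P n) (x s) = k * poly (R n) (X s))))) \<and>
       (\<forall>\<phi> \<psi> l. degree \<phi> \<le> 2 \<and> degree \<psi> = 1 \<and> (\<forall>n. sl_solution x \<phi> \<psi> (l n) n (P n))
         \<longrightarrow>
        (\<exists>R. wilson_family u R \<and>
           (\<forall>n. sl_unique x \<phi> \<psi> (l n) n \<longrightarrow>
              (\<exists>k. k \<noteq> 0 \<and> (\<forall>s. poly (P n) (x s) = k * poly (R n) (X s)))))) \<and>
       (\<forall>n a b c d s.
          pochhammer (a + b + u) n * pochhammer (a + c + u) n * pochhammer (a + d + u) n \<noteq> 0 \<longrightarrow>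
          hyp [- of_nat n, a + b + c + d + 2 * u + of_nat n - 1, a - s, a + u + s]
              [a + b + u, a + c + u, a + d + u] 1
          = poly (wilson n (a + u/2) (b + u/2) (c + u/2) (d + u/2)) (X s) /
            (pochhammer (a + b + u) n * pochhammer (a + c + u) n * pochhammer (a + d + u) n)) \<and>
       (\<forall>n a b c s.
          pochhammer (a + b + u) n * pochhammer (a + c + u) n \<noteq> 0 \<longrightarrow>
          hyp [- of_nat n, a - s, a + u + s] [a + b + u, a + c + u] 1
          = poly (cont_dual_hahn n (a + u/2) (b + u/2) (c + u/2)) (X s) /
            (pochhammer (a + b + u) n * pochhammer (a + c + u) n)))"
proof (intro conjI, goal_cases)
  case 1
  have c: "c1 \<noteq> 0" "c2 \<noteq> 0" using c12 by auto
  define r where "r = csqrt (c2 / c1)"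
  have r: "r \<noteq> 0" "r\<^sup>2 = c2 / c1" using c by (simp_all add: r_def)
  show ?case
    unfolding Let_def r_def[symmetric] aw_lattice_eq[OF q r(1)]
    by (intro conjI askey_wilson_classification[OF q r(1) P c r(2)] allI impI
        basic_hyp_eq_askey_wilson[OF q r])
next
  case 2
  show ?case
    unfolding Let_def
    by (intro conjI wilson_classification[OF P c4] allI impI hyp_eq_wilson hyp_eq_cont_dual_hahn)
qed

end
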